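(* Consider the equation $$\dot x=Ax+f(t,x)+\varepsilon g(t,x,\varepsilon),\qquad( * )$$ and assume that one of the following two sets of hypotheses is satisfied. Analytic compact case: $A$ is a generator of an analytic compact semigroup $e^{At}$ in $E$. The operators $f,g$ are subordinated to some $A^{-\alpha}$, $0<\alpha<1$ (so $f(t,A^{-\alpha}\xi)$ and $g(t,A^{-\alpha}\xi,\varepsilon)$ are considered as functions of $\xi\in E$), the operator $f(\cdot,A^{-\alpha}\cdot)$ is differentiable in the second variable, and the operators $f'_{(2)}(\cdot,A^{-\alpha}\cdot)$ (derivative in the second variable) and $g(\cdot,A^{-\alpha}\cdot,\cdot)$ are continuous and satisfy a Lipschitz condition in the second variable uniformly with respect to the other variables. Contractive case: $A$ is a generator of a $C_0$-semigroup $e^{At}$ which is contractive, namely $\|e^{At}\|\le e^{-\gamma t}$ with $\gamma>0$. The operators $f$ and $g$ are continuous and verify $\chi(f(t,\Omega))\le k'\chi(\Omega)$, $\chi(g(t,\Omega,\varepsilon))\le k'\chi(\Omega)$ for bounded $\Omega\subset E$, where $k'\ge0$, $q=k'/\gamma<1$, and $\chi$ is the Hausdorff measure of noncompactness. The operator $f$ is differentiable in the second variable and the operators $f'_{(2)}$ and $g$ are continuous and satisfy a Lipschitz condition in the second variable uniformly with respect to the other variables. Let $\xi_0\in E$ and assume that the solution $x(\cdot,\xi_0,0)$ of $( * )$ with $\varepsilon=0$ satisfying $x(0)=\xi_0$ is defined on $[0,T]$. Assume that there exists a function $S\in C^1(V,E)$ defined on some open neighborhood $V\subset\mathbb{R}^k$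 of a point $h_0$ such that $S(h_0)=\xi_0$ and $\mathcal{P}_0(\xi)=\xi$ for any $\xi\in\bigcup_{h\in V}\{S(h)\}$, and that $\dim S'(h_0)\mathbb{R}^k=k$. Let $E_{1,h}=S'(h)\mathbb{R}^k$, let $E_{2,h}$ be any subspace of $E$ such that $E=E_{1,h}\oplus E_{2,h}$, and assume that both the projectors $\pi_{1,h}$ of $E$ onto $E_{1,h}$ along $E_{2,h}$ and $\pi_{2,h}$ of $E$ onto $E_{2,h}$ along $E_{1,h}$ are continuous in $h\in V$, and that $\pi_{2,h_0}((\mathcal{P}_0)'(\xi_0)-I)\pi_{2,h_0}$ is invertible on $E_{2,h_0}$. Assume that there exist a sequence $\varepsilon_n\in(0,1]$ with $\varepsilon_n\to0$ as $n\to\infty$ and a sequence of $T$-periodic functions $x_n\in C^0([0,T],E)$ with $x_n\to x(\cdot,\xi_0,0)$ as $n\to\infty$ such that $(x_n,\varepsilon_n)$ solves $( * )$. Then $$M(h_0)=0,$$ where $M$ is the bifurcation function defined in the context.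
   Context: Setting: $E$ is a Banach space, $T>0$, $A:D(A)\to E$, $D(A)\subset E$, is the infinitesimal generator of a semigroup $e^{At}$ of linear operators in $E$, and $f\in C^1(\mathbb{R}\times E,E)$, $g\in C^0(\mathbb{R}\times E\times[0,1],E)$ are $T$-periodic in the first variable. $I$ is the identity operator. The equation under study is $\dot x=Ax+f(t,x)+\varepsilon g(t,x,\varepsilon)$, denoted $( * )$. Two alternative sets of hypotheses, called the analytic compact case and the contractive case, are written out in the claim. In the analytic compact case, $A^{\alpha}$, $A^{-\alpha}$ denote the fractional powers in the usual sense of analytic semigroup theory (i.e. the fractional powers of $-A$), which are assumed to be defined, $A^{-\alpha}$ being bounded. In the contractive case, $\chi(\Omega)=\inf\{r>0:\text{there exist finitely many } y_1,\dots,y_m \text{ such that }\Omega\subset\bigcup_{i=1}^mB(y_i,r)\}$ is the Hausdorff measure of noncompactness of a bounded set $\Omega\subset E$, where $B(y,r)$ is the ball in $E$ centered at $y$ with radius $r$. Solutions and Poincaré map: put $\alpha=0$ (so $A^{\pm\alpha}=I$) in the contractive case. Solutions of $( * )$ are understood as continuous solutions of $$x(t)=e^{At}\xi+\int_0^tA^\alpha e^{A(t-s)}\left[f(s,A^{-\alpha}x(s))+\varepsilon g(s,A^{-\alpha}x(s),\varepsilon)\right]ds,\qquad \xi=x(0).$$ For $\xi\in E$, $\varepsilon\in[0,1]$ this has a unique solution, denoted $x(t,\xi,\varepsilon)$, on some interval $[0,d]$; when it is defined on $[0,T]$ the Poincaré map is $\mathcal{P}_\varepsilon(\xi)=x(T,\xi,\varepsilon)$.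 A solution on $[0,T]$ is $T$-periodic if $x(0)=x(T)$. If $\mathcal{P}_0$ is defined at $\xi_0$, then it is defined and differentiable near $\xi_0$. Bifurcation function: for $\xi$ near $\xi_0$ let $\eta(\xi)=y(T)$, where $y$ is the solution of $$\dot y=Ay+f'_x(t,x(t,\xi,0))y+g(t,x(t,\xi,0),0),\qquad y(0)=0,$$ understood as $y(t)=\int_0^tA^\alpha e^{A(t-s)}\left[D_2\hat f(s,x(s,\xi,0))y(s)+g(s,A^{-\alpha}x(s,\xi,0),0)\right]ds$, where $\hat f(s,z)=f(s,A^{-\alpha}z)$ and $D_2$ is the derivative in the second variable. For $h$ in a small neighborhood of $h_0$ define $M(h)\in\mathbb{R}^k$ by $$M(h)=\left(S'(h)\right)^{-1}\pi_{1,h}\left[\eta(S(h))-\left((\mathcal{P}_0)'(S(h))-I\right)\left(\pi_{2,h}((\mathcal{P}_0)'(S(h))-I)\pi_{2,h}\right)^{-1}\pi_{2,h}\eta(S(h))\right],$$ where $(S'(h))^{-1}$ is the inverse of $S'(h):\mathbb{R}^k\to E_{1,h}$ and $\left(\pi_{2,h}((\mathcal{P}_0)'(S(h))-I)\pi_{2,h}\right)^{-1}$ is the inverse on $E_{2,h}$; both exist for $h$ close to $h_0$. *)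

theory Defs
  imports "HOL-Analysis.Analysis"
begin

section \<open>Semigroups and generators\<close>

definition C0_semigroup :: "(real \<Rightarrow> 'e::banach \<Rightarrow>\<^sub>L 'e) \<Rightarrow> bool" where
  "C0_semigroup U \<longleftrightarrow>
     U 0 = id_blinfun \<and>
     (\<forall>s\<ge>0. \<forall>t\<ge>0. U (s + t) = U s o\<^sub>L U t) \<and>
     (\<forall>x. ((\<lambda>t. U t x) \<longlongrightarrow> x) (at_right 0))"

text \<open>An unbounded operator is a function together with its domain; its values off the
  domain are irrelevant.\<close>

definition infinitesimal_generator ::
  "('e::banach \<Rightarrow> 'e) \<Rightarrow> 'e set \<Rightarrow> (real \<Rightarrow> 'e \<Rightarrow>\<^sub>L 'e) \<Rightarrow> bool" where
  "infinitesimal_generator A D U \<longleftrightarrow>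
     D = {x. \<exists>y. ((\<lambda>t. (U t x - x) /\<^sub>R t) \<longlongrightarrow> y) (at_right 0)} \<and>
     (\<forall>x\<in>D. ((\<lambda>t. (U t x - x) /\<^sub>R t) \<longlongrightarrow> A x) (at_right 0))"

definition compact_semigroup :: "(real \<Rightarrow> 'e::banach \<Rightarrow>\<^sub>L 'e) \<Rightarrow> bool" where
  "compact_semigroup U \<longleftrightarrow>
     (\<forall>t>0. \<forall>B. bounded B \<longrightarrow> compact (closure (blinfun_apply (U t) ` B)))"

definition sector :: "real \<Rightarrow> complex set" where
  "sector \<delta> = {z. z \<noteq> 0 \<and> \<bar>Arg z\<bar> < \<delta>}"

text \<open>The space is real, so analyticity refers to the complexification, realised as
  \<open>'e \<times> 'e\<close> with multiplication by the imaginary unit given by \<open>imag_unit\<close>. The product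
  norm is not homogeneous over the complex numbers, but it is equivalent to the usual norms on
  the complexification, which is all that matters here.\<close>

definition imag_unit :: "('e::banach \<times> 'e) \<Rightarrow>\<^sub>L ('e \<times> 'e)" where
  "imag_unit = Blinfun (\<lambda>(x, y). (- y, x))"

text \<open>The derivative clause says that \<open>Z\<close> is holomorphic in operator norm, with complex
  derivative \<open>Z'\<close>.\<close>

definition analytic_semigroup :: "(real \<Rightarrow> 'e::banach \<Rightarrow>\<^sub>L 'e) \<Rightarrow> bool" where
  "analytic_semigroup U \<longleftrightarrow>
     C0_semigroup U \<and>
     (\<exists>\<delta> Z. 0 < \<delta> \<and> \<delta> \<le> pi / 2 \<and>
        (\<forall>t\<ge>0. \<forall>x y. blinfun_apply (Z (complex_of_real t)) (x, y) = (U t x, U t y)) \<and>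
        (\<forall>z\<in>sector \<delta>. Z z o\<^sub>L imag_unit = imag_unit o\<^sub>L Z z) \<and>
        (\<forall>z\<in>sector \<delta>. \<exists>Z'.
           (Z has_derivative (\<lambda>w. Re w *\<^sub>R Z' + Im w *\<^sub>R (imag_unit o\<^sub>L Z'))) (at z)) \<and>
        (\<forall>z\<in>sector \<delta>. \<forall>w\<in>sector \<delta>. Z (z + w) = Z z o\<^sub>L Z w) \<and>
        (\<forall>u. ((\<lambda>z. blinfun_apply (Z z) u) \<longlongrightarrow> u) (at 0 within sector \<delta>)))"

section \<open>Fractional powers of \<open>-A\<close>\<close>

definition is_resolvent ::
  "('e::banach \<Rightarrow> 'e) \<Rightarrow> 'e set \<Rightarrow> real \<Rightarrow> ('e \<Rightarrow>\<^sub>L 'e) \<Rightarrow> bool" where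
  "is_resolvent A D s R \<longleftrightarrow>
     (\<forall>x. R x \<in> D \<and> s *\<^sub>R R x - A (R x) = x) \<and>
     (\<forall>x\<in>D. R (s *\<^sub>R x - A x) = x)"

definition resolvent :: "('e::banach \<Rightarrow> 'e) \<Rightarrow> 'e set \<Rightarrow> real \<Rightarrow> 'e \<Rightarrow>\<^sub>L 'e" where
  "resolvent A D s = (THE R. is_resolvent A D s R)"

text \<open>For \<open>0 < \<alpha> < 1\<close>, the negative power is given by the classical (Balakrishnan) formula
  \<open>(-A)\<^sup>-\<^sup>\<alpha> = sin (\<pi>\<alpha>) / \<pi> \<integral> s\<^sup>-\<^sup>\<alpha> (s I - A)\<^sup>-\<^sup>1 ds\<close> over \<open>(0, \<infinity>)\<close>. The
  positive power is the inverse of the negative one, with domain \<open>range (neg_power A D \<alpha>)\<close>.\<close>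

definition neg_power :: "('e::banach \<Rightarrow> 'e) \<Rightarrow> 'e set \<Rightarrow> real \<Rightarrow> 'e \<Rightarrow> 'e" where
  "neg_power A D \<alpha> x =
     (if \<alpha> = 0 then x
      else (sin (pi * \<alpha>) / pi) *\<^sub>R integral {0..} (\<lambda>s. (s powr (- \<alpha>)) *\<^sub>R resolvent A D s x))"

definition pos_power :: "('e::banach \<Rightarrow> 'e) \<Rightarrow> 'e set \<Rightarrow> real \<Rightarrow> 'e \<Rightarrow> 'e" where
  "pos_power A D \<alpha> = inv (neg_power A D \<alpha>)"

text \<open>The first conjunct is the standard condition under which the formula converges (\<open>-A\<close> is
  an operator of positive type).\<close>

definition powers_defined :: "('e::banach \<Rightarrow> 'e) \<Rightarrow> 'e set \<Rightarrow> real \<Rightarrow> bool" where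
  "powers_defined A D \<alpha> \<longleftrightarrow>
     (\<exists>M. \<forall>s\<ge>0. \<exists>R. is_resolvent A D s R \<and> norm R \<le> M / (1 + s)) \<and>
     bounded_linear (neg_power A D \<alpha>) \<and> inj (neg_power A D \<alpha>)"

section \<open>Hypotheses on the nonlinearities\<close>

definition C1_on :: "('a::real_normed_vector \<Rightarrow> 'b::real_normed_vector) \<Rightarrow> 'a set \<Rightarrow> bool" where
  "C1_on F V \<longleftrightarrow>
     (\<exists>F'. (\<forall>x\<in>V. (F has_derivative blinfun_apply (F' x)) (at x)) \<and> continuous_on V F')"

definition lipschitz_hypotheses ::
  "(real \<Rightarrow> 'e::banach \<Rightarrow> 'e) \<Rightarrow> (real \<Rightarrow> 'e \<Rightarrow> real \<Rightarrow> 'e) \<Rightarrow> bool" where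
  "lipschitz_hypotheses f g \<longleftrightarrow>
     (\<exists>f'. (\<forall>t x. (f t has_derivative blinfun_apply (f' t x)) (at x)) \<and>
           continuous_on UNIV (\<lambda>(t, x). f' t x) \<and>
           (\<exists>L. \<forall>t x y. norm (f' t x - f' t y) \<le> L * norm (x - y))) \<and>
     continuous_on (UNIV \<times> UNIV \<times> {0..1}) (\<lambda>(t, x, \<epsilon>). g t x \<epsilon>) \<and>
     (\<exists>L. \<forall>t x y. \<forall>\<epsilon>\<in>{0..1}. norm (g t x \<epsilon> - g t y \<epsilon>) \<le> L * norm (x - y))"

definition hausdorff_mnc :: "'e::metric_space set \<Rightarrow> real" where
  "hausdorff_mnc \<Omega> = Inf {r. 0 < r \<and> (\<exists>Y. finite Y \<and> \<Omega> \<subseteq> (\<Union>y\<in>Y. ball y r))}"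

definition analytic_compact_case where
  "analytic_compact_case A D U \<alpha> f g \<longleftrightarrow>
     analytic_semigroup U \<and> compact_semigroup U \<and> infinitesimal_generator A D U \<and>
     0 < \<alpha> \<and> \<alpha> < 1 \<and> powers_defined A D \<alpha> \<and>
     lipschitz_hypotheses (\<lambda>t x. f t (neg_power A D \<alpha> x)) (\<lambda>t x \<epsilon>. g t (neg_power A D \<alpha> x) \<epsilon>)"

definition contractive_case where
  "contractive_case A D U f g \<longleftrightarrow>
     C0_semigroup U \<and> infinitesimal_generator A D U \<and>
     continuous_on UNIV (\<lambda>(t, x). f t x) \<and>
     lipschitz_hypotheses f g \<and>
     (\<exists>\<gamma>>0. \<exists>k\<ge>0. k / \<gamma> < 1 \<and>
        (\<forall>t\<ge>0. norm (U t) \<le> exp (- \<gamma> * t)) \<and>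
        (\<forall>t \<Omega>. bounded \<Omega> \<longrightarrow> hausdorff_mnc (f t ` \<Omega>) \<le> k * hausdorff_mnc \<Omega>) \<and>
        (\<forall>t \<Omega>. \<forall>\<epsilon>\<in>{0..1}. bounded \<Omega> \<longrightarrow>
           hausdorff_mnc ((\<lambda>x. g t x \<epsilon>) ` \<Omega>) \<le> k * hausdorff_mnc \<Omega>))"

section \<open>Solutions, Poincare map and bifurcation function\<close>

text \<open>\<open>mild_solution A D U \<alpha> f g \<epsilon> d x\<close>: \<open>x\<close> is a solution on \<open>{0..d}\<close> with initial value
  \<open>x 0\<close>. The value of the integrand at \<open>s = t\<close>, where \<open>pos_power\<close> may be applied outside its
  domain, does not influence the integral.\<close>

definition mild_solution where
  "mild_solution A D U \<alpha> f g \<epsilon> d x \<longleftrightarrow>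
     continuous_on {0..d} x \<and>
     (\<forall>t\<in>{0..d}.
        ((\<lambda>s. pos_power A D \<alpha> (blinfun_apply (U (t - s))
                 (f s (neg_power A D \<alpha> (x s)) + \<epsilon> *\<^sub>R g s (neg_power A D \<alpha> (x s)) \<epsilon>)))
         has_integral (x t - blinfun_apply (U t) (x 0))) {0..t})"

definition solution_exists where
  "solution_exists A D U \<alpha> f g \<epsilon> d \<xi> \<longleftrightarrow> (\<exists>x. mild_solution A D U \<alpha> f g \<epsilon> d x \<and> x 0 = \<xi>)"

text \<open>\<open>solution A D U \<alpha> f g \<xi> \<epsilon> t\<close> is \<open>x(t, \<xi>, \<epsilon>)\<close>; it is meaningful if
  \<open>solution_exists A D U \<alpha> f g \<epsilon> t \<xi>\<close>.\<close>

definition solution where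
  "solution A D U \<alpha> f g \<xi> \<epsilon> t = (THE v. \<exists>x. mild_solution A D U \<alpha> f g \<epsilon> t x \<and> x 0 = \<xi> \<and> v = x t)"

definition poincare where
  "poincare A D U \<alpha> f g T \<epsilon> \<xi> = solution A D U \<alpha> f g \<xi> \<epsilon> T"

definition variational_solution where
  "variational_solution A D U \<alpha> f g T \<xi> y \<longleftrightarrow>
     continuous_on {0..T} y \<and>
     (\<forall>t\<in>{0..T}.
        ((\<lambda>s. let x = solution A D U \<alpha> f g \<xi> 0 s in
               pos_power A D \<alpha> (blinfun_apply (U (t - s))
                 (frechet_derivative (\<lambda>z. f s (neg_power A D \<alpha> z)) (at x) (y s) +
                  g s (neg_power A D \<alpha> x) 0)))
         has_integral y t) {0..t})"

definition eta where
  "eta A D U \<alpha> f g T \<xi> = (THE v. \<exists>y. variational_solution A D U \<alpha> f g T \<xi> y \<and> v = y T)"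

definition complementary :: "'e::real_vector set \<Rightarrow> 'e set \<Rightarrow> bool" where
  "complementary E1 E2 \<longleftrightarrow>
     subspace E1 \<and> subspace E2 \<and> E1 \<inter> E2 = {0} \<and> (\<forall>x. \<exists>u\<in>E1. \<exists>v\<in>E2. x = u + v)"

definition projector_onto_along :: "('e::real_normed_vector \<Rightarrow>\<^sub>L 'e) \<Rightarrow> 'e set \<Rightarrow> 'e set \<Rightarrow> bool" where
  "projector_onto_along p E1 E2 \<longleftrightarrow> (\<forall>x. p x \<in> E1 \<and> x - p x \<in> E2)"

definition poincare_deriv_minus_id where
  "poincare_deriv_minus_id A D U \<alpha> f g T \<xi> v =
     frechet_derivative (poincare A D U \<alpha> f g T 0) (at \<xi>) v - v"

definition bifurcation_function ::
  "('e::banach \<Rightarrow> 'e) \<Rightarrow> 'e set \<Rightarrow> (real \<Rightarrow> 'e \<Rightarrow>\<^sub>L 'e) \<Rightarrow> real \<Rightarrow>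
   (real \<Rightarrow> 'e \<Rightarrow> 'e) \<Rightarrow> (real \<Rightarrow> 'e \<Rightarrow> real \<Rightarrow> 'e) \<Rightarrow> real \<Rightarrow>
   (real ^ 'k \<Rightarrow> 'e) \<Rightarrow> (real ^ 'k \<Rightarrow> 'e set) \<Rightarrow>
   (real ^ 'k \<Rightarrow> 'e \<Rightarrow>\<^sub>L 'e) \<Rightarrow> (real ^ 'k \<Rightarrow> 'e \<Rightarrow>\<^sub>L 'e) \<Rightarrow> real ^ 'k \<Rightarrow> real ^ 'k" where
  "bifurcation_function A D U \<alpha> f g T S E2 \<pi>1 \<pi>2 h =
     (let Q = poincare_deriv_minus_id A D U \<alpha> f g T (S h);
          e = eta A D U \<alpha> f g T (S h)
      in inv (frechet_derivative S (at h))
           (\<pi>1 h (e - Q (inv_into (E2 h) (\<lambda>v. \<pi>2 h (Q (\<pi>2 h v))) (\<pi>2 h e)))))"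

end

theory Submission
  imports Defs
begin

text \<open>In both cases \<open>A\<^sup>\<alpha> e\<^sup>A\<^sup>\<tau>\<close> is a strongly continuous kernel with norm at most
  \<open>C * \<tau> powr (- \<alpha>)\<close>, so mild solutions solve a weakly singular Volterra equation, and a weighted
  supremum norm gives existence, uniqueness and smooth dependence on the data. If \<open>x\<^sub>n\<close> is the
  periodic solution for \<open>\<epsilon>\<^sub>n\<close>, the inverse function theorem provides \<open>h\<^sub>n\<close> tending to \<open>h0\<close> with
  \<open>\<beta>\<^sub>n = x\<^sub>n 0 - S h\<^sub>n\<close> in the complement \<open>E2\<close>. Comparing \<open>x\<^sub>n\<close> with the unperturbed solution
  through \<open>S h\<^sub>n\<close> yields \<open>Q \<beta>\<^sub>n + \<epsilon>\<^sub>n \<eta> = o(\<bar>\<beta>\<^sub>n\<bar> + \<epsilon>\<^sub>n)\<close>, where \<open>Q\<close> is the derivative of the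
  Poincare map minus the identity. Nondegeneracy on \<open>E2\<close> makes \<open>\<beta>\<^sub>n / \<epsilon>\<^sub>n\<close> converge, and in the
  limit \<open>\<eta>\<close> equals \<open>Q\<close> applied to the solution of the projected equation.\<close>

section \<open>Uniform boundedness and bounded inverses\<close>

text \<open>The overview only asserts the kernel bound, which is the hard part of the analytic case.
  There \<open>pos_power\<close> is merely the inverse of the Balakrishnan integral, so it must even
  be shown that \<open>U \<tau>\<close> maps into its domain. Both follow from a factorization: the
  resolvent at 0 is a multiple of a product of two such integrals with complementary exponents, and
  \<open>U \<tau> v\<close> is the resolvent at 0 applied to \<open>- A (U \<tau> v)\<close>.
  Cancelling one factor leaves the complementary integral of \<open>- A (U \<tau> v)\<close>.
  Interpolation between the bounded \<open>U \<tau>\<close> and its image under A, of size 1 /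
  \<tau> by Cauchy's estimate, gives \<tau> to the power -\<alpha>. The second obstacle is that the
  unperturbed solution used for comparison changes with n. Differentiability at the fixed initial
  value does not control the difference of two moving points; the expansion must be uniform in both,
  and this is where the Lipschitz condition on the derivative enters. The final limit is organized
  by tolerances: for each one, a single displacement in \<open>E2\<close> and a single positive
  \<epsilon> suffice.\<close>

lemma countable_closed_cover_has_interior:
  fixes F :: "nat \<Rightarrow> 'a::banach set"
  assumes "\<And>n. closed (F n)" and "(\<Union>n. F n) = UNIV"
  obtains n x r where "r > 0" "ball x r \<subseteq> F n"
proof -
  have "\<exists>n. interior (F n) \<noteq> {}"
  proof (rule ccontr)
    assume "\<nexists>n. interior (F n) \<noteq> {}"
    then have "euclidean interior_of (\<Union>(range F)) = {}"
      using assms(1)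
      by (intro Baire_category_alt) (auto simp: completely_metrizable_space_euclidean)
    then show False
      using assms(2) by auto
  qed
  then obtain n x where "x \<in> interior (F n)" by auto
  then show thesis
    using that by (auto simp: mem_interior)
qed

text \<open>Baire's theorem turns pointwise bounds into one ball on which all operators are bounded
  by the same n. It is applied to semigroups, where only strong convergence at 0 is given.\<close>

theorem uniform_boundedness:
  fixes B :: "'i \<Rightarrow> 'a::banach \<Rightarrow>\<^sub>L 'b::real_normed_vector"
  assumes "\<And>x. bounded (range (\<lambda>i. B i x))"
  obtains M where "\<And>i. norm (B i) \<le> M"
proof -
  define F where "F n = {x. \<forall>i. norm (B i x) \<le> real n}" for n
  have "closed (F n)" for n
    unfolding F_def by (intro closed_Collect_all closed_Collect_le continuous_intros)
  moreover have "(\<Union>n. F n) = UNIV"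
  proof (intro equalityI subsetI UNIV_I)
    fix x
    obtain b where b: "\<And>i. norm (B i x) \<le> b"
      using assms[of x] by (auto simp: bounded_iff)
    obtain n where "b \<le> real n"
      using real_arch_simple by blast
    then show "x \<in> (\<Union>n. F n)"
      using b by (auto simp: F_def intro: order_trans)
  qed
  ultimately obtain n x r where r: "r > 0" "ball x r \<subseteq> F n"
    by (rule countable_closed_cover_has_interior)
  \<comment> \<open>A vector of norm r / 2 is a difference of two points of the ball, so its image
    has norm at most 2 * n; rescaling gives the constant.\<close>
  have "norm (B i) \<le> 4 * real n / r" for i
  proof (rule norm_blinfun_bound)
    fix y
    show "norm (B i y) \<le> 4 * real n / r * norm y"
    proof (cases "y = 0")
      case False
      define z where "z = (r / (2 * norm y)) *\<^sub>R y"
      have "norm z = r / 2"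
        using r False by (simp add: z_def)
      then have "x \<in> F n" "x + z \<in> F n"
        using r by (auto intro!: subsetD[OF r(2)] simp: dist_norm)
      then have "norm (B i (x + z)) \<le> n" "norm (B i x) \<le> n"
        by (auto simp: F_def)
      moreover have "B i z = B i (x + z) - B i x"
        by (simp add: blinfun.add_right)
      ultimately have "norm (B i z) \<le> 2 * n"
        using norm_triangle_ineq4[of "B i (x + z)" "B i x"] by simp
      moreover have "norm (B i z) = r / (2 * norm y) * norm (B i y)"
        using r by (simp add: z_def blinfun.scaleR_right)
      ultimately show ?thesis
        using r False by (simp add: field_simps)
    qed simp
  qed (use r in auto)
  then show thesis
    by (rule that)
qed

text \<open>By Baire, some ball lies in the closure of the image of a ball, so every y has an
  approximate preimage of comparable norm that leaves at most half of y uncorrected. Summing the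
  corrections gives an exact preimage of \<open>L x\<close> of controlled norm, and by injectivity
  it is x.\<close>

theorem bijective_blinfun_bounded_below:
  fixes L :: "'a::banach \<Rightarrow>\<^sub>L 'b::banach"
  assumes "bij L"
  obtains c where "c > 0" "\<And>x. norm x \<le> c * norm (L x)"
proof -
  define F where "F n = closure (L ` ball 0 (real n))" for n
  have "(\<Union>n. F n) = UNIV"
  proof (intro equalityI subsetI UNIV_I)
    fix y
    obtain x where "L x = y"
      using surjD[OF bij_is_surj[OF assms], of y] by metis
    moreover obtain n where "norm x < real n"
      using reals_Archimedean2 by blast
    ultimately have "y \<in> L ` ball 0 (real n)" by auto
    then show "y \<in> (\<Union>n. F n)"
      unfolding F_def by (blast intro: subsetD[OF closure_subset])
  qed
  moreover have "closed (F n)" for n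
    by (simp add: F_def)
  ultimately obtain n y0 r where r: "r > 0" "ball y0 r \<subseteq> F n"
    by (metis countable_closed_cover_has_interior)
  define c where "c = 4 * real n / r"
  have step: "\<exists>x. norm x \<le> c * norm y \<and> norm (y - L x) \<le> norm y / 2" for y
  proof (cases "y = 0")
    case False
    \<comment> \<open>This scale keeps \<open>y0 + k *\<^sub>R y\<close> inside the ball. The
      tolerance r / 8, used twice below, adds up to r / 4, which after division by k is exactly half
      of \<open>norm y\<close>.\<close>
    define k where "k = r / (2 * norm y)"
    have k: "k > 0" "k * norm y = r / 2"
      using r False by (auto simp: k_def)
    have "y0 \<in> F n" "y0 + k *\<^sub>R y \<in> F n"
      using r k by (auto intro!: subsetD[OF r(2)] simp: dist_norm)
    then have *: "\<exists>u. norm u < n \<and> dist (L u) y0 < r / 8"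
      "\<exists>v. norm v < n \<and> dist (L v) (y0 + k *\<^sub>R y) < r / 8"
      using r unfolding F_def closure_approachable
      by (force dest!: spec[of _ "r / 8"])+
    obtain u v where uv: "norm u < n" "norm v < n" "dist (L u) y0 < r / 8"
      "dist (L v) (y0 + k *\<^sub>R y) < r / 8"
      using * by blast
    define x where "x = (1 / k) *\<^sub>R (v - u)"
    have "norm (v - u) \<le> 2 * n"
      using uv norm_triangle_ineq4[of v u] by simp
    then have "norm x \<le> 2 * n / k"
      using k by (simp add: x_def divide_right_mono)
    also have "\<dots> = c * norm y"
      using k r False by (simp add: c_def k_def field_simps)
    finally have 1: "norm x \<le> c * norm y" .
    have "norm (L (v - u) - k *\<^sub>R y) = norm ((L v - (y0 + k *\<^sub>R y)) - (L u - y0))"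
      by (simp add: blinfun.diff_right algebra_simps)
    also have "\<dots> \<le> r / 8 + r / 8"
      using uv norm_triangle_ineq4[of "L v - (y0 + k *\<^sub>R y)" "L u - y0"]
      by (simp add: dist_norm)
    finally have 2: "norm (L (v - u) - k *\<^sub>R y) \<le> r / 4" by simp
    have "L x = (1 / k) *\<^sub>R L (v - u)"
      by (simp only: x_def blinfun.scaleR_right)
    then have "y - L x = - (1 / k) *\<^sub>R (L (v - u) - k *\<^sub>R y)"
      using k by (simp add: scaleR_diff_right)
    then have "norm (y - L x) = (1 / k) * norm (L (v - u) - k *\<^sub>R y)"
      using k by simp
    also have "\<dots> \<le> (1 / k) * (r / 4)"
      using 2 k by (intro mult_left_mono) auto
    also have "\<dots> = norm y / 2"
      using k r False by (simp add: k_def field_simps)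
    finally show ?thesis using 1 by blast
  qed (auto intro!: exI[of _ 0])
  then obtain h where h: "\<And>y. norm (h y) \<le> c * norm y" "\<And>y. norm (y - L (h y)) \<le> norm y / 2"
    by metis
  have c: "c \<ge> 0"
    using r by (simp add: c_def)
  \<comment> \<open>The geometric series contributes 2 * c; the added 1 secures a positive constant.
    Below, \<open>s k\<close> is the residual after k corrections.\<close>
  have "norm x \<le> (2 * c + 1) * norm (L x)" for x
  proof -
    define s where "s k = ((\<lambda>y. y - L (h y)) ^^ k) (L x)" for k
    have s: "norm (s k) \<le> (1 / 2) ^ k * norm (L x)" for k
    proof (induction k)
      case (Suc k)
      have "norm (s (Suc k)) \<le> norm (s k) / 2"
        using h(2)[of "s k"] by (simp add: s_def)
      then show ?case using Suc by simp
    qed (simp add: s_def)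
    have b: "norm (h (s k)) \<le> c * norm (L x) * (1 / 2) ^ k" for k
      using order_trans[OF h(1)[of "s k"] mult_left_mono[OF s[of k] c]] by (simp add: ac_simps)
    have sg: "summable (\<lambda>k. c * norm (L x) * (1 / 2 :: real) ^ k)"
      by (intro summable_mult summable_geometric) simp
    have sm: "summable (\<lambda>k. h (s k))"
      using b by (intro summable_comparison_test[OF _ sg]) auto
    have part: "L (\<Sum>k<m. h (s k)) = L x - s m" for m
      by (induction m) (simp_all add: s_def blinfun.add_right)
    have "s \<longlonglongrightarrow> 0"
      by (rule Lim_null_comparison[where g="\<lambda>k. (1 / 2) ^ k * norm (L x)"])
        (auto intro!: always_eventually s tendsto_mult_left_zero LIMSEQ_power_zero)
    then have "(\<lambda>m. L (\<Sum>k<m. h (s k))) \<longlonglongrightarrow> L x - 0"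
      unfolding part by (intro tendsto_intros)
    moreover have "(\<lambda>m. L (\<Sum>k<m. h (s k))) \<longlonglongrightarrow> L (suminf (\<lambda>k. h (s k)))"
      using sm by (intro tendsto_intros summable_LIMSEQ)
    ultimately have "L x = L (suminf (\<lambda>k. h (s k)))"
      using LIMSEQ_unique by fastforce
    then have "x = suminf (\<lambda>k. h (s k))"
      using injD[OF bij_is_inj[OF assms]] by blast
    then have "norm x \<le> (\<Sum>k. c * norm (L x) * (1 / 2) ^ k)"
      using norm_suminf_le[OF b sg] by simp
    moreover have "(\<Sum>k. c * norm (L x) * (1 / 2 :: real) ^ k) = c * norm (L x) * 2"
      by (subst suminf_mult) (auto simp: suminf_geometric)
    ultimately show ?thesis using norm_ge_zero[of "L x"] by (simp add: algebra_simps del: norm_ge_zero)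
  qed
  then show thesis
    using that[of "2 * c + 1"] c by simp
qed

section \<open>Integrals with an endpoint singularity\<close>

text \<open>Kernels here are continuous only strongly. With a norm bound this suffices along a
  moving vector: split off \<open>B s (F s - F s0)\<close>, which the bound sends to 0.\<close>

lemma strongly_continuous_apply:
  fixes B :: "'s::topological_space \<Rightarrow> 'a::real_normed_vector \<Rightarrow>\<^sub>L 'b::real_normed_vector"
  assumes B: "\<And>v. continuous_on S (\<lambda>s. B s v)" and M: "\<And>s. s \<in> S \<Longrightarrow> norm (B s) \<le> M"
    and F: "continuous_on S F"
  shows "continuous_on S (\<lambda>s. B s (F s))"
  unfolding continuous_on_def
proof
  fix s0 assume s0: "s0 \<in> S"
  have "((\<lambda>s. B s (F s - F s0)) \<longlongrightarrow> 0) (at s0 within S)"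
  proof (rule Lim_null_comparison)
    show "\<forall>\<^sub>F s in at s0 within S. norm (B s (F s - F s0)) \<le> M * norm (F s - F s0)"
      unfolding eventually_at_filter
      by (intro always_eventually allI impI order_trans[OF norm_blinfun] mult_right_mono M) auto
    have "(F \<longlongrightarrow> F s0) (at s0 within S)"
      using F s0 by (simp add: continuous_on_def)
    then show "((\<lambda>s. M * norm (F s - F s0)) \<longlongrightarrow> 0) (at s0 within S)"
      using LIM_zero by (intro tendsto_mult_right_zero tendsto_norm_zero) blast
  qed
  moreover have "((\<lambda>s. B s (F s0)) \<longlongrightarrow> B s0 (F s0)) (at s0 within S)"
    using B[of "F s0"] s0 by (simp add: continuous_on_def)
  ultimately have "((\<lambda>s. B s (F s - F s0) + B s (F s0)) \<longlongrightarrow> 0 + B s0 (F s0)) (at s0 within S)"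
    by (rule tendsto_add)
  then show "((\<lambda>s. B s (F s)) \<longlongrightarrow> B s0 (F s0)) (at s0 within S)"
    by (simp add: blinfun.diff_right)
qed

text \<open>\<open>d = t\<close> is allowed, where the integrand is singular for positive a. The
  antiderivative stays continuous there since 1 - a > 0, so only interior derivatives are
  used.\<close>

lemma has_integral_powr_end:
  fixes a c d t :: real
  assumes "a < 1" "c \<le> d" "d \<le> t"
  shows "((\<lambda>s. (t - s) powr (- a)) has_integral ((t - c) powr (1 - a) - (t - d) powr (1 - a)) / (1 - a)) {c..d}"
proof -
  define \<Phi> where "\<Phi> s = - ((t - s) powr (1 - a) / (1 - a))" for s
  have "((\<lambda>s. (t - s) powr (- a)) has_integral (\<Phi> d - \<Phi> c)) {c..d}"
  proof (rule fundamental_theorem_of_calculus_interior)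
    show "continuous_on {c..d} \<Phi>"
      unfolding \<Phi>_def using assms by (auto intro!: continuous_intros continuous_on_powr')
    fix s assume "s \<in> {c<..<d}"
    then have "s < t" using assms by auto
    then have "((\<lambda>x. x powr (1 - a)) has_real_derivative (1 - a) * (t - s) powr (1 - a - 1)) (at (t - s))"
      by (intro has_real_derivative_powr) simp
    moreover have "((\<lambda>s. t - s) has_real_derivative - 1) (at s)"
      by (auto intro!: derivative_eq_intros)
    ultimately have "((\<lambda>s. (t - s) powr (1 - a)) has_real_derivative
        (1 - a) * (t - s) powr (1 - a - 1) * - 1) (at s)"
      by (rule DERIV_chain2)
    moreover have "- ((1 - a) * (t - s) powr (1 - a - 1) * - 1 / (1 - a)) = (t - s) powr (- a)"
      using assms by simp
    ultimately have "(\<Phi> has_real_derivative (t - s) powr (- a)) (at s)"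
      unfolding \<Phi>_def using DERIV_minus[OF DERIV_cdivide] by metis
    then show "(\<Phi> has_vector_derivative (t - s) powr (- a)) (at s)"
      by (simp add: has_real_derivative_iff_has_vector_derivative)
  qed fact
  then show ?thesis by (simp add: \<Phi>_def diff_divide_distrib)
qed

text \<open>At s = t the kernel will be evaluated at 0, where no bound on it is available. Both
  integrands may be reset at that single point.\<close>

lemma norm_integral_le_except_end:
  fixes f :: "real \<Rightarrow> 'a::banach"
  assumes f: "f integrable_on {0..t}" and g: "g integrable_on {0..t}"
    and le: "\<And>s. s \<in> {0..<t} \<Longrightarrow> norm (f s) \<le> g s"
  shows "norm (integral {0..t} f) \<le> integral {0..t} g"
proof -
  define f' where "f' s = (if s = t then 0 else f s)" for s
  define g' where "g' s = (if s = t then 0 else g s)" for s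
  have "norm (integral {0..t} f') \<le> integral {0..t} g'"
  proof (rule integral_norm_bound_integral)
    show "f' integrable_on {0..t}" "g' integrable_on {0..t}"
      by (rule integrable_spike[OF f, of "{t}"] integrable_spike[OF g, of "{t}"];
          simp add: f'_def g'_def)+
  qed (auto simp: f'_def g'_def le)
  moreover have "integral {0..t} f' = integral {0..t} f" "integral {0..t} g' = integral {0..t} g"
    by (rule integral_spike[of "{t}"]; simp add: f'_def g'_def)+
  ultimately show ?thesis by simp
qed

text \<open>The primitive on \<open>{0..c}\<close> satisfies a Cauchy estimate as c tends to t, by
  the explicit integral of the bound. Its limit extends it continuously to t, and the fundamental
  theorem with interior derivatives then yields integrability.\<close>

lemma integrable_singular_end:
  fixes \<phi> :: "real \<Rightarrow> 'a::banach"
  assumes a: "a < 1" and t: "0 \<le> t"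
    and cont: "\<And>c. c < t \<Longrightarrow> continuous_on {0..c} \<phi>"
    and bd: "\<And>s. s \<in> {0..<t} \<Longrightarrow> norm (\<phi> s) \<le> C * (t - s) powr (- a)"
  shows "\<phi> integrable_on {0..t}"
proof (cases "t = 0")
  case False
  then have t: "t > 0" using t by simp
  then have C: "C \<ge> 0"
    using bd[of 0] order_trans[OF norm_ge_zero] by (force simp: zero_le_mult_iff)
  define \<Psi> where "\<Psi> c = integral {0..c} \<phi>" for c
  define D where "D = C / (1 - a)"
  have int: "\<phi> integrable_on {c..d}" if "0 \<le> c" "d < t" for c d
    by (rule integrable_continuous_real) (use continuous_on_subset[OF cont[OF that(2)]] that in auto)
  have diff: "norm (\<Psi> d - \<Psi> c) \<le> D * (t - c) powr (1 - a)" if "0 \<le> c" "c \<le> d" "d < t" for c d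
  proof -
    have "\<Psi> d - \<Psi> c = integral {c..d} \<phi>"
      unfolding \<Psi>_def using that Henstock_Kurzweil_Integration.integral_combine[of 0 c d \<phi>] int[of 0 d]
      by (simp add: algebra_simps)
    also have "norm \<dots> \<le> integral {c..d} (\<lambda>s. C * (t - s) powr (- a))"
      using that has_integral_powr_end[OF a, of c d t] bd int
      by (intro integral_norm_bound_integral) (auto intro!: integrable_on_mult_right simp: has_integral_iff)
    also have "\<dots> = C * (((t - c) powr (1 - a) - (t - d) powr (1 - a)) / (1 - a))"
      using has_integral_powr_end[OF a, of c d t] that by (simp add: has_integral_iff)
    also have "\<dots> \<le> D * (t - c) powr (1 - a)"
      using a C by (simp add: D_def divide_right_mono mult_left_mono right_diff_distrib)
    finally show ?thesis .
  qed
  have small: "((\<lambda>c. D * (t - c) powr (1 - a)) \<longlongrightarrow> 0) (at t within {0..t})"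
  proof -
    have "continuous_on {0..t} (\<lambda>c. D * (t - c) powr (1 - a))"
      using a by (auto intro!: continuous_intros continuous_on_powr')
    then show ?thesis
      using t a by (auto simp: continuous_on_def dest!: bspec[of _ _ t])
  qed
  define c where "c n = t - t * inverse (real (Suc n))" for n
  have c: "0 \<le> c n" "c n < t" for n
    using t by (auto simp: c_def field_simps)
  have cmono: "c m \<le> c n" if "m \<le> n" for m n
    using t that by (auto simp: c_def intro!: mult_left_mono le_imp_inverse_le)
  have ct: "c \<longlonglongrightarrow> t"
    unfolding c_def by (rule tendsto_eq_intros LIMSEQ_inverse_real_of_nat refl | simp)+
  then have cw: "filterlim c (at t within {0..t}) sequentially"
    using c by (auto simp: filterlim_at intro!: always_eventually less_imp_le)
  have "Cauchy (\<lambda>n. \<Psi> (c n))"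
  proof (rule CauchyI)
    fix e :: real assume "e > 0"
    have "(\<lambda>n. D * (t - c n) powr (1 - a)) \<longlonglongrightarrow> 0"
      using filterlim_compose[OF small cw] .
    then have "\<forall>\<^sub>F n in sequentially. D * (t - c n) powr (1 - a) < e / 2"
      using \<open>e > 0\<close> by (intro order_tendstoD(2)) auto
    then obtain N where N: "D * (t - c N) powr (1 - a) < e / 2"
      using eventually_happens'[OF sequentially_bot] by blast
    have "norm (\<Psi> (c n) - \<Psi> (c N)) < e / 2" if "n \<ge> N" for n
      using diff[of "c N" "c n"] c cmono[OF that] N by (meson le_less_trans)
    then have "norm (\<Psi> (c m) - \<Psi> (c n)) < e" if "m \<ge> N" "n \<ge> N" for m n
      using that norm_triangle_half_l by blast
    then show "\<exists>M. \<forall>m\<ge>M. \<forall>n\<ge>M. norm (\<Psi> (c m) - \<Psi> (c n)) < e" by blast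
  qed
  then obtain l where l: "(\<lambda>n. \<Psi> (c n)) \<longlonglongrightarrow> l"
    using Cauchy_convergent_iff convergent_def by blast
  have lim: "norm (\<Psi> d - l) \<le> D * (t - d) powr (1 - a)" if "0 \<le> d" "d < t" for d
  proof (rule tendsto_upperbound)
    show "(\<lambda>n. norm (\<Psi> d - \<Psi> (c n))) \<longlonglongrightarrow> norm (\<Psi> d - l)"
      by (intro tendsto_intros l)
    have "\<forall>\<^sub>F n in sequentially. d < c n"
      using order_tendstoD(1)[OF ct that(2)] .
    then show "\<forall>\<^sub>F n in sequentially. norm (\<Psi> d - \<Psi> (c n)) \<le> D * (t - d) powr (1 - a)"
      by eventually_elim (metis diff that(1) c(2) less_imp_le norm_minus_commute)
  qed simp
  define \<Phi> where "\<Phi> s = (if s = t then l else \<Psi> s)" for s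
  have "(\<phi> has_integral (\<Phi> t - \<Phi> 0)) {0..t}"
  proof (rule fundamental_theorem_of_calculus_interior)
    have deriv: "(\<Phi> has_vector_derivative \<phi> s) (at s within {0..d})" if "s \<in> {0..d}" "d < t" for s d
      by (rule has_vector_derivative_transform[OF _ _ integral_has_vector_derivative[OF cont[OF that(2)] that(1)]])
        (use that in \<open>auto simp: \<Phi>_def \<Psi>_def\<close>)
    show "(\<Phi> has_vector_derivative \<phi> s) (at s)" if "s \<in> {0<..<t}" for s
    proof -
      have "at s within {0..(s+t)/2} = at s"
        by (rule at_within_interior) (use that in \<open>auto simp: interior_atLeastAtMost_real\<close>)
      then show ?thesis
        using deriv[of s "(s + t) / 2"] that by auto
    qed
    show "continuous_on {0..t} \<Phi>"
      unfolding continuous_on_eq_continuous_within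
    proof
      fix s assume s: "s \<in> {0..t}"
      show "continuous (at s within {0..t}) \<Phi>"
      proof (cases "s = t")
        case True
        have "((\<lambda>s. \<Phi> s - l) \<longlongrightarrow> 0) (at t within {0..t})"
          by (rule Lim_null_comparison[OF _ small])
            (auto simp: eventually_at_filter \<Phi>_def intro!: always_eventually lim)
        then show ?thesis
          using True by (simp add: continuous_within \<Phi>_def LIM_zero_cancel)
      next
        case False
        define d where "d = (s + t) / 2"
        have d: "s < d" "d < t" using False s by (auto simp: d_def)
        have "continuous (at s within {0..d}) \<Phi>"
          using deriv[of s d] s d has_vector_derivative_continuous by auto
        moreover have "at s within {0..t} = at s within {0..d}"
          by (rule at_within_nhd[of s "{..<d}"]) (use d in auto)
        ultimately show ?thesis by simp
      qed
    qed
  qed (use t in simp)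
  then show ?thesis by (auto simp: integrable_on_def)
qed (use integrable_on_refl[of \<phi> "0::real"] in simp)

section \<open>The Volterra operator of a singular kernel\<close>

lemma continuous_on_interval_bound:
  fixes F :: "real \<Rightarrow> 'a::real_normed_vector"
  assumes "continuous_on {a..b} F"
  obtains m where "m > 0" "\<And>s. s \<in> {a..b} \<Longrightarrow> norm (F s) \<le> m"
proof -
  have "bounded (F ` {a..b})"
    using assms compact_continuous_image compact_imp_bounded by blast
  then obtain m where "m > 0" "\<forall>x\<in>F ` {a..b}. norm x \<le> m"
    unfolding bounded_pos by blast
  then show thesis using that by auto
qed

text \<open>U carries the initial value and K the forcing. In the analytic case
  \<open>K \<tau>\<close> is \<open>pos_power\<close> after \<open>U \<tau>\<close>, singular at 0,
  and \<open>K 0\<close> is left open; in the contractive case K is U and \<alpha> is 0.\<close>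

locale mild_kernel =
  fixes U K :: "real \<Rightarrow> 'e::banach \<Rightarrow>\<^sub>L 'e" and T \<alpha> C :: real
  assumes T: "0 < T" and \<alpha>: "0 \<le> \<alpha>" "\<alpha> < 1" and C: "0 < C"
    and U0: "U 0 = id_blinfun"
    and U_cont: "\<And>v. continuous_on {0..T} (\<lambda>t. U t v)"
    and U_bound: "\<And>t. t \<in> {0..T} \<Longrightarrow> norm (U t) \<le> C"
    and K_cont: "\<And>v. continuous_on {0<..T} (\<lambda>t. K t v)"
    and K_bound: "\<And>t. t \<in> {0<..T} \<Longrightarrow> norm (K t) \<le> C * t powr (- \<alpha>)"
begin

definition conv :: "(real \<Rightarrow> 'e) \<Rightarrow> real \<Rightarrow> 'e" where
  "conv F t = integral {0..t} (\<lambda>s. K (t - s) (F s))"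

lemma conv_0 [simp]: "conv F 0 = 0"
  unfolding conv_def using integral_refl[of "0::real"] by (simp add: cbox_interval)

text \<open>A positive lower bound on the time argument turns the singular estimate into a uniform
  one, as \<open>strongly_continuous_apply\<close> requires.\<close>

lemma continuous_on_K_apply:
  assumes "0 < a" "\<phi> ` S \<subseteq> {a..T}" "continuous_on S \<phi>" "continuous_on S F"
  shows "continuous_on S (\<lambda>s. K (\<phi> s) (F s))"
proof (rule strongly_continuous_apply)
  show "continuous_on S (\<lambda>s. K (\<phi> s) v)" for v
    by (rule continuous_on_compose2[OF K_cont assms(3)]) (use assms in force)
  fix s assume "s \<in> S"
  then have s: "a \<le> \<phi> s" "\<phi> s \<le> T" using assms by auto
  then have "\<phi> s powr (- \<alpha>) \<le> a powr (- \<alpha>)"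
    using assms \<alpha> by (intro powr_mono2') auto
  then show "norm (K (\<phi> s)) \<le> C * a powr (- \<alpha>)"
    using K_bound[of "\<phi> s"] s assms C
    by (smt (verit) greaterThanAtMost_iff mult_left_mono)
qed fact

lemma norm_K_apply_le:
  assumes "t \<in> {0..T}" "s \<in> {0..<t}"
  shows "norm (K (t - s) v) \<le> C * (t - s) powr (- \<alpha>) * norm v"
  using assms by (intro order_trans[OF norm_blinfun] mult_right_mono K_bound) auto

lemma conv_integrable:
  assumes t: "t \<in> {0..T}" and F: "continuous_on {0..t} F"
  shows "(\<lambda>s. K (t - s) (F s)) integrable_on {0..t}"
proof -
  obtain m where m: "\<And>s. s \<in> {0..t} \<Longrightarrow> norm (F s) \<le> m"
    using continuous_on_interval_bound[OF F] by metis
  show ?thesis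
  proof (rule integrable_singular_end)
    fix c assume c: "c < t"
    show "continuous_on {0..c} (\<lambda>s. K (t - s) (F s))"
      by (rule continuous_on_K_apply[of "t - c"])
        (use c t in \<open>auto intro!: continuous_intros continuous_on_subset[OF F]\<close>)
  next
    fix s assume s: "s \<in> {0..<t}"
    have "norm (K (t - s) (F s)) \<le> C * (t - s) powr (- \<alpha>) * norm (F s)"
      by (rule norm_K_apply_le[OF t s])
    also have "\<dots> \<le> C * (t - s) powr (- \<alpha>) * m"
      using m s C by (intro mult_left_mono) auto
    finally show "norm (K (t - s) (F s)) \<le> C * m * (t - s) powr (- \<alpha>)"
      by (simp add: ac_simps)
  qed (use \<alpha> t in auto)
qed

lemma conv_has_integral:
  assumes "t \<in> {0..T}" "continuous_on {0..t} F"
  shows "((\<lambda>s. K (t - s) (F s)) has_integral conv F t) {0..t}"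
  unfolding conv_def using conv_integrable[OF assms] by (rule integrable_integral)

lemma conv_diff:
  assumes "t \<in> {0..T}" "continuous_on {0..t} F" "continuous_on {0..t} G"
  shows "conv (\<lambda>s. F s - G s) t = conv F t - conv G t"
  using has_integral_diff[OF conv_has_integral[OF assms(1,2)] conv_has_integral[OF assms(1,3)]]
  by (simp add: conv_def blinfun.diff_right has_integral_iff)

lemma conv_add:
  assumes "t \<in> {0..T}" "continuous_on {0..t} F" "continuous_on {0..t} G"
  shows "conv (\<lambda>s. F s + G s) t = conv F t + conv G t"
  using has_integral_add[OF conv_has_integral[OF assms(1,2)] conv_has_integral[OF assms(1,3)]]
  by (simp add: conv_def blinfun.add_right has_integral_iff)

lemma conv_scaleR: "conv (\<lambda>s. r *\<^sub>R F s) t = r *\<^sub>R conv F t"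
  by (simp add: conv_def blinfun.scaleR_right)

lemma conv_cong: "(\<And>s. s \<in> {0..t} \<Longrightarrow> F s = G s) \<Longrightarrow> conv F t = conv G t"
  unfolding conv_def by (intro Henstock_Kurzweil_Integration.integral_cong) simp

text \<open>A bound for \<open>conv\<close> between sup norms with weight
  \<open>exp (- r * t)\<close>; it tends to 0 as r grows. With \<beta> = (1 - \<alpha>) / 2, the
  factor 2 / (1 - \<alpha>) is 1 / \<beta>, from integrating a power with exponent \<beta> -
  1.\<close>

definition gain :: "real \<Rightarrow> real" where
  "gain r = 2 * C / (1 - \<alpha>) * (T / r) powr ((1 - \<alpha>) / 2)"

text \<open>Half of the integrability margin of the kernel is traded for decay in the weight:
  \<open>exp (- x) \<le> x powr (- \<beta>)\<close> with \<open>\<beta> = (1 - \<alpha>) / 2\<close>.\<close>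

lemma conv_weighted_bound:
  assumes t: "t \<in> {0..T}" and F: "continuous_on {0..t} F" and r: "r > 0"
    and m: "\<And>s. s \<in> {0..t} \<Longrightarrow> norm (F s) \<le> m * exp (r * s)"
  shows "norm (conv F t) \<le> m * exp (r * t) * gain r"
proof -
  define \<beta> where "\<beta> = (1 - \<alpha>) / 2"
  have \<beta>: "0 < \<beta>" "\<beta> \<le> 1" "\<alpha> + \<beta> < 1" "1 - (\<alpha> + \<beta>) = \<beta>"
    using \<alpha> by (auto simp: \<beta>_def field_simps)
  have m0: "m \<ge> 0"
    using m[of 0] order_trans[OF norm_ge_zero] t by fastforce
  define A where "A = m * exp (r * t) * C * r powr (- \<beta>)"
  have A: "A \<ge> 0" using m0 C by (simp add: A_def)
  have ker: "norm (K (t - s) (F s)) \<le> A * (t - s) powr (- (\<alpha> + \<beta>))" if s: "s \<in> {0..<t}" for s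
  proof -
    define x where "x = r * (t - s)"
    have x: "x > 0" using r s by (simp add: x_def)
    have "x powr \<beta> \<le> exp x"
    proof (cases "x \<le> 1")
      case True
      then have "x powr \<beta> \<le> 1"
        using x \<beta> powr_mono2[of \<beta> x 1] by simp
      also have "1 \<le> exp x" using x by simp
      finally show ?thesis .
    next
      case False
      then have "x powr \<beta> \<le> x" using \<beta> powr_mono[of \<beta> 1 x] by simp
      also have "x \<le> exp x" using exp_ge_add_one_self[of x] by linarith
      finally show ?thesis .
    qed
    then have "exp (- x) \<le> x powr (- \<beta>)"
      using x by (simp add: exp_minus powr_minus le_imp_inverse_le)
    then have "exp (r * t) * exp (- x) \<le> exp (r * t) * x powr (- \<beta>)"
      by simp
    moreover have "exp (r * t) * exp (- x) = exp (r * s)"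
      by (simp add: x_def exp_add[symmetric] algebra_simps)
    ultimately have "exp (r * s) \<le> exp (r * t) * x powr (- \<beta>)"
      by simp
    then have "norm (F s) \<le> m * (exp (r * t) * x powr (- \<beta>))"
      using m[of s] s m0 by (meson atLeastAtMost_iff atLeastLessThan_iff less_imp_le mult_left_mono order_trans)
    then have "norm (K (t - s) (F s)) \<le> C * (t - s) powr (- \<alpha>) * (m * (exp (r * t) * x powr (- \<beta>)))"
      using C by (intro order_trans[OF norm_K_apply_le[OF t s]] mult_left_mono) auto
    also have "x powr (- \<beta>) = r powr (- \<beta>) * (t - s) powr (- \<beta>)"
      using r s by (simp add: x_def powr_mult)
    also have "C * (t - s) powr (- \<alpha>) * (m * (exp (r * t) * (r powr (- \<beta>) * (t - s) powr (- \<beta>))))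
      = A * (t - s) powr (- (\<alpha> + \<beta>))"
      using powr_add[of "t - s" "- \<alpha>" "- \<beta>"] by (simp add: A_def)
    finally show ?thesis .
  qed
  have "norm (conv F t) \<le> integral {0..t} (\<lambda>s. A * (t - s) powr (- (\<alpha> + \<beta>)))"
    unfolding conv_def using has_integral_powr_end[OF \<beta>(3), of 0 t t] t
    by (intro norm_integral_le_except_end conv_integrable F ker)
      (auto intro!: integrable_on_mult_right simp: has_integral_iff)
  also have "\<dots> = A * (t powr \<beta> / \<beta>)"
    using has_integral_powr_end[OF \<beta>(3), of 0 t t] t \<beta> by (simp add: has_integral_iff)
  also have "\<dots> \<le> A * (T powr \<beta> / \<beta>)"
    using A t \<beta> by (intro mult_left_mono divide_right_mono powr_mono2) auto
  also have "\<dots> = m * exp (r * t) * gain r"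
    using r T by (simp add: gain_def A_def powr_divide powr_minus divide_simps flip: \<beta>_def) (simp add: \<beta>_def field_simps)
  finally show ?thesis .
qed


lemma gain_pos: "r > 0 \<Longrightarrow> gain r > 0"
  using T \<alpha> C by (simp add: gain_def)

lemma exists_small_gain:
  assumes "b > 0"
  obtains r where "r > 0" "b * gain r \<le> 1 / 2"
proof -
  define \<beta> where "\<beta> = (1 - \<alpha>) / 2"
  have \<beta>: "\<beta> > 0" using \<alpha> by (simp add: \<beta>_def)
  \<comment> \<open>The value of \<open>(T / r) powr \<beta>\<close> at which
    \<open>b * gain r\<close> equals 1 / 2.\<close>
  define A where "A = (1 - \<alpha>) / (4 * C * b)"
  have A: "A > 0" using \<alpha> C assms by (simp add: A_def)
  define r where "r = T / A powr (1 / \<beta>)"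
  have "r > 0" using T A by (simp add: r_def)
  moreover have "T / r = A powr (1 / \<beta>)"
    using T A by (simp add: r_def)
  then have "(T / r) powr \<beta> = A"
    using A \<beta> by (simp add: powr_powr)
  then have "b * gain r = 1 / 2"
    using C assms \<alpha> by (simp add: gain_def A_def field_simps flip: \<beta>_def)
  ultimately show thesis using that by simp
qed

text \<open>The weight under which an integral operator with Lipschitz constant b contracts by 1 /
  2; \<open>growth\<close> is the price for removing that weight on [0, T]. For a fixed kernel both
  depend on b alone, hence not on the solution considered.\<close>

definition rate :: "real \<Rightarrow> real" where
  "rate b = (SOME r. r > 0 \<and> b * gain r \<le> 1 / 2)"

definition growth :: "real \<Rightarrow> real" where
  "growth b = exp (rate b * T)"

lemma rate:
  assumes "b > 0"
  shows "rate b > 0" "b * gain (rate b) \<le> 1 / 2"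
proof -
  have "\<exists>r. r > 0 \<and> b * gain r \<le> 1 / 2"
    using exists_small_gain[OF assms] by metis
  then have "rate b > 0 \<and> b * gain (rate b) \<le> 1 / 2"
    unfolding rate_def by (rule someI_ex)
  then show "rate b > 0" "b * gain (rate b) \<le> 1 / 2" by auto
qed

lemma growth_pos: "growth b > 0"
  by (simp add: growth_def)

text \<open>At the point where the weighted norm of w is maximal, the weighted convolution is at
  most half of this maximum plus half of \<open>\<bar>c\<bar>\<close>, so the maximum absorbs it.
  This avoids iterating a singular kernel.\<close>

lemma conv_gronwall:
  assumes b: "b \<ge> 1" and d: "d \<in> {0..T}" and w: "continuous_on {0..d} w" and \<Phi>: "continuous_on {0..d} \<Phi>"
    and wa: "\<And>t. t \<in> {0..d} \<Longrightarrow> norm (w t) \<le> a + norm (conv \<Phi> t)"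
    and \<Phi>b: "\<And>s. s \<in> {0..d} \<Longrightarrow> norm (\<Phi> s) \<le> b * norm (w s) + c"
    and t: "t \<in> {0..d}"
  shows "norm (w t) \<le> 2 * growth b * (a + \<bar>c\<bar>)"
proof -
  define r where "r = rate b"
  have r: "r > 0" "b * gain r \<le> 1 / 2"
    using rate[of b] b by (auto simp: r_def)
  \<comment> \<open>\<open>b \<ge> 1\<close> bounds \<open>gain r\<close> itself by 1 / 2, which
    controls the term with c.\<close>
  have g: "0 \<le> gain r" "gain r \<le> 1 / 2"
    using r(2) gain_pos[OF r(1)] mult_right_mono[OF b, of "gain r"] by linarith+
  have a: "a \<ge> 0"
    using wa[of 0] order_trans[OF norm_ge_zero] d by fastforce
  define v where "v t = exp (- r * t) * norm (w t)" for t
  have "continuous_on {0..d} v"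
    unfolding v_def by (intro continuous_intros w)
  then have "\<exists>\<tau>\<in>{0..d}. \<forall>t\<in>{0..d}. v t \<le> v \<tau>"
    using d by (intro continuous_attains_sup) auto
  then obtain \<tau> where \<tau>: "\<tau> \<in> {0..d}" "\<And>t. t \<in> {0..d} \<Longrightarrow> v t \<le> v \<tau>"
    by metis
  define m where "m = v \<tau>"
  have m0: "m \<ge> 0" by (simp add: m_def v_def)
  have wm: "norm (w t) \<le> m * exp (r * t)" if "t \<in> {0..d}" for t
    using \<tau>(2)[OF that] by (simp add: m_def[symmetric]) (simp add: v_def exp_minus field_simps)
  have "norm (conv \<Phi> \<tau>) \<le> (b * m + \<bar>c\<bar>) * exp (r * \<tau>) * gain r"
  proof (rule conv_weighted_bound)
    show "continuous_on {0..\<tau>} \<Phi>" by (rule continuous_on_subset[OF \<Phi>]) (use \<tau> in auto)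
    fix s assume s: "s \<in> {0..\<tau>}"
    then have sd: "s \<in> {0..d}" using \<tau> by auto
    have "norm (\<Phi> s) \<le> b * norm (w s) + c" by (rule \<Phi>b[OF sd])
    also have "\<dots> \<le> b * (m * exp (r * s)) + \<bar>c\<bar> * exp (r * s)"
    proof (rule add_mono)
      show "b * norm (w s) \<le> b * (m * exp (r * s))"
        using b wm[OF sd] by (intro mult_left_mono) auto
      have "\<bar>c\<bar> * 1 \<le> \<bar>c\<bar> * exp (r * s)"
        using r s by (intro mult_left_mono) auto
      then show "c \<le> \<bar>c\<bar> * exp (r * s)" by linarith
    qed
    finally show "norm (\<Phi> s) \<le> (b * m + \<bar>c\<bar>) * exp (r * s)"
      by (simp add: algebra_simps)
  qed (use \<tau> d r in auto)
  then have "norm (w \<tau>) \<le> a + (b * m + \<bar>c\<bar>) * exp (r * \<tau>) * gain r"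
    using wa[OF \<tau>(1)] by linarith
  then have "exp (- r * \<tau>) * norm (w \<tau>) \<le> exp (- r * \<tau>) * (a + (b * m + \<bar>c\<bar>) * exp (r * \<tau>) * gain r)"
    by (intro mult_left_mono) auto
  also have "\<dots> = exp (- r * \<tau>) * a + (b * m + \<bar>c\<bar>) * gain r"
    by (simp add: distrib_left exp_minus)
  finally have "m \<le> exp (- r * \<tau>) * a + (b * m + \<bar>c\<bar>) * gain r"
    by (simp add: m_def v_def)
  also have "\<dots> \<le> 1 * a + (m / 2 + \<bar>c\<bar> / 2)"
  proof (rule add_mono)
    show "exp (- r * \<tau>) * a \<le> 1 * a"
      using a r \<tau> by (intro mult_right_mono) auto
    have "m * (b * gain r) \<le> m * (1 / 2)" "\<bar>c\<bar> * gain r \<le> \<bar>c\<bar> * (1 / 2)"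
      using m0 r g by (intro mult_left_mono; simp)+
    then show "(b * m + \<bar>c\<bar>) * gain r \<le> m / 2 + \<bar>c\<bar> / 2"
      by (simp add: algebra_simps)
  qed
  finally have m2: "m \<le> 2 * (a + \<bar>c\<bar>)" by simp
  have "norm (w t) \<le> m * exp (r * t)" by (rule wm[OF t])
  also have "\<dots> \<le> (2 * (a + \<bar>c\<bar>)) * exp (r * T)"
    using m2 a r t d by (intro mult_mono) auto
  finally show ?thesis by (simp add: algebra_simps growth_def r_def)
qed

text \<open>After the reflection of s to t - s the singularity sits at 0 for every t, and t appears
  only in F and in the upper limit. Continuity then follows from uniform continuity of F and of
  \<open>t powr a\<close>.\<close>

lemma conv_continuous:
  assumes F: "continuous_on {0..T} F"
  shows "continuous_on {0..T} (conv F)"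
proof -
  define a where "a = 1 - \<alpha>"
  have a: "a > 0" using \<alpha> by (simp add: a_def)
  obtain m where m: "m > 0" "\<And>s. s \<in> {0..T} \<Longrightarrow> norm (F s) \<le> m"
    using continuous_on_interval_bound[OF F] by metis
  have int: "(\<lambda>\<tau>. K \<tau> (F (t - \<tau>))) integrable_on {0..t} \<and> integral {0..t} (\<lambda>\<tau>. K \<tau> (F (t - \<tau>))) = conv F t"
    if "t \<in> {0..T}" for t
  proof -
    have "((\<lambda>s. K (t - s) (F s)) has_integral conv F t) (cbox 0 t)"
      using conv_has_integral[of t F] that continuous_on_subset[OF F] by (auto simp: cbox_interval)
    from has_integral_affinity[OF this, of "-1" t]
    have "((\<lambda>\<tau>. K \<tau> (F (t - \<tau>))) has_integral conv F t) ((\<lambda>x. t - x) ` {0..t})"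
      by (simp add: cbox_interval)
    then show ?thesis by (auto simp: has_integral_iff)
  qed
  have kint: "((\<lambda>\<tau>. \<tau> powr (- \<alpha>)) has_integral (v powr a - u powr a) / a) {u..v}" if "0 \<le> u" "u \<le> v" for u v
  proof -
    have "((\<lambda>s. (0 - s) powr (- \<alpha>)) has_integral (v powr a - u powr a) / a) {- v..- u}"
      using has_integral_powr_end[OF \<alpha>(2), of "- v" "- u" 0] that by (simp add: a_def)
    then show ?thesis by (subst (asm) has_integral_reflect_real[symmetric]) simp
  qed
  have bound: "norm (conv F t' - conv F t) \<le> C * m * (t' powr a - t powr a) / a + C * \<omega> * T powr a / a"
    if t: "0 \<le> t" "t \<le> t'" "t' \<le> T" and \<omega>: "\<And>s s'. \<lbrakk>s \<in> {0..T}; s' \<in> {0..T}; \<bar>s' - s\<bar> \<le> t' - t\<rbrakk> \<Longrightarrow> norm (F s' - F s) \<le> \<omega>"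
    for t t' \<omega>
  proof -
    let ?G = "\<lambda>t \<tau>. K \<tau> (F (t - \<tau>))"
    have \<omega>0: "\<omega> \<ge> 0" using \<omega>[of 0 0] T t by simp
    have i: "?G t integrable_on {0..t}" "?G t' integrable_on {0..t'}" using int t by auto
    have i': "?G t' integrable_on {0..t}" "?G t' integrable_on {t..t'}"
      using i t by (auto intro: integrable_subinterval_real)
    have i'': "(\<lambda>\<tau>. K \<tau> (F (t' - \<tau>) - F (t - \<tau>))) integrable_on {0..t}"
      using Henstock_Kurzweil_Integration.integrable_diff[OF i'(1) i(1)] by (simp add: blinfun.diff_right)
    have "conv F t' - conv F t = integral {0..t} (?G t') + integral {t..t'} (?G t') - integral {0..t} (?G t)"
      using int[of t] int[of t'] t Henstock_Kurzweil_Integration.integral_combine[of 0 t t' "?G t'"] i by simp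
    also have "\<dots> = integral {t..t'} (?G t') + integral {0..t} (\<lambda>\<tau>. ?G t' \<tau> - ?G t \<tau>)"
      using i i' by (subst Henstock_Kurzweil_Integration.integral_diff) auto
    also have "norm \<dots> \<le> C * m * ((t' powr a - t powr a) / a) + C * \<omega> * ((t powr a - 0) / a)"
    proof (rule norm_triangle_mono)
      have tail: "norm (integral {u..v} H) \<le> C * n * ((v powr a - u powr a) / a)"
        if uv: "0 \<le> u" "u \<le> v" "v \<le> T" and H: "H integrable_on {u..v}"
          and le: "\<And>\<tau>. \<tau> \<in> {u..v} \<Longrightarrow> \<tau> > 0 \<Longrightarrow> norm (H \<tau>) \<le> C * n * \<tau> powr (- \<alpha>)" for u v n and H :: "real \<Rightarrow> 'e"
      proof -
        \<comment> \<open>The bound on K starts at positive times, so the value at 0 is replaced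
          before estimating.\<close>
        let ?H = "\<lambda>\<tau>. if \<tau> = 0 then 0 else H \<tau>"
        have "norm (integral {u..v} ?H) \<le> integral {u..v} (\<lambda>\<tau>. C * n * \<tau> powr (- \<alpha>))"
          using kint[OF uv(1,2)] le uv
          by (intro integral_norm_bound_integral integrable_spike[OF H, of "{0}"])
            (auto intro!: integrable_on_mult_right simp: has_integral_iff)
        moreover have "integral {u..v} ?H = integral {u..v} H"
          by (rule integral_spike[of "{0}"]) auto
        ultimately show ?thesis
          using kint[OF uv(1,2)] by (simp add: has_integral_iff)
      qed
      have Kle: "norm (K \<tau> x) \<le> C * n * \<tau> powr (- \<alpha>)" if "\<tau> \<in> {0<..T}" "norm x \<le> n" for \<tau> x n
      proof -
        have "norm (K \<tau> x) \<le> norm (K \<tau>) * norm x" by (rule norm_blinfun)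
        also have "\<dots> \<le> C * \<tau> powr (- \<alpha>) * n"
          using that K_bound C by (intro mult_mono) auto
        finally show ?thesis by (simp add: ac_simps)
      qed
      show "norm (integral {t..t'} (?G t')) \<le> C * m * ((t' powr a - t powr a) / a)"
        by (rule tail) (use t i' in \<open>auto intro!: Kle m\<close>)
      show "norm (integral {0..t} (\<lambda>\<tau>. ?G t' \<tau> - ?G t \<tau>)) \<le> C * \<omega> * ((t powr a - 0) / a)"
      proof -
        have "norm (integral {0..t} (\<lambda>\<tau>. ?G t' \<tau> - ?G t \<tau>)) \<le> C * \<omega> * ((t powr a - 0 powr a) / a)"
          by (rule tail)
            (use t i'' in \<open>auto intro!: Kle \<omega> simp flip: blinfun.diff_right\<close>)
        then show ?thesis using a by simp
      qed
    qed
    also have "\<dots> \<le> C * m * (t' powr a - t powr a) / a + C * \<omega> * T powr a / a"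
      using \<omega>0 C a t by (auto intro!: divide_right_mono mult_left_mono powr_mono2)
    finally show ?thesis .
  qed
  show ?thesis
    unfolding continuous_on_iff
  proof (intro ballI allI impI)
    fix t e :: real assume t: "t \<in> {0..T}" and e: "e > 0"
    \<comment> \<open>\<open>e1\<close> and \<open>e2\<close> are chosen so that each of the two
      terms of \<open>bound\<close> contributes e / 2.\<close>
    define e1 where "e1 = e * a / (2 * C * m)"
    define e2 where "e2 = e * a / (2 * C * T powr a)"
    have e12: "e1 > 0" "e2 > 0" using e a C m T by (auto simp: e1_def e2_def)
    have "uniformly_continuous_on {0..T} F"
      using F by (intro compact_uniformly_continuous) auto
    then obtain \<delta>1 where \<delta>1: "\<delta>1 > 0" "\<And>s s'. \<lbrakk>s \<in> {0..T}; s' \<in> {0..T}; dist s' s < \<delta>1\<rbrakk> \<Longrightarrow> dist (F s') (F s) < e2"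
      using e12 unfolding uniformly_continuous_on_def by metis
    have "uniformly_continuous_on {0..T} (\<lambda>t. t powr a)"
      using a by (intro compact_uniformly_continuous continuous_on_powr') (auto intro!: continuous_intros)
    then obtain \<delta>2 where \<delta>2: "\<delta>2 > 0" "\<And>s s'. \<lbrakk>s \<in> {0..T}; s' \<in> {0..T}; dist s' s < \<delta>2\<rbrakk> \<Longrightarrow> dist (s' powr a) (s powr a) < e1"
      using e12 unfolding uniformly_continuous_on_def by metis
    have *: "norm (conv F v - conv F u) < e"
      if uv: "u \<in> {0..T}" "v \<in> {0..T}" "u \<le> v" "v - u < min \<delta>1 \<delta>2" for u v
    proof -
      have "norm (F s' - F s) \<le> e2" if "s \<in> {0..T}" "s' \<in> {0..T}" "\<bar>s' - s\<bar> \<le> v - u" for s s'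
        using \<delta>1(2)[OF that(1,2)] that uv by (auto simp: dist_norm)
      then have "norm (conv F v - conv F u) \<le> C * m * (v powr a - u powr a) / a + C * e2 * T powr a / a"
        using uv by (intro bound) auto
      also have "\<dots> < C * m * e1 / a + C * e2 * T powr a / a"
        using \<delta>2(2)[of u v] uv C m a by (auto simp: dist_real_def intro!: divide_strict_right_mono mult_strict_left_mono)
      also have "\<dots> = e"
        using C m a T by (simp add: e1_def e2_def)
      finally show ?thesis .
    qed
    show "\<exists>d>0. \<forall>t'\<in>{0..T}. dist t' t < d \<longrightarrow> dist (conv F t') (conv F t) < e"
    proof (intro exI[of _ "min \<delta>1 \<delta>2"] conjI ballI impI)
      fix t' assume "t' \<in> {0..T}" "dist t' t < min \<delta>1 \<delta>2"
      then show "dist (conv F t') (conv F t) < e"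
        using *[of t t'] *[of t' t] t
        by (cases "t \<le> t'") (auto simp: dist_norm dist_real_def norm_minus_commute)
    qed (use \<delta>1 \<delta>2 in auto)
  qed
qed

text \<open>In the norm with weight \<open>exp (- r * t)\<close>, the integral operator is a contraction.\<close>

lemma conv_fixed_point:
  fixes \<Psi> :: "real \<Rightarrow> 'e \<Rightarrow> 'e"
  assumes b: "b > 0" and R: "R > 0" and p: "continuous_on {0..T} p"
    and pR: "\<And>t. t \<in> {0..T} \<Longrightarrow> norm (p t) \<le> R / (2 * growth b)"
    and \<Psi>c: "\<And>w. continuous_on {0..T} w \<Longrightarrow> continuous_on {0..T} (\<lambda>s. \<Psi> s (w s))"
    and \<Psi>0: "\<And>s. s \<in> {0..T} \<Longrightarrow> \<Psi> s 0 = 0"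
    and lip: "\<And>s y z. \<lbrakk>s \<in> {0..T}; norm y \<le> R; norm z \<le> R\<rbrakk> \<Longrightarrow> norm (\<Psi> s y - \<Psi> s z) \<le> b * norm (y - z)"
  shows "\<exists>w. continuous_on {0..T} w \<and> (\<forall>t\<in>{0..T}. norm (w t) \<le> R \<and> w t = p t + conv (\<lambda>s. \<Psi> s (w s)) t)"
proof -
  define r where "r = rate b"
  have r: "r > 0" "b * gain r \<le> 1 / 2"
    using rate[OF b] by (auto simp: r_def)
  \<comment> \<open>The weighted ball gets radius
    \<open>2 * \<rho> * R = exp (- (r * T)) * R\<close>, so that its members stay below R once the
    weight is removed. The inhomogeneity uses one half of the radius, the integral term the
    other.\<close>
  define \<rho> where "\<rho> = exp (- (r * T)) / 2"
  have pR: "norm (p t) \<le> \<rho> * R" if "t \<in> {0..T}" for t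
    using pR[OF that] by (simp add: \<rho>_def growth_def r_def exp_minus field_simps)
  define w where "w \<zeta> t = exp (r * t) *\<^sub>R apply_bcontfun \<zeta> t" for \<zeta> :: "real \<Rightarrow>\<^sub>C 'e" and t :: real
  have wc: "continuous_on S (w \<zeta>)" for S \<zeta>
    unfolding w_def by (intro continuous_intros continuous_on_apply_bcontfun)
  \<comment> \<open>Clamping time to [0, T] turns curves on the interval into bounded continuous
    functions on the line, a complete space for Banach's theorem.\<close>
  define cl where "cl t = max 0 (min T t)" for t :: real
  have cl: "cl t \<in> {0..T}" "t \<in> {0..T} \<Longrightarrow> cl t = t" for t
    using T by (auto simp: cl_def)
  define G where "G \<zeta> t = exp (- (r * t)) *\<^sub>R (p t + conv (\<lambda>s. \<Psi> s (w \<zeta> s)) t)" for \<zeta> t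
  define X where "X = cball (0 :: real \<Rightarrow>\<^sub>C 'e) (2 * \<rho> * R)"
  have \<rho>R: "2 * \<rho> * R \<ge> 0"
    using R by (simp add: \<rho>_def less_imp_le)
  have wR: "norm (w \<zeta> s) \<le> R" if "\<zeta> \<in> X" "s \<in> {0..T}" for \<zeta> s
  proof -
    have "norm (w \<zeta> s) \<le> exp (r * T) * norm \<zeta>"
      using that r norm_bounded[of \<zeta> s] by (auto simp: w_def intro!: mult_mono)
    also have "\<dots> \<le> exp (r * T) * (2 * \<rho> * R)"
      using that by (intro mult_left_mono) (auto simp: X_def)
    finally show ?thesis by (simp add: \<rho>_def exp_minus field_simps)
  qed
  have Gc: "continuous_on {0..T} (G \<zeta>)" for \<zeta>
    unfolding G_def by (intro continuous_intros p conv_continuous \<Psi>c wc)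
  have Gb: "(\<lambda>t. G \<zeta> (cl t)) \<in> bcontfun" for \<zeta>
  proof -
    obtain m where "\<And>s. s \<in> {0..T} \<Longrightarrow> norm (G \<zeta> s) \<le> m"
      using continuous_on_interval_bound[OF Gc] by metis
    moreover have "continuous_on UNIV (\<lambda>t. G \<zeta> (cl t))"
      by (rule continuous_on_compose2[OF Gc[of \<zeta>]])
        (use cl in \<open>auto simp: cl_def intro!: continuous_intros\<close>)
    ultimately show ?thesis
      using cl by (intro bcontfun_normI) auto
  qed
  define \<Gamma> where "\<Gamma> \<zeta> = Bcontfun (\<lambda>t. G \<zeta> (cl t))" for \<zeta>
  have \<Gamma>: "apply_bcontfun (\<Gamma> \<zeta>) t = G \<zeta> (cl t)" for \<zeta> t
    unfolding \<Gamma>_def using Gb by (simp add: Bcontfun_inverse)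
  have est: "norm (exp (- (r * t)) *\<^sub>R conv \<Phi> t) \<le> m / 2"
    if t: "t \<in> {0..T}" and \<Phi>: "continuous_on {0..T} \<Phi>" and m: "m \<ge> 0"
      and le: "\<And>s. s \<in> {0..T} \<Longrightarrow> norm (\<Phi> s) \<le> b * (m * exp (r * s))" for t \<Phi> m
  proof -
    have "norm (conv \<Phi> t) \<le> (b * m) * exp (r * t) * gain r"
    proof (rule conv_weighted_bound[OF t])
      show "continuous_on {0..t} \<Phi>" by (rule continuous_on_subset[OF \<Phi>]) (use t in auto)
      show "norm (\<Phi> s) \<le> b * m * exp (r * s)" if "s \<in> {0..t}" for s
        using le[of s] that t by (simp add: ac_simps)
    qed (use r in auto)
    also have "\<dots> = exp (r * t) * m * (b * gain r)" by simp
    also have "\<dots> \<le> exp (r * t) * m * (1 / 2)"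
      using r m by (intro mult_left_mono) auto
    finally show ?thesis by (simp add: exp_minus field_simps)
  qed
  have "\<exists>!\<zeta>. \<zeta> \<in> X \<and> \<Gamma> \<zeta> = \<zeta>"
  proof (rule Banach_fix[where c = "1 / 2"])
    show "complete X" "X \<noteq> {}"
      using \<rho>R by (auto simp: X_def complete_eq_closed)
    show "\<Gamma> ` X \<subseteq> X"
    proof clarify
      fix \<zeta> assume \<zeta>: "\<zeta> \<in> X"
      have "norm (\<Gamma> \<zeta> t) \<le> 2 * \<rho> * R" for t
      proof -
        have "norm (\<Gamma> \<zeta> t) \<le> norm (exp (- (r * cl t)) *\<^sub>R p (cl t)) + norm (exp (- (r * cl t)) *\<^sub>R conv (\<lambda>s. \<Psi> s (w \<zeta> s)) (cl t))"
          unfolding \<Gamma> G_def scaleR_add_right by (rule norm_triangle_ineq)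
        also have "\<dots> \<le> 1 * (\<rho> * R) + (2 * \<rho> * R) / 2"
        proof (rule add_mono)
          show "norm (exp (- (r * cl t)) *\<^sub>R p (cl t)) \<le> 1 * (\<rho> * R)"
            unfolding norm_scaleR using pR[OF cl(1)] cl(1)[of t] r by (intro mult_mono) auto
          show "norm (exp (- (r * cl t)) *\<^sub>R conv (\<lambda>s. \<Psi> s (w \<zeta> s)) (cl t)) \<le> (2 * \<rho> * R) / 2"
          proof (rule est[OF cl(1)])
            fix s assume s: "s \<in> {0..T}"
            have "norm (\<Psi> s (w \<zeta> s)) \<le> b * norm (w \<zeta> s)"
              using lip[of s "w \<zeta> s" 0] wR[OF \<zeta> s] \<Psi>0[OF s] s R by simp
            also have "norm (w \<zeta> s) \<le> exp (r * s) * norm \<zeta>"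
              unfolding w_def using norm_bounded[of \<zeta> s] by simp
            also have "\<dots> \<le> exp (r * s) * (2 * \<rho> * R)"
              using \<zeta> by (simp add: X_def)
            finally show "norm (\<Psi> s (w \<zeta> s)) \<le> b * ((2 * \<rho> * R) * exp (r * s))"
              using b by (simp add: ac_simps)
          qed (use \<rho>R in \<open>auto intro!: \<Psi>c wc\<close>)
        qed
        finally show ?thesis by (simp add: ac_simps)
      qed
      then have "norm (\<Gamma> \<zeta>) \<le> 2 * \<rho> * R" by (rule norm_bound)
      then show "\<Gamma> \<zeta> \<in> X" by (simp add: X_def)
    qed
    fix \<zeta> \<zeta>' assume \<zeta>: "\<zeta> \<in> X" "\<zeta>' \<in> X"
    show "dist (\<Gamma> \<zeta>) (\<Gamma> \<zeta>') \<le> 1 / 2 * dist \<zeta> \<zeta>'"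
    proof (rule dist_bound)
      fix t
      let ?\<Phi> = "\<lambda>s. \<Psi> s (w \<zeta> s) - \<Psi> s (w \<zeta>' s)"
      have sub: "continuous_on {0..cl t} (\<lambda>s. \<Psi> s (w \<zeta> s))" for \<zeta>
        by (rule continuous_on_subset[OF \<Psi>c[OF wc]]) (use cl(1)[of t] in auto)
      have "\<Gamma> \<zeta> t - \<Gamma> \<zeta>' t = exp (- (r * cl t)) *\<^sub>R conv ?\<Phi> (cl t)"
        unfolding \<Gamma> G_def by (simp add: conv_diff[OF cl(1) sub sub] algebra_simps)
      moreover have "norm (exp (- (r * cl t)) *\<^sub>R conv ?\<Phi> (cl t)) \<le> dist \<zeta> \<zeta>' / 2"
      proof (rule est[OF cl(1)])
        fix s assume s: "s \<in> {0..T}"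
        have "norm (?\<Phi> s) \<le> b * norm (w \<zeta> s - w \<zeta>' s)"
          by (intro lip s wR \<zeta>)
        also have "norm (w \<zeta> s - w \<zeta>' s) = exp (r * s) * dist (\<zeta> s) (\<zeta>' s)"
          by (simp add: w_def dist_norm flip: scaleR_diff_right)
        also have "\<dots> \<le> exp (r * s) * dist \<zeta> \<zeta>'"
          by (intro mult_left_mono dist_bounded) auto
        finally show "norm (?\<Phi> s) \<le> b * (dist \<zeta> \<zeta>' * exp (r * s))"
          using b by (simp add: ac_simps)
      qed (auto intro!: continuous_intros \<Psi>c wc)
      ultimately show "dist (\<Gamma> \<zeta> t) (\<Gamma> \<zeta>' t) \<le> 1 / 2 * dist \<zeta> \<zeta>'"
        by (simp add: dist_norm)
    qed
  qed auto
  then obtain \<zeta> where \<zeta>: "\<zeta> \<in> X" "\<Gamma> \<zeta> = \<zeta>" by blast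
  have "w \<zeta> t = p t + conv (\<lambda>s. \<Psi> s (w \<zeta> s)) t" if t: "t \<in> {0..T}" for t
  proof -
    have "w \<zeta> t = exp (r * t) *\<^sub>R \<Gamma> \<zeta> t" using \<zeta>(2) by (simp add: w_def)
    then show ?thesis
      using cl(2)[OF t] by (simp add: \<Gamma> G_def exp_minus)
  qed
  then show ?thesis using wc wR[OF \<zeta>(1)] by blast
qed

end

section \<open>Mild solutions\<close>

text \<open>F and G stand for f and g composed with \<open>neg_power\<close>. One constant L serves
  both Lipschitz conditions; taking it at least 1 keeps later divisors positive.\<close>

locale mild_problem = mild_kernel U K T \<alpha> C
  for U K :: "real \<Rightarrow> 'e::banach \<Rightarrow>\<^sub>L 'e" and T \<alpha> C :: real +
  fixes F :: "real \<Rightarrow> 'e \<Rightarrow> 'e" and F' :: "real \<Rightarrow> 'e \<Rightarrow> 'e \<Rightarrow>\<^sub>L 'e"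
    and G :: "real \<Rightarrow> 'e \<Rightarrow> real \<Rightarrow> 'e" and L :: real
  assumes L: "L \<ge> 1"
    and F_cont: "continuous_on UNIV (\<lambda>(t, x). F t x)"
    and F_deriv: "\<And>t x. (F t has_derivative F' t x) (at x)"
    and F'_cont: "continuous_on UNIV (\<lambda>(t, x). F' t x)"
    and F'_lip: "\<And>t x y. norm (F' t x - F' t y) \<le> L * norm (x - y)"
    and G_cont: "continuous_on (UNIV \<times> UNIV \<times> {0..1}) (\<lambda>(t, x, e). G t x e)"
    and G_lip: "\<And>t x y e. e \<in> {0..1} \<Longrightarrow> norm (G t x e - G t y e) \<le> L * norm (x - y)"
begin

definition mild :: "real \<Rightarrow> real \<Rightarrow> (real \<Rightarrow> 'e) \<Rightarrow> bool" where
  "mild \<epsilon> d x \<longleftrightarrow> continuous_on {0..d} x \<and>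
     (\<forall>t\<in>{0..d}. x t = U t (x 0) + conv (\<lambda>s. F s (x s) + \<epsilon> *\<^sub>R G s (x s) \<epsilon>) t)"

lemma mild_continuous: "mild \<epsilon> d x \<Longrightarrow> continuous_on {0..d} x"
  unfolding mild_def by blast

lemma mild_eq:
  "mild \<epsilon> d x \<Longrightarrow> t \<in> {0..d} \<Longrightarrow> x t = U t (x 0) + conv (\<lambda>s. F s (x s) + \<epsilon> *\<^sub>R G s (x s) \<epsilon>) t"
  unfolding mild_def by blast

lemma continuous_on_F [continuous_intros]:
  "continuous_on S p \<Longrightarrow> continuous_on S q \<Longrightarrow> continuous_on S (\<lambda>s. F (p s) (q s))"
  using continuous_on_compose2[OF F_cont, of S "\<lambda>s. (p s, q s)"] by (auto intro: continuous_intros)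

lemma continuous_on_F' [continuous_intros]:
  "continuous_on S p \<Longrightarrow> continuous_on S q \<Longrightarrow> continuous_on S (\<lambda>s. F' (p s) (q s))"
  using continuous_on_compose2[OF F'_cont, of S "\<lambda>s. (p s, q s)"] by (auto intro: continuous_intros)

lemma continuous_on_G [continuous_intros]:
  assumes "continuous_on S p" "continuous_on S q" "continuous_on S r" "r ` S \<subseteq> {0..1}"
  shows "continuous_on S (\<lambda>s. G (p s) (q s) (r s))"
proof -
  have "continuous_on S (\<lambda>s. (p s, q s, r s))" by (intro continuous_intros assms)
  from continuous_on_compose2[OF G_cont this] show ?thesis
    using assms(4) by auto
qed

text \<open>Mean value inequality for F minus its linear part at a, whose derivative on the ball of
  radius R is at most L * R. Neither point has to be a, which is what the comparison of two moving
  solutions needs.\<close>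

lemma F_linearization:
  assumes "norm (y - a) \<le> R" "norm (z - a) \<le> R"
  shows "norm (F s y - F s z - F' s a (y - z)) \<le> L * R * norm (y - z)"
proof -
  have "norm ((F s y - F' s a y) - (F s z - F' s a z)) \<le> L * R * norm (y - z)"
  proof (rule differentiable_bound[where S = "cball a R" and f' = "\<lambda>u. F' s u - F' s a"])
    fix u assume u: "u \<in> cball a R"
    show "((\<lambda>y. F s y - F' s a y) has_derivative (F' s u - F' s a)) (at u within cball a R)"
      by (auto intro!: derivative_eq_intros has_derivative_at_withinI[OF F_deriv] simp: blinfun.diff_left)
    have "norm (F' s u - F' s a) \<le> L * norm (u - a)" by (rule F'_lip)
    also have "\<dots> \<le> L * R"
      using u L by (intro mult_left_mono) (auto simp: dist_norm norm_minus_commute)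
    finally show "onorm (blinfun_apply (F' s u - F' s a)) \<le> L * R"
      by (simp add: norm_blinfun.rep_eq)
  qed (use assms in \<open>auto simp: dist_norm norm_minus_commute\<close>)
  then show ?thesis by (simp add: blinfun.diff_right algebra_simps)
qed

lemma F_lipschitz:
  assumes "norm (y - a) \<le> R" "norm (z - a) \<le> R"
  shows "norm (F s y - F s z) \<le> (norm (F' s a) + L * R) * norm (y - z)"
proof -
  have "F s y - F s z = F' s a (y - z) + (F s y - F s z - F' s a (y - z))" by simp
  also have "norm \<dots> \<le> norm (F' s a) * norm (y - z) + L * R * norm (y - z)"
    by (intro norm_triangle_mono norm_blinfun F_linearization assms)
  finally show ?thesis by (simp add: algebra_simps)
qed

lemma mild_restrict:
  assumes "mild \<epsilon> T x" "d \<in> {0..T}" shows "mild \<epsilon> d x"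
  unfolding mild_def
proof (intro conjI ballI)
  show "continuous_on {0..d} x"
    by (rule continuous_on_subset[OF mild_continuous[OF assms(1)]]) (use assms in auto)
qed (rule mild_eq[OF assms(1)], use assms in auto)

text \<open>F is only locally Lipschitz, so both solutions are first enclosed in one ball; there
  Gronwall with zero data gives equality.\<close>

lemma mild_unique:
  assumes d: "d \<in> {0..T}" and x: "mild 0 d x" and y: "mild 0 d y" and "x 0 = y 0"
    and t: "t \<in> {0..d}"
  shows "x t = y t"
proof -
  have xc: "continuous_on {0..d} x" and yc: "continuous_on {0..d} y"
    using x y by (auto intro: mild_continuous)
  obtain mx where mx: "mx > 0" "\<And>s. s \<in> {0..d} \<Longrightarrow> norm (x s) \<le> mx"
    using continuous_on_interval_bound[OF xc] by metis
  obtain my where my: "my > 0" "\<And>s. s \<in> {0..d} \<Longrightarrow> norm (y s) \<le> my"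
    using continuous_on_interval_bound[OF yc] by metis
  have "continuous_on {0..d} (\<lambda>s. F' s 0)" by (intro continuous_intros)
  then obtain mF where mF: "mF > 0" "\<And>s. s \<in> {0..d} \<Longrightarrow> norm (F' s 0) \<le> mF"
    using continuous_on_interval_bound by metis
  define R where "R = max mx my"
  define b where "b = max 1 (mF + L * R)"
  have "norm (x t - y t) \<le> 2 * growth b * (0 + \<bar>0\<bar>)"
  proof (rule conv_gronwall[OF _ d _ _ _ _ t])
    show "b \<ge> 1" by (simp add: b_def)
    show "continuous_on {0..d} (\<lambda>t. x t - y t)" "continuous_on {0..d} (\<lambda>s. F s (x s) - F s (y s))"
      by (intro continuous_intros xc yc)+
    fix s assume s: "s \<in> {0..d}"
    have "continuous_on {0..s} (\<lambda>s. F s (x s))" "continuous_on {0..s} (\<lambda>s. F s (y s))"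
      by (intro continuous_intros continuous_on_subset[OF xc] continuous_on_subset[OF yc]; use s in auto)+
    then show "norm (x s - y s) \<le> 0 + norm (conv (\<lambda>s. F s (x s) - F s (y s)) s)"
      using mild_eq[OF x s] mild_eq[OF y s] assms(4) s d by (simp add: conv_diff)
    have "norm (F s (x s) - F s (y s)) \<le> (norm (F' s 0) + L * R) * norm (x s - y s)"
      using mx(2)[OF s] my(2)[OF s] by (intro F_lipschitz) (auto simp: R_def)
    also have "\<dots> \<le> b * norm (x s - y s)"
      using mF(2)[OF s] by (intro mult_right_mono) (auto simp: b_def)
    finally show "norm (F s (x s) - F s (y s)) \<le> b * norm (x s - y s) + 0" by simp
  qed
  then show ?thesis by simp
qed

end

section \<open>Linearization along the reference solution\<close>

locale mild_problem_at = mild_problem +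
  fixes x0 :: "real \<Rightarrow> 'a"
  assumes x0: "mild 0 T x0"
begin

lemma x0_cont: "continuous_on {0..T} x0"
  using mild_continuous[OF x0] .

abbreviation "B s \<equiv> F' s (x0 s)"

lemma B_cont: "continuous_on {0..T} (\<lambda>s. B s)"
  by (intro continuous_intros x0_cont)

definition BB :: real where
  "BB = (SOME b. b \<ge> 1 \<and> (\<forall>s\<in>{0..T}. norm (B s) \<le> b))"

lemma BB: "BB \<ge> 1" "s \<in> {0..T} \<Longrightarrow> norm (B s) \<le> BB"
proof -
  obtain m where "\<And>s. s \<in> {0..T} \<Longrightarrow> norm (B s) \<le> m"
    using continuous_on_interval_bound[OF B_cont] by metis
  then have "max 1 m \<ge> 1 \<and> (\<forall>s\<in>{0..T}. norm (B s) \<le> max 1 m)"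
    by (force simp: le_max_iff_disj)
  then have "BB \<ge> 1 \<and> (\<forall>s\<in>{0..T}. norm (B s) \<le> BB)"
    unfolding BB_def by (rule someI)
  then show "BB \<ge> 1" "s \<in> {0..T} \<Longrightarrow> norm (B s) \<le> BB" by auto
qed

lemma norm_B_apply_le: "s \<in> {0..T} \<Longrightarrow> norm (B s v) \<le> BB * norm v"
  by (intro order_trans[OF norm_blinfun] mult_right_mono BB) auto

lemma continuous_on_B_apply:
  "continuous_on {0..T} w \<Longrightarrow> continuous_on {0..T} (\<lambda>s. B s (w s))"
  by (intro continuous_intros x0_cont)

text \<open>The inhomogeneity is an arbitrary curve, so that one theory covers a perturbed initial
  value (\<open>U t \<beta>\<close>) and a forcing term (a convolution).\<close>

definition linear_mild :: "(real \<Rightarrow> 'a) \<Rightarrow> (real \<Rightarrow> 'a) \<Rightarrow> bool" where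
  "linear_mild p y \<longleftrightarrow> continuous_on {0..T} y \<and> (\<forall>t\<in>{0..T}. y t = p t + conv (\<lambda>s. B s (y s)) t)"

lemma linear_mild_continuous: "linear_mild p y \<Longrightarrow> continuous_on {0..T} y"
  unfolding linear_mild_def by blast

lemma linear_mild_eq: "linear_mild p y \<Longrightarrow> t \<in> {0..T} \<Longrightarrow> y t = p t + conv (\<lambda>s. B s (y s)) t"
  unfolding linear_mild_def by blast

lemma linear_mild_exists:
  assumes p: "continuous_on {0..T} p"
  shows "\<exists>y. linear_mild p y"
proof -
  obtain m where m: "m > 0" "\<And>s. s \<in> {0..T} \<Longrightarrow> norm (p s) \<le> m"
    using continuous_on_interval_bound[OF p] by metis
  \<comment> \<open>A linear equation allows any radius; this one makes the smallness condition on p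
    in \<open>conv_fixed_point\<close> read \<open>norm (p t) \<le> m\<close>.\<close>
  have "\<exists>w. continuous_on {0..T} w \<and> (\<forall>t\<in>{0..T}. norm (w t) \<le> m * (2 * growth BB) \<and> w t = p t + conv (\<lambda>s. B s (w s)) t)"
    by (rule conv_fixed_point[where b = BB, OF _ _ p])
      (use BB(1) growth_pos[of BB] m in \<open>auto intro!: continuous_on_B_apply norm_B_apply_le simp flip: blinfun.diff_right\<close>)
  then show ?thesis unfolding linear_mild_def by blast
qed

text \<open>\<open>BB + L\<close> bounds the Lipschitz constant of F within distance 1 of
  \<open>x0\<close>, so the same Gronwall constant serves the linear and the nonlinear
  comparison.\<close>

definition A0 :: real where "A0 = 2 * growth (BB + L)"

lemma A0_pos: "A0 > 0"
  by (simp add: A0_def growth_pos)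

lemma perturbed_gronwall:
  assumes "continuous_on {0..T} w" "continuous_on {0..T} \<Phi>"
    "\<And>t. t \<in> {0..T} \<Longrightarrow> norm (w t) \<le> a + norm (conv \<Phi> t)"
    "\<And>s. s \<in> {0..T} \<Longrightarrow> norm (\<Phi> s) \<le> (BB + L) * norm (w s) + c"
    "t \<in> {0..T}"
  shows "norm (w t) \<le> A0 * (a + \<bar>c\<bar>)"
  unfolding A0_def by (rule conv_gronwall[OF _ _ assms]) (use BB(1) L T in auto)

lemma linear_mild_bound:
  assumes y: "linear_mild p y" and p: "\<And>t. t \<in> {0..T} \<Longrightarrow> norm (p t) \<le> a" and t: "t \<in> {0..T}"
  shows "norm (y t) \<le> A0 * a"
proof -
  have "norm (y t) \<le> A0 * (a + \<bar>0\<bar>)"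
  proof (rule perturbed_gronwall[OF _ _ _ _ t])
    fix t assume t: "t \<in> {0..T}"
    have "norm (y t) \<le> norm (p t) + norm (conv (\<lambda>s. B s (y s)) t)"
      using linear_mild_eq[OF y t] by (simp add: norm_triangle_ineq)
    then show "norm (y t) \<le> a + norm (conv (\<lambda>s. B s (y s)) t)"
      using p[OF t] by linarith
    have "norm (B t (y t)) \<le> BB * norm (y t)" by (rule norm_B_apply_le[OF t])
    also have "\<dots> \<le> (BB + L) * norm (y t)" using L by (intro mult_right_mono) auto
    finally show "norm (B t (y t)) \<le> (BB + L) * norm (y t) + 0" by simp
  qed (use linear_mild_continuous[OF y] in \<open>auto intro: continuous_on_B_apply\<close>)
  then show ?thesis by simp
qed

lemma linear_mild_add:
  assumes "linear_mild p y" "linear_mild q z"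
  shows "linear_mild (\<lambda>t. p t + r *\<^sub>R q t) (\<lambda>t. y t + r *\<^sub>R z t)"
  unfolding linear_mild_def
proof (intro conjI ballI)
  show "continuous_on {0..T} (\<lambda>t. y t + r *\<^sub>R z t)"
    by (intro continuous_intros linear_mild_continuous[OF assms(1)] linear_mild_continuous[OF assms(2)])
  fix t assume t: "t \<in> {0..T}"
  have c: "continuous_on {0..t} (\<lambda>s. B s (y s))" "continuous_on {0..t} (\<lambda>s. B s (z s))"
    using assms t by (auto dest: linear_mild_continuous intro!: continuous_on_subset[OF continuous_on_B_apply])
  have "conv (\<lambda>s. B s (y s + r *\<^sub>R z s)) t = conv (\<lambda>s. B s (y s)) t + r *\<^sub>R conv (\<lambda>s. B s (z s)) t"
    unfolding blinfun.add_right blinfun.scaleR_right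
    by (subst conv_add[OF t]) (auto intro!: continuous_intros c simp: conv_scaleR)
  then show "y t + r *\<^sub>R z t = p t + r *\<^sub>R q t + conv (\<lambda>s. B s (y s + r *\<^sub>R z s)) t"
    using linear_mild_eq[OF assms(1) t] linear_mild_eq[OF assms(2) t] by (simp add: algebra_simps)
qed

lemma linear_mild_unique:
  assumes "linear_mild p y" "linear_mild p z" "t \<in> {0..T}"
  shows "y t = z t"
proof -
  have "norm (y t + (- 1) *\<^sub>R z t) \<le> A0 * 0"
    by (rule linear_mild_bound[OF linear_mild_add[OF assms(1,2)] _ assms(3)]) simp
  then show ?thesis by simp
qed

text \<open>Candidate for the derivative of the solution in its initial value;
  \<open>time_map_has_derivative\<close> confirms it at time T.\<close>

definition tangent_curve :: "'a \<Rightarrow> real \<Rightarrow> 'a" where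
  "tangent_curve \<beta> = (SOME y. linear_mild (\<lambda>t. U t \<beta>) y)"

lemma tangent_curve: "linear_mild (\<lambda>t. U t \<beta>) (tangent_curve \<beta>)"
  unfolding tangent_curve_def using linear_mild_exists[OF U_cont] by (rule someI_ex)

lemma bounded_linear_tangent_curve: "bounded_linear (\<lambda>\<beta>. tangent_curve \<beta> T)"
proof -
  have TT: "T \<in> {0..T}" using T by simp
  have lin: "tangent_curve (\<beta> + r *\<^sub>R \<gamma>) T = tangent_curve \<beta> T + r *\<^sub>R tangent_curve \<gamma> T" for \<beta> \<gamma> r
  proof -
    have "linear_mild (\<lambda>t. U t (\<beta> + r *\<^sub>R \<gamma>)) (\<lambda>t. tangent_curve \<beta> t + r *\<^sub>R tangent_curve \<gamma> t)"
      using linear_mild_add[OF tangent_curve tangent_curve] by (simp add: blinfun.add_right blinfun.scaleR_right)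
    then show ?thesis using linear_mild_unique[OF tangent_curve _ TT] by blast
  qed
  have zero: "tangent_curve 0 T = 0" using lin[of 0 "-1" 0] by simp
  show ?thesis
  proof (rule bounded_linear_intro)
    show "tangent_curve (\<beta> + \<gamma>) T = tangent_curve \<beta> T + tangent_curve \<gamma> T" for \<beta> \<gamma>
      using lin[of \<beta> 1 \<gamma>] by simp
    show "tangent_curve (r *\<^sub>R \<gamma>) T = r *\<^sub>R tangent_curve \<gamma> T" for r \<gamma>
      using lin[of 0 r \<gamma>] zero by simp
    fix \<beta>
    have "norm (tangent_curve \<beta> T) \<le> A0 * (C * norm \<beta>)"
      by (rule linear_mild_bound[OF tangent_curve _ TT])
        (intro order_trans[OF norm_blinfun] mult_right_mono U_bound; simp)
    then show "norm (tangent_curve \<beta> T) \<le> norm \<beta> * (A0 * C)"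
      by (simp add: ac_simps)
  qed
qed

lemma G0_cont: "continuous_on {0..T} (\<lambda>s. G s (x0 s) 0)"
  by (intro continuous_intros x0_cont) auto

text \<open>First-order response to \<epsilon>; at T it is the vector \<open>eta\<close> of the
  reference point, see \<open>eta_eq\<close>.\<close>

definition forced_curve :: "real \<Rightarrow> 'a" where
  "forced_curve = (SOME y. linear_mild (conv (\<lambda>s. G s (x0 s) 0)) y)"

lemma forced_curve: "linear_mild (conv (\<lambda>s. G s (x0 s) 0)) forced_curve"
  unfolding forced_curve_def using linear_mild_exists[OF conv_continuous[OF G0_cont]] by (rule someI_ex)

text \<open>Lipschitz constant of the solution in its initial value near \<open>x0\<close>: C from
  the bound on U, the rest from the radius condition of \<open>conv_fixed_point\<close>.\<close>

definition near :: real where "near = 2 * C * growth (BB + L)"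

lemma near_pos: "near > 0"
  using C by (simp add: near_def growth_pos)

text \<open>The fixed point theorem is applied to the deviation from \<open>x0\<close>, in a ball of
  radius proportional to the initial deviation. The hypothesis keeps this radius at most 1, where
  \<open>BB + L\<close> is a Lipschitz constant; existence up to T comes with it.\<close>

lemma mild_nearby:
  assumes \<xi>: "near * norm (\<xi> - x0 0) \<le> 1"
  shows "\<exists>z. mild 0 T z \<and> z 0 = \<xi> \<and> (\<forall>t\<in>{0..T}. norm (z t - x0 t) \<le> near * norm (\<xi> - x0 0))"
proof (cases "\<xi> = x0 0")
  case True
  then show ?thesis using x0 by (intro exI[of _ x0]) auto
next
  case False
  have "BB + L > 0" using BB(1) L by simp
  define R where "R = near * norm (\<xi> - x0 0)"
  have R: "R > 0" "R \<le> 1"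
    using False near_pos \<xi> by (auto simp: R_def)
  define \<Psi> where "\<Psi> s w = F s (x0 s + w) - F s (x0 s)" for s w
  have "\<exists>w. continuous_on {0..T} w \<and> (\<forall>t\<in>{0..T}. norm (w t) \<le> R \<and> w t = U t (\<xi> - x0 0) + conv (\<lambda>s. \<Psi> s (w s)) t)"
  proof (rule conv_fixed_point[OF \<open>BB + L > 0\<close> R(1) U_cont])
    show "norm (U t (\<xi> - x0 0)) \<le> R / (2 * growth (BB + L))" if "t \<in> {0..T}" for t
    proof -
      have "norm (U t (\<xi> - x0 0)) \<le> C * norm (\<xi> - x0 0)"
        by (intro order_trans[OF norm_blinfun] mult_right_mono U_bound that) auto
      then show ?thesis using growth_pos[of "BB + L"] by (simp add: R_def near_def)
    qed
    show "continuous_on {0..T} (\<lambda>s. \<Psi> s (w s))" if "continuous_on {0..T} w" for w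
      unfolding \<Psi>_def by (intro continuous_intros x0_cont that)
    fix s and y z :: 'a assume s: "s \<in> {0..T}" and yz: "norm y \<le> R" "norm z \<le> R"
    have "norm (F s (x0 s + y) - F s (x0 s + z)) \<le> (norm (B s) + L * R) * norm ((x0 s + y) - (x0 s + z))"
      using yz by (intro F_lipschitz) auto
    also have "\<dots> \<le> (BB + L) * norm ((x0 s + y) - (x0 s + z))"
      using BB(2)[OF s] L R(2) mult_left_mono[of R 1 L] by (intro mult_right_mono add_mono) auto
    finally show "norm (\<Psi> s y - \<Psi> s z) \<le> (BB + L) * norm (y - z)" by (simp add: \<Psi>_def)
  qed (auto simp: \<Psi>_def)
  then obtain w where wc: "continuous_on {0..T} w"
    and w: "\<And>t. t \<in> {0..T} \<Longrightarrow> norm (w t) \<le> R"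
      "\<And>t. t \<in> {0..T} \<Longrightarrow> w t = U t (\<xi> - x0 0) + conv (\<lambda>s. \<Psi> s (w s)) t"
    by blast
  have w0: "w 0 = \<xi> - x0 0" using w(2)[of 0] T U0 by simp
  have "mild 0 T (\<lambda>t. x0 t + w t)"
    unfolding mild_def
  proof (intro conjI ballI)
    show "continuous_on {0..T} (\<lambda>t. x0 t + w t)" by (intro continuous_intros x0_cont wc)
    fix t assume t: "t \<in> {0..T}"
    have c: "continuous_on {0..t} (\<lambda>s. F s (x0 s + w s))" "continuous_on {0..t} (\<lambda>s. F s (x0 s))"
      by (intro continuous_intros continuous_on_subset[OF x0_cont] continuous_on_subset[OF wc]; use t in auto)+
    have "w t = U t (w 0) + (conv (\<lambda>s. F s (x0 s + w s)) t - conv (\<lambda>s. F s (x0 s)) t)"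
      using w(2)[OF t] by (simp add: w0 \<Psi>_def conv_diff[OF t c])
    moreover have "x0 t = U t (x0 0) + conv (\<lambda>s. F s (x0 s)) t"
      using mild_eq[OF x0 t] by simp
    ultimately show "x0 t + w t = U t (x0 0 + w 0) + conv (\<lambda>s. F s (x0 s + w s) + 0 *\<^sub>R G s (x0 s + w s) 0) t"
      by (simp add: blinfun.add_right)
  qed
  then show ?thesis
    using w0 w(1) by (intro exI[of _ "\<lambda>t. x0 t + w t"]) (auto simp: R_def)
qed

end

section \<open>First-order expansion\<close>

context mild_problem_at
begin

lemma G_near:
  assumes "e > 0"
  shows "\<exists>\<delta>>0. \<forall>s\<in>{0..T}. \<forall>\<epsilon>\<in>{0..1}. \<epsilon> < \<delta> \<longrightarrow> norm (G s (x0 s) \<epsilon> - G s (x0 s) 0) \<le> e"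
proof -
  have "continuous_on ({0..T} \<times> {0..1}) (\<lambda>p. G (fst p) (x0 (fst p)) (snd p))"
    by (intro continuous_intros continuous_on_compose2[OF x0_cont]) auto
  then have "uniformly_continuous_on ({0..T} \<times> {0..1}) (\<lambda>p. G (fst p) (x0 (fst p)) (snd p))"
    by (intro compact_uniformly_continuous compact_Times) auto
  then obtain \<delta> where \<delta>: "\<delta> > 0"
    "\<And>p q. \<lbrakk>p \<in> {0..T} \<times> {0..1}; q \<in> {0..T} \<times> {0..1}; dist q p < \<delta>\<rbrakk>
      \<Longrightarrow> dist (G (fst q) (x0 (fst q)) (snd q)) (G (fst p) (x0 (fst p)) (snd p)) < e"
    using assms unfolding uniformly_continuous_on_def by metis
  show ?thesis
  proof (intro exI[of _ \<delta>] conjI \<delta>(1) ballI impI)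
    fix s \<epsilon> assume "s \<in> {0..T}" "\<epsilon> \<in> {0..1}" "\<epsilon> < \<delta>"
    then show "norm (G s (x0 s) \<epsilon> - G s (x0 s) 0) \<le> e"
      using \<delta>(2)[of "(s, 0)" "(s, \<epsilon>)"] by (auto simp: dist_Pair_Pair dist_norm)
  qed
qed

text \<open>Used in two ways: with \<epsilon> = 0 and z the reference solution it is
  differentiability of the Poincare map; with z moving along the manifold S it is the expansion
  behind the bifurcation condition.\<close>

definition expansion_radius :: "real \<Rightarrow> real \<Rightarrow> bool" where
  "expansion_radius e \<delta> \<longleftrightarrow> \<delta> > 0 \<and> (\<forall>\<epsilon> x z. 0 \<le> \<epsilon> \<longrightarrow> \<epsilon> < \<delta> \<longrightarrow> mild \<epsilon> T x \<longrightarrow> mild 0 T z \<longrightarrow>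
     (\<forall>t\<in>{0..T}. norm (x t - x0 t) \<le> \<delta>) \<longrightarrow> (\<forall>t\<in>{0..T}. norm (z t - x0 t) \<le> \<delta>) \<longrightarrow>
     norm (x T - z T - tangent_curve (x 0 - z 0) T - \<epsilon> *\<^sub>R forced_curve T) \<le> e * (norm (x 0 - z 0) + \<epsilon>))"

text \<open>Strict differentiability: the perturbed and the unperturbed solution may vary independently
  near the reference solution.\<close>

lemma strict_expansion:
  assumes e: "e > 0"
  shows "\<exists>\<delta>. expansion_radius e \<delta>"
proof -
  obtain m0 where m0: "m0 > 0" "\<And>s. s \<in> {0..T} \<Longrightarrow> norm (G s (x0 s) 0) \<le> m0"
    using continuous_on_interval_bound[OF G0_cont] by metis
  \<comment> \<open>A priori constant for x - z; \<open>m0 + 1 + L\<close> will bound G along x,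
    since \<open>e'\<close> and \<delta> are at most 1.\<close>
  define A1 where "A1 = A0 * (C + (m0 + 1 + L))"
  have A1: "A1 > 0" using A0_pos C m0(1) L by (simp add: A1_def)
  define e' where "e' = min 1 (e / (2 * A0))"
  have e': "e' > 0" "e' \<le> 1" "A0 * e' \<le> e / 2"
    using e A0_pos by (auto simp: e'_def min_def field_simps)
  obtain \<delta>' where \<delta>': "\<delta>' > 0"
    "\<And>s \<epsilon>. s \<in> {0..T} \<Longrightarrow> \<epsilon> \<in> {0..1} \<Longrightarrow> \<epsilon> < \<delta>' \<Longrightarrow> norm (G s (x0 s) \<epsilon> - G s (x0 s) 0) \<le> e'"
    using G_near[OF e'(1)] by auto
  \<comment> \<open>The last entry spends half of e on errors proportional to \<delta>: the
    linearization of F and the variation of G in space. The other half goes, through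
    \<open>e'\<close>, to the variation of G in \<epsilon>.\<close>
  define \<delta> where "\<delta> = min 1 (min \<delta>' (e / (2 * A0 * L * (A1 + 1))))"
  have \<delta>: "\<delta> > 0" "\<delta> \<le> 1" "\<delta> \<le> \<delta>'" "\<delta> \<le> e / (2 * A0 * L * (A1 + 1))"
    using e \<delta>'(1) A0_pos L A1 by (auto simp: \<delta>_def)
  have pos: "2 * A0 * L * (A1 + 1) > 0"
    using A0_pos L A1 by (intro mult_pos_pos) auto
  have \<delta>e: "A0 * (L * \<delta> * (A1 + 1)) \<le> e / 2"
    using \<delta>(4) pos by (simp add: pos_le_divide_eq ac_simps)
  have "expansion_radius e \<delta>"
    unfolding expansion_radius_def
  proof (intro conjI \<delta>(1) allI impI)
    fix \<epsilon> x z
    assume \<epsilon>: "0 \<le> \<epsilon>" "\<epsilon> < \<delta>" and x: "mild \<epsilon> T x" and z: "mild 0 T z"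
      and xn': "\<forall>t\<in>{0..T}. norm (x t - x0 t) \<le> \<delta>"
      and zn': "\<forall>t\<in>{0..T}. norm (z t - x0 t) \<le> \<delta>"
    note xn = bspec[OF xn'] and zn = bspec[OF zn']
    define \<beta> where "\<beta> = x 0 - z 0"
    define w where "w t = x t - z t" for t
    define y where "y = tangent_curve \<beta>"
    define r where "r t = w t - y t - \<epsilon> *\<^sub>R forced_curve t" for t
    have \<epsilon>1: "\<epsilon> \<in> {0..1}" "\<epsilon> < \<delta>'" using \<epsilon> \<delta> by auto
    note lin = tangent_curve[of \<beta>, folded y_def]
    note cont = mild_continuous[OF x] mild_continuous[OF z] linear_mild_continuous[OF lin]
      linear_mild_continuous[OF forced_curve] x0_cont
    have Gx: "norm (G s (x s) \<epsilon> - G s (x0 s) 0) \<le> L * \<delta> + e'" if s: "s \<in> {0..T}" for s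
    proof -
      have "norm (G s (x s) \<epsilon> - G s (x0 s) \<epsilon>) \<le> L * \<delta>"
        using order_trans[OF G_lip[OF \<epsilon>1(1)] mult_left_mono[OF xn[OF s], of L]] L by simp
      then show ?thesis
        using norm_triangle_mono[OF _ \<delta>'(2)[OF s \<epsilon>1]] by (metis diff_add_cancel add_diff_eq)
    qed
    have Gcont: "continuous_on {0..T} (\<lambda>s. G s (x s) \<epsilon>)"
      by (intro continuous_intros cont) (use \<epsilon>1 in auto)
    define R where "R s = F s (x s) - F s (z s) - B s (w s)" for s
    have R: "norm (R s) \<le> L * \<delta> * norm (w s)" if s: "s \<in> {0..T}" for s
      unfolding R_def w_def by (rule F_linearization[OF xn[OF s] zn[OF s]])
    have weq: "w t = U t \<beta> + conv (\<lambda>s. F s (x s) - F s (z s) + \<epsilon> *\<^sub>R G s (x s) \<epsilon>) t" if t: "t \<in> {0..T}" for t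
    proof -
      have c: "continuous_on {0..t} (\<lambda>s. F s (x s) + \<epsilon> *\<^sub>R G s (x s) \<epsilon>)" "continuous_on {0..t} (\<lambda>s. F s (z s))"
        by (rule continuous_on_subset[where s = "{0..T}"], intro continuous_intros cont Gcont, use t in auto)+
      have "w t = U t \<beta> + (conv (\<lambda>s. F s (x s) + \<epsilon> *\<^sub>R G s (x s) \<epsilon>) t - conv (\<lambda>s. F s (z s)) t)"
        using mild_eq[OF x t] mild_eq[OF z t] by (simp add: w_def \<beta>_def blinfun.diff_right)
      then show ?thesis by (simp add: conv_diff[OF t c, symmetric] algebra_simps)
    qed
    have wb: "norm (w t) \<le> A1 * (norm \<beta> + \<epsilon>)" if t: "t \<in> {0..T}" for t
    proof -
      have "norm (w t) \<le> A0 * (C * norm \<beta> + \<bar>\<epsilon> * (m0 + 1 + L)\<bar>)"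
      proof (rule perturbed_gronwall[OF _ _ _ _ t])
        show "continuous_on {0..T} w" unfolding w_def by (intro continuous_intros cont)
        show "continuous_on {0..T} (\<lambda>s. F s (x s) - F s (z s) + \<epsilon> *\<^sub>R G s (x s) \<epsilon>)"
          by (intro continuous_intros cont Gcont)
        fix s assume s: "s \<in> {0..T}"
        have "norm (U s \<beta>) \<le> C * norm \<beta>"
          by (intro order_trans[OF norm_blinfun] mult_right_mono U_bound s) auto
        then show "norm (w s) \<le> C * norm \<beta> + norm (conv (\<lambda>s. F s (x s) - F s (z s) + \<epsilon> *\<^sub>R G s (x s) \<epsilon>) s)"
          unfolding weq[OF s] by (intro norm_triangle_mono) auto
        have "norm (B s (w s)) \<le> BB * norm (w s)" by (rule norm_B_apply_le[OF s])
        moreover have "norm (R s) \<le> L * norm (w s)"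
          using order_trans[OF R[OF s] mult_right_mono[OF mult_left_mono[OF \<delta>(2), of L]]] L by simp
        moreover have "norm (\<epsilon> *\<^sub>R G s (x s) \<epsilon>) \<le> \<epsilon> * (m0 + 1 + L)"
        proof -
          have "G s (x s) \<epsilon> = (G s (x s) \<epsilon> - G s (x0 s) 0) + G s (x0 s) 0" by simp
          also have "norm \<dots> \<le> (L * \<delta> + e') + m0"
            by (intro norm_triangle_mono Gx s m0)
          also have "L * \<delta> \<le> L"
            using \<delta>(2) L by (simp add: mult_left_le)
          also have "L + e' + m0 \<le> m0 + 1 + L"
            using e'(2) by simp
          finally show ?thesis using \<epsilon> by (auto intro: mult_left_mono)
        qed
        ultimately have "norm (B s (w s) + R s + \<epsilon> *\<^sub>R G s (x s) \<epsilon>) \<le> BB * norm (w s) + L * norm (w s) + \<epsilon> * (m0 + 1 + L)"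
          by (intro norm_triangle_mono)
        then show "norm (F s (x s) - F s (z s) + \<epsilon> *\<^sub>R G s (x s) \<epsilon>) \<le> (BB + L) * norm (w s) + \<epsilon> * (m0 + 1 + L)"
          by (simp add: R_def algebra_simps)
      qed
      also have "\<dots> \<le> A1 * (norm \<beta> + \<epsilon>)"
        using A0_pos C m0(1) L \<epsilon>(1)
        by (simp add: A1_def mult.assoc) (simp add: algebra_simps)
      finally show ?thesis .
    qed
    \<comment> \<open>The first-order error solves the linearized equation with zero initial value.
      Its sources, the remainder R and the change of G, are small relative to
      \<open>norm \<beta> + \<epsilon>\<close>, the former because of \<open>wb\<close>.\<close>
    have req: "r t = conv (\<lambda>s. R s + B s (r s) + \<epsilon> *\<^sub>R (G s (x s) \<epsilon> - G s (x0 s) 0)) t" if t: "t \<in> {0..T}" for t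
    proof -
      let ?a = "\<lambda>s. F s (x s) - F s (z s) + \<epsilon> *\<^sub>R G s (x s) \<epsilon>"
      let ?b = "\<lambda>s. B s (y s)" and ?c = "\<lambda>s. G s (x0 s) 0" and ?d = "\<lambda>s. B s (forced_curve s)"
      have c: "continuous_on {0..t} ?a" "continuous_on {0..t} ?b" "continuous_on {0..t} ?c" "continuous_on {0..t} ?d"
        by (rule continuous_on_subset[where s = "{0..T}"], intro continuous_intros cont Gcont G0_cont, use t in auto)+
      have "r t = conv ?a t - conv ?b t - \<epsilon> *\<^sub>R (conv ?c t + conv ?d t)"
        using weq[OF t] linear_mild_eq[OF lin t] linear_mild_eq[OF forced_curve t] by (simp add: r_def)
      also have "\<dots> = conv (\<lambda>s. ?a s - ?b s - \<epsilon> *\<^sub>R (?c s + ?d s)) t"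
        using c by (simp add: conv_diff[OF t] conv_add[OF t] conv_scaleR continuous_intros)
      also have "\<dots> = conv (\<lambda>s. R s + B s (r s) + \<epsilon> *\<^sub>R (G s (x s) \<epsilon> - G s (x0 s) 0)) t"
        by (intro conv_cong) (simp add: r_def R_def blinfun.add_right blinfun.diff_right blinfun.scaleR_right algebra_simps)
      finally show ?thesis .
    qed
    define c where "c = (L * \<delta> * (A1 + 1) + e') * (norm \<beta> + \<epsilon>)"
    have c0: "c \<ge> 0" unfolding c_def using L \<delta>(1) A1 e'(1) \<epsilon>(1) by auto
    have TT: "T \<in> {0..T}" using T by simp
    have "norm (r T) \<le> A0 * (0 + \<bar>c\<bar>)"
    proof (rule perturbed_gronwall[OF _ _ _ _ TT])
      show rc: "continuous_on {0..T} r"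
        unfolding r_def w_def by (intro continuous_intros cont)
      show "continuous_on {0..T} (\<lambda>s. R s + B s (r s) + \<epsilon> *\<^sub>R (G s (x s) \<epsilon> - G s (x0 s) 0))"
        unfolding R_def w_def by (intro continuous_intros cont Gcont G0_cont rc)
      fix s assume s: "s \<in> {0..T}"
      show "norm (r s) \<le> 0 + norm (conv (\<lambda>s. R s + B s (r s) + \<epsilon> *\<^sub>R (G s (x s) \<epsilon> - G s (x0 s) 0)) s)"
        using req[OF s] by simp
      have "norm (R s) \<le> L * \<delta> * (A1 * (norm \<beta> + \<epsilon>))"
        using order_trans[OF R[OF s] mult_left_mono[OF wb[OF s]]] L \<delta>(1) by simp
      moreover have "norm (B s (r s)) \<le> BB * norm (r s)" by (rule norm_B_apply_le[OF s])
      moreover have "norm (\<epsilon> *\<^sub>R (G s (x s) \<epsilon> - G s (x0 s) 0)) \<le> (norm \<beta> + \<epsilon>) * (L * \<delta> + e')"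
        unfolding norm_scaleR using Gx[OF s] \<epsilon>(1) by (intro mult_mono) auto
      ultimately have "norm (R s + B s (r s) + \<epsilon> *\<^sub>R (G s (x s) \<epsilon> - G s (x0 s) 0))
          \<le> L * \<delta> * (A1 * (norm \<beta> + \<epsilon>)) + BB * norm (r s) + (norm \<beta> + \<epsilon>) * (L * \<delta> + e')"
        by (intro norm_triangle_mono)
      also have "\<dots> = BB * norm (r s) + c" by (simp add: c_def algebra_simps)
      also have "\<dots> \<le> (BB + L) * norm (r s) + c" using L by (simp add: algebra_simps)
      finally show "norm (R s + B s (r s) + \<epsilon> *\<^sub>R (G s (x s) \<epsilon> - G s (x0 s) 0)) \<le> (BB + L) * norm (r s) + c" .
    qed
    also have "\<dots> = (A0 * (L * \<delta> * (A1 + 1)) + A0 * e') * (norm \<beta> + \<epsilon>)"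
      using c0 by (simp add: c_def algebra_simps)
    also have "\<dots> \<le> e * (norm \<beta> + \<epsilon>)"
      using \<delta>e e'(3) \<epsilon>(1) by (intro mult_right_mono) auto
    finally show "norm (x T - z T - tangent_curve (x 0 - z 0) T - \<epsilon> *\<^sub>R forced_curve T) \<le> e * (norm (x 0 - z 0) + \<epsilon>)"
      by (simp add: r_def w_def y_def \<beta>_def)
  qed
  then show ?thesis ..
qed

text \<open>P is any map sending initial values to values at T; near the reference point
  \<open>mild_nearby\<close> supplies the solutions, so P is determined in a neighbourhood.\<close>

lemma time_map_has_derivative:
  assumes P: "\<And>z. mild 0 T z \<Longrightarrow> P (z 0) = z T"
  shows "(P has_derivative (\<lambda>\<beta>. tangent_curve \<beta> T)) (at (x0 0))"
  unfolding has_derivative_at_alt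
proof (intro conjI allI impI)
  fix e :: real assume e: "e > 0"
  obtain \<delta> where \<delta>: "expansion_radius e \<delta>"
    using strict_expansion[OF e] by blast
  then have \<delta>0: "\<delta> > 0" by (simp add: expansion_radius_def)
  show "\<exists>d>0. \<forall>\<xi>. norm (\<xi> - x0 0) < d \<longrightarrow>
      norm (P \<xi> - P (x0 0) - tangent_curve (\<xi> - x0 0) T) \<le> e * norm (\<xi> - x0 0)"
  \<comment> \<open>The 1 serves \<open>mild_nearby\<close>, the \<delta> serves the
    expansion.\<close>
  proof (intro exI[of _ "min 1 \<delta> / near"] conjI allI impI)
    fix \<xi> assume "norm (\<xi> - x0 0) < min 1 \<delta> / near"
    then have \<xi>: "near * norm (\<xi> - x0 0) \<le> min 1 \<delta>"
      using near_pos by (simp add: field_simps)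
    then obtain z where z: "mild 0 T z" "z 0 = \<xi>"
      "\<And>t. t \<in> {0..T} \<Longrightarrow> norm (z t - x0 t) \<le> near * norm (\<xi> - x0 0)"
      using mild_nearby[of \<xi>] by auto
    have "\<forall>t\<in>{0..T}. norm (z t - x0 t) \<le> \<delta>"
      using z(3) \<xi> by fastforce
    then have "norm (z T - x0 T - tangent_curve (z 0 - x0 0) T - 0 *\<^sub>R forced_curve T) \<le> e * (norm (z 0 - x0 0) + 0)"
      using \<delta> z(1) x0 \<delta>0 unfolding expansion_radius_def by auto
    then show "norm (P \<xi> - P (x0 0) - tangent_curve (\<xi> - x0 0) T) \<le> e * norm (\<xi> - x0 0)"
      using P[OF z(1)] P[OF x0] z(2) by simp
  qed (use near_pos \<delta>0 in auto)
qed (rule bounded_linear_tangent_curve)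

end

section \<open>Linear algebra of the tangent space and its complement\<close>

text \<open>A maximal independent subset of the images of the standard basis spans the range and so
  has as many elements as that basis; hence the images are distinct and independent. The target may
  be infinite-dimensional.\<close>

lemma inj_linear_of_dim_range:
  fixes f :: "real ^ 'k \<Rightarrow> 'e::real_vector"
  assumes f: "linear f" and dim: "dim (range f) = CARD('k)"
  shows "inj f"
proof -
  let ?B = "Basis :: (real ^ 'k) set"
  have card: "card ?B = CARD('k)" by simp
  have range: "range f = span (f ` ?B)"
    using linear_span_image[OF f, of ?B] by simp
  obtain B where B: "B \<subseteq> f ` ?B" "independent B" "f ` ?B \<subseteq> span B"
    by (rule maximal_independent_subset)
  have fin: "finite (f ` ?B)" by simp
  have "span B = span (f ` ?B)"
    using B span_mono[OF B(1)] span_minimal[OF B(3) subspace_span] by blast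
  then have "card B = CARD('k)"
    using dim_eq_card[of B "range f"] B(2) dim range by (simp add: span_span)
  moreover have "card (f ` ?B) \<le> CARD('k)"
    using card_image_le[of ?B f] card by simp
  ultimately have "B = f ` ?B"
    using card_subset_eq[OF fin B(1)] card_mono[OF fin B(1)] by simp
  then have "inj_on f ?B" "independent (f ` ?B)"
    using \<open>card B = CARD('k)\<close> card B(2) by (auto intro!: eq_card_imp_inj_on)
  then have "inj_on f (span ?B)"
    by (intro linear_inj_on_span_independent_image[OF f])
  then show ?thesis by simp
qed

text \<open>The norm of f attains a positive minimum on the compact unit sphere. This makes the
  coordinates on the range of \<open>S' h0\<close> bounded.\<close>

lemma inj_linear_bounded_below:
  fixes f :: "'a::euclidean_space \<Rightarrow> 'e::real_normed_vector"
  assumes f: "linear f" and inj: "inj f"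
  obtains c where "c > 0" "\<And>v. norm v \<le> c * norm (f v)"
proof (cases "sphere (0::'a) 1 = {}")
  case False
  have bl: "bounded_linear f" using f by (simp add: linear_conv_bounded_linear)
  have "\<exists>u\<in>sphere 0 1. \<forall>v\<in>sphere 0 1. norm (f u) \<le> norm (f v)"
    by (intro continuous_attains_inf compact_sphere False continuous_intros
        linear_continuous_on[OF bl])
  then obtain u where u: "u \<in> sphere 0 1" "\<And>v. v \<in> sphere 0 1 \<Longrightarrow> norm (f u) \<le> norm (f v)" by auto
  have pos: "norm (f u) > 0"
    using u(1) inj linear_0[OF f] injD[OF inj, of u 0] by auto
  have "norm v \<le> 1 / norm (f u) * norm (f v)" for v
  proof (cases "v = 0")
    case False
    then have "norm (f u) \<le> norm (f ((1 / norm v) *\<^sub>R v))" by (intro u(2)) auto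
    also have "\<dots> = norm (f v) / norm v" by (simp add: linear_scale[OF f])
    finally show ?thesis using False pos by (simp add: field_simps)
  qed simp
  then show thesis using pos by (intro that[of "1 / norm (f u)"]) auto
next
  case True
  then have "v = 0" for v :: 'a
    by (metis (no_types, lifting) vector_choose_size zero_le_one mem_sphere_0 empty_iff)
  then show thesis by (intro that[of 1]) auto
qed

text \<open>\<open>projector_onto_along\<close> only records memberships; the algebra follows
  because the two subspaces meet in 0.\<close>

lemma projector_simps:
  assumes c: "complementary E1 E2" and p1: "projector_onto_along p1 E1 E2" and p2: "projector_onto_along p2 E2 E1"
  shows "p1 x \<in> E1" "p2 x \<in> E2" "v \<in> E1 \<Longrightarrow> p1 v = v" "v \<in> E2 \<Longrightarrow> p1 v = 0" "v \<in> E2 \<Longrightarrow> p2 v = v"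
    "v \<in> E1 \<Longrightarrow> p2 v = 0" "p1 x + p2 x = x"
proof -
  have sub: "subspace E1" "subspace E2" and i: "\<And>v. v \<in> E1 \<Longrightarrow> v \<in> E2 \<Longrightarrow> v = 0"
    using c by (auto simp: complementary_def)
  have mem: "p1 x \<in> E1" "p2 x \<in> E2" "x - p1 x \<in> E2" "x - p2 x \<in> E1" for x
    using p1 p2 by (auto simp: projector_onto_along_def)
  show "p1 x \<in> E1" "p2 x \<in> E2" by (rule mem)+
  show 1: "p1 v = v" if "v \<in> E1" for v
    using i[of "v - p1 v"] that mem[of v] subspace_diff[OF sub(1)] by auto
  show 2: "p1 v = 0" if "v \<in> E2" for v
    using i[of "p1 v"] that mem[of v] subspace_diff[OF sub(2), of v "v - p1 v"] by auto
  show "p2 v = v" if "v \<in> E2" for v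
    using i[of "v - p2 v"] that mem[of v] subspace_diff[OF sub(2)] by auto
  show "p2 v = 0" if "v \<in> E1" for v
    using i[of "p2 v"] that mem[of v] subspace_diff[OF sub(1), of v "v - p2 v"] by auto
  have "p1 x + p2 x - x = 0"
  proof (rule i)
    show "p1 x + p2 x - x \<in> E1"
      using subspace_diff[OF sub(1) mem(1)[of x] mem(4)[of x]] by (simp add: algebra_simps)
    show "p1 x + p2 x - x \<in> E2"
      using subspace_diff[OF sub(2) mem(2)[of x] mem(3)[of x]] by (simp add: algebra_simps)
  qed
  then show "p1 x + p2 x = x" by simp
qed

text \<open>The block operator \<open>p2 Q p2 + p1\<close> is a bijection of the whole space, so the bounded
  inverse theorem applies to it without treating the subspace as a Banach space.\<close>

lemma nondegenerate_limit:
  fixes Q p1 p2 :: "'e::banach \<Rightarrow>\<^sub>L 'e"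
  assumes c: "complementary E1 E2" and p1: "projector_onto_along p1 E1 E2" and p2: "projector_onto_along p2 E2 E1"
    and bij: "bij_betw (\<lambda>v. p2 (Q (p2 v))) E2 E2"
    and approx: "\<And>e. e > 0 \<Longrightarrow> \<exists>\<beta>\<in>E2. \<exists>\<epsilon>>0. norm (Q \<beta> + \<epsilon> *\<^sub>R \<eta>) \<le> e * (norm \<beta> + \<epsilon>)"
  shows "\<eta> = Q (inv_into E2 (\<lambda>v. p2 (Q (p2 v))) (p2 \<eta>))"
proof -
  note pr = projector_simps[OF c p1 p2]
  have sub: "subspace E2" using c by (simp add: complementary_def)
  define N where "N = (p2 o\<^sub>L Q o\<^sub>L p2) + p1"
  have N: "N v = p2 (Q (p2 v)) + p1 v" for v
    by (simp add: N_def plus_blinfun.rep_eq)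
  have "bij N"
    unfolding bij_def
  proof (intro conjI surjI injI)
    fix u v assume "N u = N v"
    then have eq: "p2 (Q (p2 (u - v))) + p1 (u - v) = 0"
      by (simp add: N blinfun.diff_right algebra_simps)
    have "p1 (p2 (Q (p2 (u - v))) + p1 (u - v)) = 0"
      unfolding eq by simp
    then have a: "p1 (u - v) = 0"
      using pr(3)[OF pr(1)] pr(4)[OF pr(2)] by (simp add: blinfun.add_right)
    then have "p2 (Q (p2 (p2 (u - v)))) = p2 (Q (p2 0))"
      using eq pr(5)[OF pr(2)] by simp
    then have "p2 (u - v) = 0"
      using bij pr(2) subspace_0[OF sub] by (auto simp: bij_betw_def inj_on_def)
    then show "u = v" using a pr(7)[of "u - v"] by simp
  next
    fix y
    let ?v = "inv_into E2 (\<lambda>v. p2 (Q (p2 v))) (p2 y)"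
    have v: "?v \<in> E2" "p2 (Q (p2 ?v)) = p2 y"
      using bij_betw_apply[OF bij_betw_inv_into[OF bij] pr(2)] bij_betw_inv_into_right[OF bij pr(2)] by auto
    show "N (?v + p1 y) = y"
      using v pr(3)[OF pr(1)] pr(4)[OF v(1)] pr(6)[OF pr(1)] pr(7)[of y]
      by (simp add: N blinfun.add_right add.commute)
  qed
  then obtain k where k: "k > 0" "\<And>v. norm v \<le> k * norm (N v)"
    by (rule bijective_blinfun_bounded_below) blast
  define v where "v = inv_into E2 (\<lambda>v. p2 (Q (p2 v))) (p2 \<eta>)"
  have v: "v \<in> E2" "p2 (Q (p2 v)) = p2 \<eta>"
    unfolding v_def using bij_betw_apply[OF bij_betw_inv_into[OF bij] pr(2)] bij_betw_inv_into_right[OF bij pr(2)] by auto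
  define k' where "k' = k * norm p2"
  have k': "k' \<ge> 0" using k(1) by (simp add: k'_def)
  define D where "D = 2 * (norm v + 1) * (1 + norm Q * k')"
  have "1 + norm Q * k' > 0" using k' by (simp add: add_pos_nonneg)
  then have D: "D > 0" by (simp add: D_def add_nonneg_pos)
  have small: "norm (\<eta> - Q v) \<le> e * D" if e: "e > 0" "k' * e \<le> 1 / 2" for e
  proof -
    obtain \<beta> \<epsilon> where \<beta>: "\<beta> \<in> E2" "\<epsilon> > 0" "norm (Q \<beta> + \<epsilon> *\<^sub>R \<eta>) \<le> e * (norm \<beta> + \<epsilon>)"
      using approx[OF e(1)] by auto
    \<comment> \<open>The rescaled displacement should be close to -v: N sends u + v to the
      projection of the residual \<open>Q u + \<eta>\<close>.\<close>
    define u where "u = (1 / \<epsilon>) *\<^sub>R \<beta>"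
    have u: "u \<in> E2" using \<beta>(1) sub by (simp add: u_def subspace_scale)
    have "Q u + \<eta> = (1 / \<epsilon>) *\<^sub>R (Q \<beta> + \<epsilon> *\<^sub>R \<eta>)"
      using \<beta>(2) by (simp add: u_def blinfun.scaleR_right scaleR_add_right)
    then have "norm (Q u + \<eta>) = 1 / \<epsilon> * norm (Q \<beta> + \<epsilon> *\<^sub>R \<eta>)"
      using \<beta>(2) by simp
    also have "\<dots> \<le> 1 / \<epsilon> * (e * (norm \<beta> + \<epsilon>))"
      using \<beta> by (intro mult_left_mono) auto
    also have "\<dots> = e * (norm u + 1)"
      using \<beta>(2) by (simp add: u_def field_simps)
    finally have 1: "norm (Q u + \<eta>) \<le> e * (norm u + 1)" .
    have uv: "u + v \<in> E2" using u v sub by (simp add: subspace_add)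
    have "N (u + v) = p2 (Q u + \<eta>)"
      using v pr(5)[OF uv] pr(4)[OF uv] pr(5)[OF v(1)] by (simp add: N blinfun.add_right)
    then have "norm (u + v) \<le> k * norm (p2 (Q u + \<eta>))"
      using k(2)[of "u + v"] by simp
    also have "\<dots> \<le> k * (norm p2 * (e * (norm u + 1)))"
      using k(1) 1 by (intro mult_left_mono order_trans[OF norm_blinfun]) auto
    finally have 2: "norm (u + v) \<le> k' * e * (norm u + 1)" by (simp add: k'_def mult.assoc)
    also have "\<dots> \<le> 1 / 2 * (norm u + 1)" using e by (intro mult_right_mono) auto
    \<comment> \<open>Since \<open>k' * e \<le> 1 / 2\<close>, the dependence on u is absorbed, and
      u is bounded in terms of v alone.\<close>
    finally have "norm u + 1 \<le> 2 * (norm v + 1)"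
      using norm_triangle_ineq4[of "u + v" v] by simp
    then have 3: "e * (norm u + 1) \<le> e * (2 * (norm v + 1))"
      using e by (intro mult_left_mono) auto
    have "norm (\<eta> - Q v) = norm ((Q u + \<eta>) - Q (u + v))"
      by (simp add: blinfun.add_right)
    also have "\<dots> \<le> norm (Q u + \<eta>) + norm (Q (u + v))" by (rule norm_triangle_ineq4)
    also have "\<dots> \<le> e * (norm u + 1) + norm Q * (k' * e * (norm u + 1))"
      by (intro add_mono 1 order_trans[OF norm_blinfun] mult_left_mono 2) auto
    also have "\<dots> = (1 + norm Q * k') * (e * (norm u + 1))" by (simp add: algebra_simps)
    also have "\<dots> \<le> (1 + norm Q * k') * (e * (2 * (norm v + 1)))"
      by (rule mult_left_mono[OF 3]) (use k' in simp)
    finally show ?thesis by (simp add: D_def ac_simps)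
  qed
  have "norm (\<eta> - Q v) \<le> 0 + e" if "e > 0" for e
  proof -
    define e' where "e' = min (e / D) (1 / (2 * (k' + 1)))"
    have e': "e' > 0" "e' \<le> e / D" "e' \<le> 1 / (2 * (k' + 1))"
      using that D k' by (auto simp: e'_def)
    have "k' * e' \<le> (k' + 1) * (1 / (2 * (k' + 1)))"
      using e' k' by (intro mult_mono) auto
    also have "\<dots> = 1 / 2" using k' by simp
    finally have "norm (\<eta> - Q v) \<le> e' * D"
      by (intro small e')
    also have "\<dots> \<le> e" using e'(2) D by (simp add: field_simps)
    finally show ?thesis by simp
  qed
  then have "norm (\<eta> - Q v) \<le> 0" by (rule field_le_epsilon)
  then show ?thesis by (simp add: v_def)
qed

section \<open>The bifurcation condition\<close>

context mild_problem_at
begin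

theorem forced_curve_in_range:
  fixes S :: "real ^ 'k \<Rightarrow> 'a" and S' :: "real ^ 'k \<Rightarrow> (real ^ 'k) \<Rightarrow>\<^sub>L 'a" and Q p1 p2 :: "'a \<Rightarrow>\<^sub>L 'a"
  assumes V: "open V" "h0 \<in> V"
    and S: "\<And>h. h \<in> V \<Longrightarrow> (S has_derivative S' h) (at h)" "continuous_on V S'"
    and S0: "S h0 = x0 0" and inj: "inj (S' h0)"
    and per: "\<And>h. h \<in> V \<Longrightarrow> \<exists>z. mild 0 T z \<and> z 0 = S h \<and> z T = S h"
    and c: "complementary (range (S' h0)) E2"
    and p1: "projector_onto_along p1 (range (S' h0)) E2"
    and p2: "projector_onto_along p2 E2 (range (S' h0))"
    and Q: "\<And>\<beta>. Q \<beta> = tangent_curve \<beta> T - \<beta>"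
    and bij: "bij_betw (\<lambda>v. p2 (Q (p2 v))) E2 E2"
    and \<epsilon>: "\<And>n. \<epsilon> n \<in> {0<..1}" "\<epsilon> \<longlonglongrightarrow> 0"
    and x: "\<And>n. mild (\<epsilon> n) T (x n)" "\<And>n. x n 0 = x n T" "uniform_limit {0..T} x x0 sequentially"
  shows "forced_curve T = Q (inv_into E2 (\<lambda>v. p2 (Q (p2 v))) (p2 (forced_curve T)))"
proof (rule nondegenerate_limit[OF c p1 p2 bij])
  fix e :: real assume e: "e > 0"
  note pr = projector_simps[OF c p1 p2]
  \<comment> \<open>Coordinates of the \<open>E1\<close> part. This map vanishes exactly on
    \<open>E2\<close>, so solving \<open>l (S h) = l (x n 0)\<close> for h puts the difference in
    \<open>E2\<close>; composed with S it has identity derivative at \<open>h0\<close>, as the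
    inverse function theorem asks.\<close>
  define l where "l w = inv (S' h0) (p1 w)" for w
  have lin: "linear (S' h0)" by (rule bounded_linear.linear[OF blinfun.bounded_linear_right])
  have Sl: "S' h0 (l w) = p1 w" for w
    using pr(1)[of w] by (simp add: l_def f_inv_into_f)
  have lS: "l (S' h0 v) = v" for v
    using injD[OF inj, of "l (S' h0 v)" v] Sl[of "S' h0 v"] pr(3)[of "S' h0 v"] by simp
  obtain k where k: "k > 0" "\<And>v. norm v \<le> k * norm (S' h0 v)"
    using inj_linear_bounded_below[OF lin inj] by metis
  have "bounded_linear l"
  proof (rule bounded_linear_intro)
    show "l (u + v) = l u + l v" for u v
      by (rule injD[OF inj]) (simp add: Sl blinfun.add_right)
    show "l (r *\<^sub>R v) = r *\<^sub>R l v" for r v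
      by (rule injD[OF inj]) (simp add: Sl blinfun.scaleR_right)
    fix w
    have "norm (l w) \<le> k * norm (p1 w)" using k(2)[of "l w"] by (simp add: Sl)
    also have "\<dots> \<le> k * (norm p1 * norm w)"
      using k(1) by (intro mult_left_mono norm_blinfun) auto
    finally show "norm (l w) \<le> norm w * (k * norm p1)" by (simp add: ac_simps)
  qed
  then obtain lb where lb: "\<And>w. blinfun_apply lb w = l w"
    by (metis bounded_linear_Blinfun_apply)
  have "\<exists>U' W g. open U' \<and> U' \<subseteq> V \<and> h0 \<in> U' \<and> open W \<and> lb (S h0) \<in> W \<and> homeomorphism U' W (\<lambda>h. lb (S h)) g"
  proof (rule inverse_function_theorem[where f = "\<lambda>h. lb (S h)" and f' = "\<lambda>h. lb o\<^sub>L S' h" and U = V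
      and ?x0.0 = h0 and invf = id_blinfun])
    show "((\<lambda>h. lb (S h)) has_derivative (lb o\<^sub>L S' h)) (at h)" if "h \<in> V" for h
      using bounded_linear.has_derivative[OF blinfun.bounded_linear_right S(1)[OF that], of lb]
      by (simp add: o_def blinfun_compose.rep_eq)
    show "continuous_on V (\<lambda>h. lb o\<^sub>L S' h)"
      by (intro continuous_intros S(2))
    show "id_blinfun o\<^sub>L (lb o\<^sub>L S' h0) = id_blinfun"
      by (rule blinfun_eqI) (simp add: lb lS)
  qed (use V in blast)+
  then obtain U' W g where W: "U' \<subseteq> V" "h0 \<in> U'" "open W" "lb (S h0) \<in> W"
    and hom: "homeomorphism U' W (\<lambda>h. lb (S h)) g" by blast
  have lim: "(\<lambda>n. x n 0) \<longlonglongrightarrow> S h0"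
    using tendsto_uniform_limitI[OF x(3), of 0] T S0 by simp
  have lbl: "(\<lambda>n. lb (x n 0)) \<longlonglongrightarrow> lb (S h0)"
    by (intro tendsto_intros lim)
  then have ev1: "\<forall>\<^sub>F n in sequentially. lb (x n 0) \<in> W"
    using topological_tendstoD W(3,4) by blast
  have "isCont g (lb (S h0))"
    using hom W by (auto simp: homeomorphism_def continuous_on_eq_continuous_at)
  then have "(\<lambda>n. g (lb (x n 0))) \<longlonglongrightarrow> g (lb (S h0))"
    using lbl isCont_tendsto_compose by blast
  moreover have gh: "g (lb (S h0)) = h0"
    using hom W(2) by (simp add: homeomorphism_def)
  moreover have "isCont S h0"
    using has_derivative_continuous[OF S(1)[OF V(2)]] by simp
  ultimately have "(\<lambda>n. S (g (lb (x n 0)))) \<longlonglongrightarrow> S h0"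
    using isCont_tendsto_compose[of h0 S] by simp
  then have Slim: "(\<lambda>n. near * norm (S (g (lb (x n 0))) - x0 0)) \<longlonglongrightarrow> 0"
    unfolding S0 by (intro tendsto_mult_right_zero tendsto_norm_zero LIM_zero)
  obtain \<delta> where \<delta>: "expansion_radius e \<delta>"
    using strict_expansion[OF e] by blast
  then have \<delta>0: "\<delta> > 0" by (simp add: expansion_radius_def)
  have ev2: "\<forall>\<^sub>F n in sequentially. near * norm (S (g (lb (x n 0))) - x0 0) < min 1 \<delta>"
    using \<delta>0 by (intro order_tendstoD(2)[OF Slim]) auto
  have ev3: "\<forall>\<^sub>F n in sequentially. \<epsilon> n < \<delta>"
    using order_tendstoD(2)[OF \<epsilon>(2) \<delta>0] .
  have ev4: "\<forall>\<^sub>F n in sequentially. \<forall>t\<in>{0..T}. dist (x n t) (x0 t) < \<delta>"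
    using uniform_limitD[OF x(3) \<delta>0] .
  \<comment> \<open>For the given e one late index suffices, because
    \<open>nondegenerate_limit\<close> asks for a single pair per tolerance.\<close>
  have "\<forall>\<^sub>F n in sequentially. lb (x n 0) \<in> W \<and> near * norm (S (g (lb (x n 0))) - x0 0) < min 1 \<delta>
      \<and> \<epsilon> n < \<delta> \<and> (\<forall>t\<in>{0..T}. dist (x n t) (x0 t) < \<delta>)"
    using ev1 ev2 ev3 ev4 by eventually_elim auto
  then obtain n where n: "lb (x n 0) \<in> W" "near * norm (S (g (lb (x n 0))) - x0 0) < min 1 \<delta>"
      "\<epsilon> n < \<delta>" "\<And>t. t \<in> {0..T} \<Longrightarrow> dist (x n t) (x0 t) < \<delta>"
    using eventually_happens'[OF sequentially_bot] by blast
  define h where "h = g (lb (x n 0))"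
  have h: "h \<in> V" "lb (S h) = lb (x n 0)"
    using hom n(1) W(1) by (auto simp: homeomorphism_def h_def)
  define \<beta> where "\<beta> = x n 0 - S h"
  have "l \<beta> = 0"
    using h(2) by (simp add: \<beta>_def blinfun.diff_right flip: lb)
  then have "p1 \<beta> = 0" using Sl[of \<beta>] by simp
  then have \<beta>E: "\<beta> \<in> E2" using pr(7)[of \<beta>] pr(2)[of \<beta>] by simp
  obtain z where z: "mild 0 T z" "z 0 = S h" "z T = S h"
    using per[OF h(1)] by blast
  have nb: "near * norm (S h - x0 0) < min 1 \<delta>" using n(2) by (simp add: h_def)
  then obtain z' where z': "mild 0 T z'" "z' 0 = S h"
      "\<And>t. t \<in> {0..T} \<Longrightarrow> norm (z' t - x0 t) \<le> near * norm (S h - x0 0)"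
    using mild_nearby[of "S h"] by auto
  have TT: "T \<in> {0..T}" using T by simp
  \<comment> \<open>The solution through \<open>S h\<close> from the hypothesis is periodic but not
    known to be close to \<open>x0\<close>; the one from \<open>mild_nearby\<close> is close.
    Uniqueness identifies them.\<close>
  have zn: "\<forall>t\<in>{0..T}. norm (z t - x0 t) \<le> \<delta>"
  proof
    fix t assume t: "t \<in> {0..T}"
    have "z t = z' t" by (rule mild_unique[OF TT z(1) z'(1) _ t]) (simp add: z z')
    then show "norm (z t - x0 t) \<le> \<delta>" using z'(3)[OF t] nb by auto
  qed
  have bound: "norm (x n T - z T - tangent_curve (x n 0 - z 0) T - \<epsilon> n *\<^sub>R forced_curve T) \<le> e * (norm (x n 0 - z 0) + \<epsilon> n)"
    using \<delta> \<epsilon>(1)[of n] n(3) x(1)[of n] z(1) n(4) zn unfolding expansion_radius_def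
    by (auto simp: dist_norm less_imp_le)
  \<comment> \<open>Periodicity of both solutions replaces \<open>x n T - z T\<close> by \<beta>,
    and \<beta> minus its tangent value is \<open>- Q \<beta>\<close>.\<close>
  have eq: "x n T - z T - tangent_curve (x n 0 - z 0) T - \<epsilon> n *\<^sub>R forced_curve T
      = - (Q \<beta> + \<epsilon> n *\<^sub>R forced_curve T)"
    using x(2)[of n] by (simp add: Q \<beta>_def z)
  have "norm (Q \<beta> + \<epsilon> n *\<^sub>R forced_curve T) \<le> e * (norm \<beta> + \<epsilon> n)"
    using bound unfolding eq norm_minus_cancel by (simp only: \<beta>_def z)
  then show "\<exists>\<beta>\<in>E2. \<exists>\<epsilon>>0. norm (Q \<beta> + \<epsilon> *\<^sub>R forced_curve T) \<le> e * (norm \<beta> + \<epsilon>)"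
    using \<beta>E \<epsilon>(1)[of n] by auto
qed

end

section \<open>Resolvent integrals\<close>

text \<open>Integrates the bound on the derivative. The rate k may have either sign, for the growing
  and the decaying half of the line.\<close>

lemma vector_derivative_exp_bound:
  fixes J q :: "real \<Rightarrow> 'b::banach"
  assumes J: "\<And>a. (J has_vector_derivative q a) (at a)" and xy: "x \<le> y" and k: "k \<noteq> 0"
    and q: "\<And>a. a \<in> {x..y} \<Longrightarrow> norm (q a) \<le> c * exp (k * a)"
  shows "norm (J y - J x) \<le> c / k * (exp (k * y) - exp (k * x))"
proof -
  have "(q has_integral (J y - J x)) {x..y}"
    by (rule fundamental_theorem_of_calculus[OF xy]) (rule has_vector_derivative_at_within[OF J])
  moreover have "((\<lambda>a. c * exp (k * a)) has_integral (c / k * exp (k * y) - c / k * exp (k * x))) {x..y}"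
  proof (rule fundamental_theorem_of_calculus[OF xy])
    fix a assume "a \<in> {x..y}"
    have "((\<lambda>a. c / k * exp (k * a)) has_real_derivative c * exp (k * a)) (at a within {x..y})"
      using k by (auto intro!: derivative_eq_intros)
    then show "((\<lambda>a. c / k * exp (k * a)) has_vector_derivative c * exp (k * a)) (at a within {x..y})"
      by (simp add: has_real_derivative_iff_has_vector_derivative)
  qed
  ultimately have "norm (J y - J x) \<le> c / k * exp (k * y) - c / k * exp (k * x)"
    using Henstock_Kurzweil_Integration.integral_norm_bound_integral[of q "{x..y}" "\<lambda>a. c * exp (k * a)"] q
    by (auto simp: has_integral_iff)
  then show ?thesis by (simp add: right_diff_distrib)
qed

lemma continuous_antiderivative:
  fixes p :: "real \<Rightarrow> 'b::banach"
  assumes cont: "continuous_on UNIV p"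
  shows "\<exists>J. \<forall>a. (J has_vector_derivative p a) (at a)"
proof -
  \<comment> \<open>Signed integral from 0: at least one of the two intervals is empty or a point.
    On a window around a it differs by a constant from the integral starting at -n, which gives the
    derivative also at 0.\<close>
  define J0 where "J0 y = integral {0..y} p - integral {y..0} p" for y
  have int: "p integrable_on {x..y}" for x y
    using cont by (intro integrable_continuous_real) (auto intro: continuous_on_subset)
  have J0: "(J0 has_vector_derivative p a) (at a)" for a
  proof -
    define n where "n = \<bar>a\<bar> + 1"
    have a: "a \<in> {-n<..<n}" "0 \<le> n" by (auto simp: n_def)
    have eq: "J0 y = integral {-n..y} p - integral {-n..0} p" if "y \<in> {-n..n}" for y
    proof (cases "y \<ge> 0")
      case True
      then have "integral {-n..0} p + integral {0..y} p = integral {-n..y} p"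
        using that a int by (intro Henstock_Kurzweil_Integration.integral_combine) auto
      moreover have "integral {y..0} p = 0"
        using True by (cases "y = 0") auto
      ultimately show ?thesis by (simp add: J0_def algebra_simps)
    next
      case False
      then have "integral {-n..y} p + integral {y..0} p = integral {-n..0} p"
        using that a int by (intro Henstock_Kurzweil_Integration.integral_combine) auto
      then show ?thesis using False by (simp add: J0_def algebra_simps)
    qed
    have "((\<lambda>y. integral {-n..y} p) has_vector_derivative p a) (at a within {-n..n})"
      using a by (intro integral_has_vector_derivative continuous_on_subset[OF cont]) auto
    then have "((\<lambda>y. integral {-n..y} p - integral {-n..0} p) has_vector_derivative p a - 0) (at a within {-n..n})"
      by (intro has_vector_derivative_diff has_vector_derivative_const)
    then have "(J0 has_vector_derivative p a) (at a within {-n..n})"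
      using a eq by (intro has_vector_derivative_transform[of _ _ J0 "\<lambda>y. integral {-n..y} p - integral {-n..0} p"]) auto
    moreover have "at a within {-n..n} = at a"
      using a by (intro at_within_interior) auto
    ultimately show ?thesis by simp
  qed
  then show ?thesis by blast
qed

lemma vector_derivative_norm_le:
  fixes f :: "real \<Rightarrow> 'b::real_normed_vector"
  assumes f: "\<And>x. (f has_vector_derivative f' x) (at x)"
    and B: "\<And>x. x \<in> closed_segment a b \<Longrightarrow> norm (f' x) \<le> B"
  shows "norm (f b - f a) \<le> B * \<bar>b - a\<bar>"
proof -
  have "B \<ge> 0" using B[of a] order_trans[OF norm_ge_zero] by auto
  have "norm (f b - f a) \<le> B * norm (b - a)"
  proof (rule differentiable_bound[where S = "closed_segment a b" and f' = "\<lambda>x h. h *\<^sub>R f' x"])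
    fix x assume x: "x \<in> closed_segment a b"
    show "(f has_derivative (\<lambda>h. h *\<^sub>R f' x)) (at x within closed_segment a b)"
      using f[of x] by (simp add: has_vector_derivative_def has_derivative_at_withinI)
    show "onorm (\<lambda>h. h *\<^sub>R f' x) \<le> B"
      using mult_left_mono[OF B[OF x] abs_ge_zero] \<open>B \<ge> 0\<close> by (intro onorm_bound) (auto simp: mult.commute)
  qed auto
  then show ?thesis by simp
qed

text \<open>J is the primitive vanishing at minus infinity and P the integral over the whole line.
  Keeping both with explicit exponential tails lets later arguments work on compact
  intervals.\<close>

lemma antiderivative_on_line:
  fixes p :: "real \<Rightarrow> 'b::banach"
  assumes cont: "continuous_on UNIV p" and \<delta>: "\<delta> > 0"
    and p: "\<And>a. norm (p a) \<le> M * exp (- \<delta> * \<bar>a\<bar>)"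
  obtains J P where "\<And>a. (J has_vector_derivative p a) (at a)"
    "\<And>x. norm (J x) \<le> M / \<delta> * exp (\<delta> * x)" "\<And>y. norm (P - J y) \<le> M / \<delta> * exp (- \<delta> * y)"
proof -
  have M: "M \<ge> 0" using p[of 0] order_trans[OF norm_ge_zero] by fastforce
  obtain J0 where J0: "\<And>a. (J0 has_vector_derivative p a) (at a)"
    using continuous_antiderivative[OF cont] by metis
  have up: "norm (J0 y - J0 x) \<le> M / \<delta> * exp (- \<delta> * x)" if "x \<le> y" for x y
  proof -
    have "norm (J0 y - J0 x) \<le> M / (- \<delta>) * (exp (- \<delta> * y) - exp (- \<delta> * x))"
    proof (rule vector_derivative_exp_bound[OF J0 that])
      show "norm (p a) \<le> M * exp (- \<delta> * a)" for a
        using \<delta> M by (intro order_trans[OF p] mult_left_mono) auto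
    qed (use \<delta> in auto)
    also have "\<dots> = M / \<delta> * exp (- \<delta> * x) - M / \<delta> * exp (- \<delta> * y)"
      by (simp add: right_diff_distrib)
    also have "\<dots> \<le> M / \<delta> * exp (- \<delta> * x)" using M \<delta> by simp
    finally show ?thesis .
  qed
  have lo: "norm (J0 y - J0 x) \<le> M / \<delta> * exp (\<delta> * y)" if "x \<le> y" for x y
  proof -
    have "norm (J0 y - J0 x) \<le> M / \<delta> * (exp (\<delta> * y) - exp (\<delta> * x))"
    proof (rule vector_derivative_exp_bound[OF J0 that])
      fix a
      have "exp (- \<delta> * \<bar>a\<bar>) \<le> exp (\<delta> * a)"
        using \<delta> mult_left_mono[of "- \<bar>a\<bar>" a \<delta>] by simp
      then show "norm (p a) \<le> M * exp (\<delta> * a)"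
        using M by (intro order_trans[OF p] mult_left_mono) auto
    qed (use \<delta> in auto)
    also have "\<dots> \<le> M / \<delta> * exp (\<delta> * y)" using M \<delta> by (intro mult_left_mono) auto
    finally show ?thesis .
  qed
  have tail: "(\<lambda>n. M / \<delta> * exp (- \<delta> * real n)) \<longlonglongrightarrow> 0"
    using \<delta> by (intro tendsto_mult_right_zero filterlim_compose[OF exp_at_bot]
        filterlim_tendsto_neg_mult_at_bot[OF tendsto_const _ filterlim_real_sequentially]) auto
  have conv: "\<exists>l. s \<longlonglongrightarrow> l" if "\<And>m n. m \<ge> n \<Longrightarrow> norm (s m - s n) \<le> M / \<delta> * exp (- \<delta> * real n)" for s :: "nat \<Rightarrow> 'b"
  proof -
    have "Cauchy s"
    proof (rule CauchyI)
      fix e :: real assume "e > 0"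
      then have "\<forall>\<^sub>F n in sequentially. M / \<delta> * exp (- \<delta> * real n) < e / 2"
        by (intro order_tendstoD(2)[OF tail]) auto
      then obtain N where "M / \<delta> * exp (- \<delta> * real N) < e / 2"
        using eventually_happens'[OF sequentially_bot] by blast
      then have "norm (s n - s N) < e / 2" if "n \<ge> N" for n
        using \<open>\<And>m n. m \<ge> n \<Longrightarrow> norm (s m - s n) \<le> M / \<delta> * exp (- \<delta> * real n)\<close>[OF that] by linarith
      then show "\<exists>N. \<forall>m\<ge>N. \<forall>n\<ge>N. norm (s m - s n) < e"
        using norm_triangle_half_l by blast
    qed
    then show ?thesis by (simp add: convergent_eq_Cauchy)
  qed
  have "\<exists>l. (\<lambda>n. J0 (- real n)) \<longlonglongrightarrow> l"
  proof (rule conv)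
    fix m n :: nat assume "m \<ge> n"
    then show "norm (J0 (- real m) - J0 (- real n)) \<le> M / \<delta> * exp (- \<delta> * real n)"
      using lo[of "- real m" "- real n"] by (simp add: norm_minus_commute)
  qed
  then obtain l where l: "(\<lambda>n. J0 (- real n)) \<longlonglongrightarrow> l" ..
  have "\<exists>u. (\<lambda>n. J0 (real n)) \<longlonglongrightarrow> u"
    by (rule conv) (rule up, simp)
  then obtain u where u: "(\<lambda>n. J0 (real n)) \<longlonglongrightarrow> u" ..
  have ev: "\<forall>\<^sub>F n in sequentially. x \<le> real n" for x
    using filterlim_real_sequentially by (simp add: filterlim_at_top)
  show thesis
  proof (rule that[of "\<lambda>y. J0 y - l" "u - l"])
    show "((\<lambda>y. J0 y - l) has_vector_derivative p a) (at a)" for a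
      using has_vector_derivative_diff[OF J0[of a] has_vector_derivative_const[of l]] by simp
    show "norm (J0 x - l) \<le> M / \<delta> * exp (\<delta> * x)" for x
    proof (rule tendsto_upperbound)
      show "(\<lambda>n. norm (J0 x - J0 (- real n))) \<longlonglongrightarrow> norm (J0 x - l)" by (intro tendsto_intros l)
      show "\<forall>\<^sub>F n in sequentially. norm (J0 x - J0 (- real n)) \<le> M / \<delta> * exp (\<delta> * x)"
        using ev[of "- x"] by eventually_elim (intro lo, simp)
    qed simp
    have "norm (u - J0 y) \<le> M / \<delta> * exp (- \<delta> * y)" for y
    proof (rule tendsto_upperbound)
      show "(\<lambda>n. norm (J0 (real n) - J0 y)) \<longlonglongrightarrow> norm (u - J0 y)" by (intro tendsto_intros u)
      show "\<forall>\<^sub>F n in sequentially. norm (J0 (real n) - J0 y) \<le> M / \<delta> * exp (- \<delta> * y)"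
        using ev[of y] by eventually_elim (intro up)
    qed simp
    then show "norm (u - l - (J0 y - l)) \<le> M / \<delta> * exp (- \<delta> * y)" for y by simp
  qed
qed

section \<open>Power integrals of a resolvent family\<close>

text \<open>Only the resolvent identity and the decay on the half line are kept, \<open>R s\<close>
  standing for the resolvent at s; the unbounded operator no longer appears.\<close>

locale positive_resolvent =
  fixes R :: "real \<Rightarrow> 'e::banach \<Rightarrow>\<^sub>L 'e" and M :: real
  assumes R_identity: "\<And>s t. 0 \<le> s \<Longrightarrow> 0 \<le> t \<Longrightarrow> R s - R t = (t - s) *\<^sub>R (R s o\<^sub>L R t)"
    and R_bound: "\<And>s. 0 \<le> s \<Longrightarrow> norm (R s) \<le> M / (1 + s)"
begin

lemma M: "M \<ge> 0"
  using order_trans[OF norm_ge_zero R_bound[of 0]] by simp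

lemma R_le: "0 \<le> s \<Longrightarrow> norm (R s) \<le> M"
  using M mult_left_mono[of 1 "1 + s" M] by (intro order_trans[OF R_bound]) (auto simp: divide_le_eq)

lemma R_lipschitz: "0 \<le> s \<Longrightarrow> 0 \<le> t \<Longrightarrow> norm (R s - R t) \<le> \<bar>t - s\<bar> * (M * M)"
  unfolding R_identity norm_scaleR
  by (intro mult_left_mono order_trans[OF norm_blinfun_compose] mult_mono R_le M) auto

lemma R_continuous: "continuous_on {0..} R"
proof (rule continuous_onI)
  fix x e :: real assume x: "x \<in> {0..}" and e: "e > 0"
  show "\<exists>d>0. \<forall>y\<in>{0..}. dist y x < d \<longrightarrow> dist (R y) (R x) \<le> e"
  proof (intro exI[of _ "e / (M * M + 1)"] conjI ballI impI)
    have pos: "M * M + 1 > 0" by (simp add: add_nonneg_pos)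
    then show "e / (M * M + 1) > 0" using e by simp
    fix y assume y: "y \<in> {0..}" "dist y x < e / (M * M + 1)"
    have "dist (R y) (R x) \<le> \<bar>x - y\<bar> * (M * M)"
      using R_lipschitz[of y x] x y by (simp add: dist_norm)
    also have "\<dots> \<le> \<bar>x - y\<bar> * (M * M + 1)" by (intro mult_left_mono) auto
    also have "\<dots> \<le> e" using y(2) pos by (simp add: dist_real_def pos_less_divide_eq abs_minus_commute)
    finally show "dist (R y) (R x) \<le> e" .
  qed
qed

lemma R_exp_continuous: "continuous_on S (\<lambda>a. R (exp a))"
  by (rule continuous_on_compose2[OF R_continuous]) (auto intro!: continuous_intros)

text \<open>The substitution s = exp a turns \<open>(s powr (\<theta> - 1)) *\<^sub>R R s\<close> on
  the half line into this kernel on the line, where it decays exponentially at both ends if 0 <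
  \<theta> < 1.\<close>

definition log_kernel :: "real \<Rightarrow> real \<Rightarrow> 'e \<Rightarrow>\<^sub>L 'e" where
  "log_kernel \<theta> a = exp (\<theta> * a) *\<^sub>R R (exp a)"

lemma log_kernel_continuous [continuous_intros]:
  "continuous_on S f \<Longrightarrow> continuous_on S (\<lambda>a. log_kernel \<theta> (f a))"
  unfolding log_kernel_def by (intro continuous_intros continuous_on_compose2[OF R_exp_continuous[of UNIV]]) auto

text \<open>At minus infinity the exponential decays and R is bounded; at plus infinity the decay 1
  / s of R leaves the exponent \<theta> - 1. The smaller of the two rates serves both ends.\<close>

lemma log_kernel_bound:
  assumes \<theta>: "0 < \<theta>" "\<theta> < 1"
  shows "norm (log_kernel \<theta> a) \<le> M * exp (- min \<theta> (1 - \<theta>) * \<bar>a\<bar>)"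
proof (cases "a \<ge> 0")
  case True
  have "norm (log_kernel \<theta> a) \<le> exp (\<theta> * a) * (M / (1 + exp a))"
    using mult_left_mono[OF R_bound[of "exp a"], of "exp (\<theta> * a)"] by (simp add: log_kernel_def)
  also have "\<dots> \<le> exp (\<theta> * a) * (M / exp a)"
    using M by (intro mult_left_mono divide_left_mono mult_pos_pos) (auto simp: add_pos_pos)
  also have "\<dots> = M * exp (- (1 - \<theta>) * a)"
    by (simp add: exp_diff left_diff_distrib exp_minus)
  also have "\<dots> \<le> M * exp (- min \<theta> (1 - \<theta>) * \<bar>a\<bar>)"
    using True M mult_right_mono[of "min \<theta> (1 - \<theta>)" "1 - \<theta>" a] by (intro mult_left_mono) (auto simp: algebra_simps)
  finally show ?thesis .
next
  case False
  have "norm (log_kernel \<theta> a) \<le> exp (\<theta> * a) * M"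
    unfolding log_kernel_def norm_scaleR using R_le[of "exp a"] by simp
  also have "\<dots> \<le> M * exp (- min \<theta> (1 - \<theta>) * \<bar>a\<bar>)"
    using False M mult_right_mono_neg[of "min \<theta> (1 - \<theta>)" \<theta> a] by (simp add: mult.commute mult_left_mono)
  finally show ?thesis .
qed


definition line_antiderivative :: "real \<Rightarrow> (real \<Rightarrow> 'e \<Rightarrow>\<^sub>L 'e) \<Rightarrow> ('e \<Rightarrow>\<^sub>L 'e) \<Rightarrow> bool" where
  "line_antiderivative \<theta> J P \<longleftrightarrow> (let \<delta> = min \<theta> (1 - \<theta>) in
     (\<forall>a. (J has_vector_derivative log_kernel \<theta> a) (at a)) \<and>
     (\<forall>x. norm (J x) \<le> M / \<delta> * exp (\<delta> * x)) \<and> (\<forall>y. norm (P - J y) \<le> M / \<delta> * exp (- \<delta> * y)))"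

lemma line_antiderivative_exists:
  assumes \<theta>: "0 < \<theta>" "\<theta> < 1"
  shows "\<exists>J P. line_antiderivative \<theta> J P"
proof -
  have "continuous_on UNIV (log_kernel \<theta>)"
    using log_kernel_continuous[of UNIV "\<lambda>a. a"] by (simp add: continuous_on_id)
  then show ?thesis
    by (rule antiderivative_on_line[of "log_kernel \<theta>" "min \<theta> (1 - \<theta>)" M])
      (use \<theta> log_kernel_bound[OF \<theta>] in \<open>auto simp: line_antiderivative_def Let_def\<close>)
qed

text \<open>The operator obtained by integrating \<open>s powr (\<theta> - 1)\<close> against R over
  the half line. For resolvents of A it is a multiple of the power of -A with exponent \<theta> - 1,
  so \<open>neg_power\<close> with exponent \<alpha> corresponds to \<theta> = 1 - \<alpha>.\<close>

definition power_integral :: "real \<Rightarrow> 'e \<Rightarrow>\<^sub>L 'e" where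
  "power_integral \<theta> = (SOME P. \<exists>J. line_antiderivative \<theta> J P)"

lemma power_integral:
  assumes \<theta>: "0 < \<theta>" "\<theta> < 1"
  obtains J where "line_antiderivative \<theta> J (power_integral \<theta>)"
proof -
  have "\<exists>J. line_antiderivative \<theta> J (power_integral \<theta>)"
    unfolding power_integral_def by (rule someI_ex) (use line_antiderivative_exists[OF \<theta>] in blast)
  then show thesis using that by blast
qed

lemma exp_tendsto_0:
  fixes c k :: real
  assumes "k > 0"
  shows "((\<lambda>y. c * exp (- k * y)) \<longlongrightarrow> 0) at_top"
  using assms by (intro tendsto_mult_right_zero filterlim_compose[OF exp_at_bot]
        filterlim_tendsto_neg_mult_at_bot[OF tendsto_const _ filterlim_ident]) auto

text \<open>Undoing the logarithm gives the integral over the half line in which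
  \<open>neg_power\<close> is stated. The primitive \<open>J (ln s)\<close> extends by 0 to s = 0,
  and its limit at infinity is the operator.\<close>

lemma has_integral_power_integral:
  assumes \<theta>: "0 < \<theta>" "\<theta> < 1"
  shows "((\<lambda>s. (s powr (\<theta> - 1)) *\<^sub>R R s x) has_integral power_integral \<theta> x) {0..}"
proof -
  obtain J where "line_antiderivative \<theta> J (power_integral \<theta>)"
    by (rule power_integral[OF \<theta>])
  define \<delta> where "\<delta> = min \<theta> (1 - \<theta>)"
  have \<delta>: "\<delta> > 0" using \<theta> by (simp add: \<delta>_def)
  have J: "\<And>a. (J has_vector_derivative log_kernel \<theta> a) (at a)"
    and J0: "\<And>y. norm (J y) \<le> M / \<delta> * exp (\<delta> * y)"
    and JP: "\<And>y. norm (power_integral \<theta> - J y) \<le> M / \<delta> * exp (- \<delta> * y)"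
    using \<open>line_antiderivative \<theta> J (power_integral \<theta>)\<close> by (auto simp: line_antiderivative_def Let_def \<delta>_def)
  define \<Phi> where "\<Phi> s = (if s = 0 then 0 else J (ln s) x)" for s
  have J0': "norm (J (ln s) x) \<le> M / \<delta> * s powr \<delta> * norm x" if "s > 0" for s
    using order_trans[OF norm_blinfun mult_right_mono[OF J0[of "ln s"], of "norm x"]] that
    by (simp add: powr_def)
  have ftc: "((\<lambda>s. (s powr (\<theta> - 1)) *\<^sub>R R s x) has_integral (\<Phi> b - \<Phi> 0)) {0..b}" if b: "b \<ge> 0" for b
  proof (rule fundamental_theorem_of_calculus_interior[OF b])
    have d: "(\<Phi> has_vector_derivative (s powr (\<theta> - 1)) *\<^sub>R R s x) (at s)" if s: "s > 0" for s
    proof -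
      have "(ln has_vector_derivative inverse s) (at s)"
        using DERIV_ln[OF s] by (simp add: has_real_derivative_iff_has_vector_derivative)
      from vector_diff_chain_at[OF this J]
      have "((\<lambda>s. J (ln s)) has_vector_derivative inverse s *\<^sub>R log_kernel \<theta> (ln s)) (at s)"
        by (simp add: o_def)
      then have "((\<lambda>s. J (ln s) x) has_vector_derivative (inverse s *\<^sub>R log_kernel \<theta> (ln s)) x) (at s)"
        by (rule bounded_linear.has_vector_derivative[OF blinfun.bounded_linear_left])
      moreover have "(inverse s *\<^sub>R log_kernel \<theta> (ln s)) x = (s powr (\<theta> - 1)) *\<^sub>R R s x"
        using s by (simp add: log_kernel_def scaleR_blinfun.rep_eq powr_def left_diff_distrib exp_diff field_simps)
      ultimately have "((\<lambda>s. J (ln s) x) has_vector_derivative (s powr (\<theta> - 1)) *\<^sub>R R s x) (at s within {0<..})"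
        by (simp add: has_vector_derivative_at_within)
      then have "(\<Phi> has_vector_derivative (s powr (\<theta> - 1)) *\<^sub>R R s x) (at s within {0<..})"
        by (rule has_vector_derivative_transform[rotated 2]) (use s in \<open>auto simp: \<Phi>_def\<close>)
      moreover have "at s within {0<..} = at s"
        using s by (intro at_within_open) auto
      ultimately show ?thesis by simp
    qed
    show "(\<Phi> has_vector_derivative (s powr (\<theta> - 1)) *\<^sub>R R s x) (at s)" if "s \<in> {0<..<b}" for s
      using d that by auto
    show "continuous_on {0..b} \<Phi>"
      unfolding continuous_on_eq_continuous_within
    proof
      fix s assume s: "s \<in> {0..b}"
      show "continuous (at s within {0..b}) \<Phi>"
      proof (cases "s = 0")
        case False
        then show ?thesis
          using d[of s] s has_vector_derivative_continuous continuous_at_imp_continuous_at_within by fastforce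
      next
        case True
        have "continuous_on {0..b} (\<lambda>s. M / \<delta> * s powr \<delta> * norm x)"
          using \<delta> by (auto intro!: continuous_intros continuous_on_powr')
        then have "((\<lambda>s. M / \<delta> * s powr \<delta> * norm x) \<longlongrightarrow> 0) (at 0 within {0..b})"
          using b \<delta> by (auto simp: continuous_on_def dest!: bspec[of _ _ 0])
        then have "(\<Phi> \<longlongrightarrow> 0) (at 0 within {0..b})"
          by (rule Lim_null_comparison[rotated])
            (auto simp: eventually_at_filter \<Phi>_def intro!: always_eventually order_trans[OF J0'])
        then show ?thesis using True by (simp add: continuous_within \<Phi>_def)
      qed
    qed
  qed
  have lim: "(\<Phi> \<longlongrightarrow> power_integral \<theta> x) at_top"
  proof (rule Lim_transform_eventually)
    have "((\<lambda>y. J y - power_integral \<theta>) \<longlongrightarrow> 0) at_top"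
      by (rule Lim_null_comparison[OF _ exp_tendsto_0[OF \<delta>, of "M / \<delta>"]])
        (use JP in \<open>auto simp: norm_minus_commute\<close>)
    then have "(J \<longlongrightarrow> power_integral \<theta>) at_top" by (simp add: LIM_zero_cancel)
    then have "((\<lambda>s. J (ln s)) \<longlongrightarrow> power_integral \<theta>) at_top"
      by (rule filterlim_compose[OF _ ln_at_top])
    then show "((\<lambda>s. J (ln s) x) \<longlongrightarrow> power_integral \<theta> x) at_top" by (intro tendsto_intros)
    show "\<forall>\<^sub>F s in at_top. J (ln s) x = \<Phi> s"
      using eventually_gt_at_top[of "0::real"] by eventually_elim (simp add: \<Phi>_def)
  qed
  \<comment> \<open>For the unbounded domain the characterization asks for intervals containing a
    large ball; their negative part contributes 0 and the rest is the primitive at b.\<close>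
  show ?thesis
  proof (subst has_integral', intro allI impI)
    fix e :: real assume "e > 0"
    then have "\<forall>\<^sub>F b in at_top. dist (\<Phi> b) (power_integral \<theta> x) < e"
      using tendstoD[OF lim] by blast
    then obtain N where N: "\<And>b. b \<ge> N \<Longrightarrow> dist (\<Phi> b) (power_integral \<theta> x) < e"
      by (auto simp: eventually_at_top_linorder)
    show "\<exists>B>0. \<forall>a b. ball 0 B \<subseteq> cbox a b \<longrightarrow>
      (\<exists>z. ((\<lambda>s. if s \<in> {0..} then (s powr (\<theta> - 1)) *\<^sub>R R s x else 0) has_integral z) (cbox a b)
        \<and> norm (z - power_integral \<theta> x) < e)"
    proof (intro exI[of _ "max 1 N"] conjI allI impI)
      fix a b :: real assume "ball 0 (max 1 N) \<subseteq> cbox a b"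
      moreover have "- (max 1 N) < u \<Longrightarrow> u < max 1 N \<Longrightarrow> u \<in> ball 0 (max 1 N)" for u :: real
        by (auto simp: dist_real_def)
      ultimately have sub: "{- max 1 N<..<max 1 N} \<subseteq> {a..b}" by auto
      then have ab: "a \<le> - max 1 N \<and> max 1 N \<le> b"
        using greaterThanLessThan_subseteq_atLeastAtMost_iff[of "- max 1 N" "max 1 N" a b] by auto
      have "((\<lambda>s. if s \<in> {0..} then (s powr (\<theta> - 1)) *\<^sub>R R s x else 0) has_integral (\<Phi> b - \<Phi> 0)) {a..b}"
      proof -
        let ?f = "\<lambda>s. if s \<in> {0..} then (s powr (\<theta> - 1)) *\<^sub>R R s x else 0"
        have "(?f has_integral 0) {a..0}"
          by (rule has_integral_is_0) auto
        moreover have "(?f has_integral (\<Phi> b - \<Phi> 0)) {0..b}"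
          by (rule has_integral_eq[OF _ ftc]) (use ab in auto)
        ultimately have "(?f has_integral (0 + (\<Phi> b - \<Phi> 0))) {a..b}"
          by (intro has_integral_combine[where c = 0]) (use ab in auto)
        then show ?thesis by simp
      qed
      then show "\<exists>z. ((\<lambda>s. if s \<in> {0..} then (s powr (\<theta> - 1)) *\<^sub>R R s x else 0) has_integral z) (cbox a b)
          \<and> norm (z - power_integral \<theta> x) < e"
        using N[of b] ab by (intro exI[of _ "\<Phi> b - \<Phi> 0"]) (auto simp: \<Phi>_def dist_norm)
    qed auto
  qed
qed

text \<open>The bound comes from splitting the integral at \<open>t = 1 / \<tau>\<close> and using
  \<open>R t v = y - t *\<^sub>R R t y\<close> below and the decay of the resolvent above.\<close>

lemma power_integral_interpolation:
  assumes \<theta>: "0 < \<theta>" "\<theta> < 1" and \<tau>: "\<tau> > 0" and y: "y = R 0 v"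
  shows "norm (power_integral \<theta> v) \<le> \<tau> powr (- \<theta>) * ((1 + M) / \<theta> * norm y + M / (1 - \<theta>) * \<tau> * norm v)"
proof -
  obtain J where "line_antiderivative \<theta> J (power_integral \<theta>)"
    by (rule power_integral[OF \<theta>])
  define \<delta> where "\<delta> = min \<theta> (1 - \<theta>)"
  have \<delta>: "\<delta> > 0" using \<theta> by (simp add: \<delta>_def)
  have J: "\<And>a. (J has_vector_derivative log_kernel \<theta> a) (at a)"
    and J0: "\<And>y. norm (J y) \<le> M / \<delta> * exp (\<delta> * y)"
    and JP: "\<And>y. norm (power_integral \<theta> - J y) \<le> M / \<delta> * exp (- \<delta> * y)"
    using \<open>line_antiderivative \<theta> J (power_integral \<theta>)\<close> by (auto simp: line_antiderivative_def Let_def \<delta>_def)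
  define I where "I a = J a v" for a
  have I: "(I has_vector_derivative log_kernel \<theta> a v) (at a)" for a
    unfolding I_def by (rule bounded_linear.has_vector_derivative[OF blinfun.bounded_linear_left J])
  \<comment> \<open>The logarithmic coordinate of the splitting point 1 / \<tau>.\<close>
  define b where "b = - ln \<tau>"
  have expb: "exp (k * b) = \<tau> powr (- k)" for k
    using \<tau> by (simp add: b_def powr_def)
  have lo: "norm (log_kernel \<theta> a v) \<le> (1 + M) * norm y * exp (\<theta> * a)" for a
  proof -
    have "(R 0 - R (exp a)) v = exp a *\<^sub>R R (exp a) (R 0 v)"
    proof -
      have "R (exp a) - R 0 = - exp a *\<^sub>R (R (exp a) o\<^sub>L R 0)" using R_identity[of "exp a" 0] by simp
      then have "R 0 - R (exp a) = exp a *\<^sub>R (R (exp a) o\<^sub>L R 0)" by (simp add: algebra_simps)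
      then show ?thesis by (simp add: scaleR_blinfun.rep_eq)
    qed
    then have eq: "R (exp a) v = y - exp a *\<^sub>R R (exp a) y"
      by (simp add: y minus_blinfun.rep_eq algebra_simps)
    have "norm (exp a *\<^sub>R R (exp a) y) \<le> exp a * (M / (1 + exp a) * norm y)"
      unfolding norm_scaleR abs_exp_cancel
      by (intro mult_left_mono order_trans[OF norm_blinfun] mult_right_mono R_bound) auto
    also have "\<dots> \<le> M * norm y"
      using M add_pos_pos[of 1 "exp a"] mult_right_mono[of "exp a" "1 + exp a" "M * norm y"]
      by (simp add: divide_le_eq ac_simps)
    finally have "norm (R (exp a) v) \<le> norm y + M * norm y"
      unfolding eq by (intro order_trans[OF norm_triangle_ineq4]) simp
    then have "exp (\<theta> * a) * norm (R (exp a) v) \<le> exp (\<theta> * a) * ((1 + M) * norm y)"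
      by (intro mult_left_mono) (auto simp: algebra_simps)
    then show ?thesis by (simp add: log_kernel_def scaleR_blinfun.rep_eq ac_simps)
  qed
  have hi: "norm (log_kernel \<theta> a v) \<le> M * norm v * exp ((\<theta> - 1) * a)" for a
  proof -
    have "norm (R (exp a) v) \<le> M / (1 + exp a) * norm v"
      using order_trans[OF norm_blinfun mult_right_mono[OF R_bound[of "exp a"], of "norm v"]] by simp
    also have "\<dots> \<le> M / exp a * norm v"
      using M by (intro mult_right_mono divide_left_mono mult_pos_pos) (auto simp: add_pos_pos)
    finally have "exp (\<theta> * a) * norm (R (exp a) v) \<le> exp (\<theta> * a) * (M / exp a * norm v)"
      by (intro mult_left_mono) auto
    also have "\<dots> = M * norm v * exp ((\<theta> - 1) * a)"
      by (simp add: left_diff_distrib exp_diff)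
    finally show ?thesis by (simp add: log_kernel_def scaleR_blinfun.rep_eq)
  qed
  have "(\<lambda>n. I b - I (- real n)) \<longlonglongrightarrow> I b - 0"
  proof (intro tendsto_intros)
    have "((\<lambda>y. J (- y)) \<longlongrightarrow> 0) at_top"
      by (rule Lim_null_comparison[OF _ exp_tendsto_0[OF \<delta>, of "M / \<delta>"]])
        (use J0[of "- y" for y] in auto)
    then have "(\<lambda>n. J (- real n) v) \<longlonglongrightarrow> (0 :: 'e \<Rightarrow>\<^sub>L 'e) v"
      by (intro tendsto_intros filterlim_compose[OF _ filterlim_real_sequentially])
    then show "(\<lambda>n. I (- real n)) \<longlonglongrightarrow> 0" by (simp add: I_def)
  qed
  then have "(\<lambda>n. norm (I b - I (- real n))) \<longlonglongrightarrow> norm (I b)"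
    using tendsto_norm by fastforce
  then have 1: "norm (I b) \<le> (1 + M) * norm y / \<theta> * exp (\<theta> * b)"
  proof (rule tendsto_upperbound)
    have "\<forall>\<^sub>F n in sequentially. - b \<le> real n"
      using filterlim_real_sequentially by (simp add: filterlim_at_top)
    then show "\<forall>\<^sub>F n in sequentially. norm (I b - I (- real n)) \<le> (1 + M) * norm y / \<theta> * exp (\<theta> * b)"
    proof eventually_elim
      case (elim n)
      have "norm (I b - I (- real n)) \<le> (1 + M) * norm y / \<theta> * (exp (\<theta> * b) - exp (\<theta> * (- real n)))"
        by (rule vector_derivative_exp_bound[OF I]) (use elim \<theta> lo in auto)
      also have "\<dots> \<le> (1 + M) * norm y / \<theta> * exp (\<theta> * b)"
        using M \<theta> by (intro mult_left_mono) auto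
      finally show ?case .
    qed
  qed simp
  have "((\<lambda>y. J y - power_integral \<theta>) \<longlongrightarrow> 0) at_top"
    by (rule Lim_null_comparison[OF _ exp_tendsto_0[OF \<delta>, of "M / \<delta>"]])
      (use JP in \<open>auto simp: norm_minus_commute\<close>)
  then have "(J \<longlongrightarrow> power_integral \<theta>) at_top" by (simp add: LIM_zero_cancel)
  then have "(\<lambda>n. J (real n)) \<longlonglongrightarrow> power_integral \<theta>"
    by (rule filterlim_compose[OF _ filterlim_real_sequentially])
  then have "(\<lambda>n. norm (I (real n) - I b)) \<longlonglongrightarrow> norm (power_integral \<theta> v - I b)"
    unfolding I_def by (intro tendsto_intros)
  then have 2: "norm (power_integral \<theta> v - I b) \<le> M * norm v / (1 - \<theta>) * exp ((\<theta> - 1) * b)"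
  proof (rule tendsto_upperbound)
    have "\<forall>\<^sub>F n in sequentially. b \<le> real n"
      using filterlim_real_sequentially by (simp add: filterlim_at_top)
    then show "\<forall>\<^sub>F n in sequentially. norm (I (real n) - I b) \<le> M * norm v / (1 - \<theta>) * exp ((\<theta> - 1) * b)"
    proof eventually_elim
      case (elim n)
      have "norm (I (real n) - I b) \<le> M * norm v / (\<theta> - 1) * (exp ((\<theta> - 1) * real n) - exp ((\<theta> - 1) * b))"
        by (rule vector_derivative_exp_bound[OF I]) (use elim \<theta> hi in auto)
      also have "\<dots> = M * norm v / (1 - \<theta>) * (exp ((\<theta> - 1) * b) - exp ((\<theta> - 1) * real n))"
        using \<theta> by (simp add: field_simps)
      also have "\<dots> \<le> M * norm v / (1 - \<theta>) * exp ((\<theta> - 1) * b)"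
        using M \<theta> by (intro mult_left_mono) auto
      finally show ?case .
    qed
  qed simp
  have "norm (power_integral \<theta> v) \<le> norm (I b) + norm (power_integral \<theta> v - I b)"
    using norm_triangle_ineq[of "I b" "power_integral \<theta> v - I b"] by simp
  also have "\<dots> \<le> (1 + M) * norm y / \<theta> * \<tau> powr (- \<theta>) + M * norm v / (1 - \<theta>) * (\<tau> powr (- \<theta>) * \<tau>)"
    using 1 2 \<tau> powr_add[of \<tau> "- \<theta>" 1] by (simp add: expb)
  also have "\<dots> = \<tau> powr (- \<theta>) * ((1 + M) / \<theta> * norm y + M / (1 - \<theta>) * \<tau> * norm v)"
    by (simp add: algebra_simps)
  finally show ?thesis .
qed

end

section \<open>The weight of the Frullani integral\<close>

text \<open>The telescoping integral over a shift by r leaves a factor r, and the resolvent identity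
  a divisor \<open>exp r - 1\<close>; 1 fills the removable singularity.\<close>

definition exp_quotient :: "real \<Rightarrow> real" where
  "exp_quotient r = (if r = 0 then 1 else r / (exp r - 1))"

text \<open>All three come from the tangent line of exp. The upper bounds limit the growth of the
  truncated integrals; the lower bound makes their normalization positive.\<close>

lemma exp_quotient_bounds:
  "exp (- \<bar>r\<bar>) \<le> exp_quotient r" "0 \<le> r \<Longrightarrow> exp_quotient r \<le> 1" "r \<le> 0 \<Longrightarrow> exp_quotient r \<le> exp (- r)"
proof -
  have 1: "r \<le> exp r - 1" using exp_ge_add_one_self[of r] by linarith
  have "1 - r \<le> exp (- r)" using exp_ge_add_one_self[of "- r"] by linarith
  then have "exp r * (1 - r) \<le> exp r * exp (- r)" by simp
  then have 2: "exp r - 1 \<le> r * exp r" by (simp add: exp_minus algebra_simps)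
  show "0 \<le> r \<Longrightarrow> exp_quotient r \<le> 1"
    using 1 by (auto simp: exp_quotient_def divide_le_eq)
  show "r \<le> 0 \<Longrightarrow> exp_quotient r \<le> exp (- r)"
    using 2 by (auto simp: exp_quotient_def exp_minus field_simps)
  show "exp (- \<bar>r\<bar>) \<le> exp_quotient r"
  proof (cases r "0 :: real" rule: linorder_cases)
    case less
    then have "1 \<le> exp_quotient r" using 1 by (simp add: exp_quotient_def le_divide_eq)
    then show ?thesis using less by (meson abs_ge_zero exp_le_one_iff neg_le_0_iff_le order_trans)
  next
    case greater
    then show ?thesis using 2 by (simp add: exp_quotient_def exp_minus field_simps)
  qed (simp add: exp_quotient_def)
qed

lemma exp_quotient_nonneg: "0 \<le> exp_quotient r"
  by (rule order_trans[OF _ exp_quotient_bounds(1)]) simp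

lemma exp_quotient_continuous: "continuous_on S exp_quotient"
proof -
  have "isCont exp_quotient r" for r
  proof (cases "r = 0")
    case True
    have "((\<lambda>r::real. inverse ((exp r - 1) / r)) \<longlongrightarrow> inverse 1) (at 0)"
      by (intro tendsto_inverse lim_exp_minus_1) simp
    then have "((\<lambda>r::real. inverse ((exp r - 1) / r)) \<longlongrightarrow> 1) (at 0)" by simp
    then have "(exp_quotient \<longlongrightarrow> 1) (at 0)"
      by (rule Lim_transform_eventually) (auto simp: exp_quotient_def eventually_at_filter simp flip: inverse_eq_divide)
    then show ?thesis using True by (simp add: isCont_def exp_quotient_def)
  next
    case False
    have "isCont (\<lambda>r. r / (exp r - 1)) r"
      using False by (intro continuous_intros) auto
    moreover have "\<forall>\<^sub>F x in nhds r. x / (exp x - 1) = exp_quotient x"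
      using t1_space_nhds[OF False] by eventually_elim (simp add: exp_quotient_def)
    ultimately show ?thesis using isCont_cong[of "\<lambda>r. r / (exp r - 1)" exp_quotient r] by simp
  qed
  then show ?thesis by (simp add: continuous_at_imp_continuous_on)
qed

context positive_resolvent
begin

text \<open>In logarithmic coordinates the product of the two integrals is a double integral over the
  plane. After the shear \<open>b = a + r\<close> the resolvent identity makes the inner integrand telescope:
  the integral over \<open>a\<close> tends to \<open>exp_quotient r * exp (\<alpha> * r)\<close> times \<open>R 0\<close>, a Frullani integral.\<close>

lemma power_integral_product:
  assumes \<alpha>: "0 < \<alpha>" "\<alpha> < 1"
  shows "\<exists>\<mu>. R 0 = \<mu> *\<^sub>R (power_integral (1 - \<alpha>) o\<^sub>L power_integral \<alpha>)"
proof -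
  define \<beta> where "\<beta> = 1 - \<alpha>"
  have \<beta>: "0 < \<beta>" "\<beta> < 1" using \<alpha> by (auto simp: \<beta>_def)
  define \<delta> where "\<delta> = min \<alpha> (1 - \<alpha>)"
  have \<delta>: "0 < \<delta>" "\<delta> \<le> \<alpha>" "\<delta> \<le> 1 - \<alpha>" using \<alpha> by (auto simp: \<delta>_def)
  have \<delta>': "min \<beta> (1 - \<beta>) = \<delta>" "min \<alpha> (1 - \<alpha>) = \<delta>" by (auto simp: \<beta>_def \<delta>_def)
  define P where "P = power_integral \<beta>"
  define Q where "Q = power_integral \<alpha>"
  obtain JP where "line_antiderivative \<beta> JP P" unfolding P_def by (rule power_integral[OF \<beta>])
  then have JP: "\<And>a. (JP has_vector_derivative log_kernel \<beta> a) (at a)"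
    and JP0: "\<And>y. norm (JP y) \<le> M / \<delta> * exp (\<delta> * y)" and JP1: "\<And>y. norm (P - JP y) \<le> M / \<delta> * exp (- \<delta> * y)"
    by (auto simp: line_antiderivative_def Let_def \<delta>')
  obtain JQ where "line_antiderivative \<alpha> JQ Q" unfolding Q_def by (rule power_integral[OF \<alpha>])
  then have JQ: "\<And>a. (JQ has_vector_derivative log_kernel \<alpha> a) (at a)"
    and JQ0: "\<And>y. norm (JQ y) \<le> M / \<delta> * exp (\<delta> * y)" and JQ1: "\<And>y. norm (Q - JQ y) \<le> M / \<delta> * exp (- \<delta> * y)"
    by (auto simp: line_antiderivative_def Let_def \<delta>')
  define Z where "Z a = R (exp a)" for a
  have Zc: "continuous_on UNIV Z" unfolding Z_def by (rule R_exp_continuous)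
  have Zc': "continuous_on S (\<lambda>a. Z (f a))" if "continuous_on S f" for S and f :: "'z::topological_space \<Rightarrow> real"
    by (rule continuous_on_compose2[OF Zc that]) auto
  \<comment> \<open>A primitive of Z turns the telescoping integral into four boundary
    values.\<close>
  obtain W where W: "\<And>a. (W has_vector_derivative Z a) (at a)"
    using continuous_antiderivative[OF Zc] by metis
  have JQc: "continuous_on S (\<lambda>a. JQ (f a))" if "continuous_on S f" for S and f :: "real \<Rightarrow> real"
    by (rule continuous_on_compose2[OF continuous_at_imp_continuous_on that, of UNIV])
      (use has_vector_derivative_continuous[OF JQ] in auto)
  define H where "H a r = log_kernel \<beta> a o\<^sub>L log_kernel \<alpha> (a + r)" for a r
  have Hc: "continuous_on S (\<lambda>p. H (f p) (g p))" if "continuous_on S f" "continuous_on S g"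
    for S and f g :: "'z::topological_space \<Rightarrow> real"
    unfolding H_def by (intro continuous_intros that)
  \<comment> \<open>The window for a is twice as long as the one for r, so that every shifted
    endpoint stays at distance at least N from 0, where Z is close to one of its limits 0 and
    \<open>R 0\<close>.\<close>
  define Y where "Y N r = integral {-2*N..2*N} (\<lambda>a. H a r)" for N r
  define X where "X N = integral {-N..N} (Y N)" for N
  define \<kappa> where "\<kappa> N = integral {-N..N} (\<lambda>r. exp_quotient r * exp (\<alpha> * r))" for N
  have \<phi>c: "continuous_on S (\<lambda>r. exp_quotient r * exp (\<alpha> * r))" for S
    by (intro continuous_intros exp_quotient_continuous)

  \<comment> \<open>Fubini on the rectangle makes the inner integral over r a difference of values
    of \<open>JQ\<close>. Both truncations cost exponentially little: the loss
    \<open>exp (\<delta> * \<bar>a\<bar>)\<close> in the inner one is offset by the decay of the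
    outer kernel.\<close>
  have X_near: "norm ((P o\<^sub>L Q) - X N) \<le> M / \<delta> * exp (- \<delta> * (2 * N)) * 2 * norm Q + M * (2 * M / \<delta> * exp (- \<delta> * N)) * (4 * N)"
    if N: "N \<ge> 0" for N
  proof -
    let ?J = "JP (2 * N) - JP (- 2 * N)"
    have JP': "(log_kernel \<beta> has_integral ?J) {-2*N..2*N}"
      using N by (intro fundamental_theorem_of_calculus has_vector_derivative_at_within[OF JP]) auto
    then have i1: "((\<lambda>a. log_kernel \<beta> a o\<^sub>L Q) has_integral (?J o\<^sub>L Q)) {-2*N..2*N}"
      using has_integral_linear[OF JP' bounded_bilinear.bounded_linear_left[OF bounded_bilinear_blinfun_compose, of Q]]
      by (simp add: o_def)
    have inner: "integral {-N..N} (\<lambda>r. H a r) = log_kernel \<beta> a o\<^sub>L (JQ (a + N) - JQ (a - N))" for a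
    proof -
      have "((\<lambda>r. log_kernel \<alpha> (a + r)) has_integral (JQ (a + N) - JQ (a + - N))) {-N..N}"
      proof (rule fundamental_theorem_of_calculus)
        fix r
        have "((\<lambda>r. a + r) has_vector_derivative 1) (at r)"
          by (auto intro!: derivative_eq_intros)
        from vector_diff_chain_at[OF this JQ]
        show "((\<lambda>r. JQ (a + r)) has_vector_derivative log_kernel \<alpha> (a + r)) (at r within {-N..N})"
          by (simp add: o_def has_vector_derivative_at_within)
      qed (use N in auto)
      from has_integral_linear[OF this bounded_bilinear.bounded_linear_right[OF bounded_bilinear_blinfun_compose, of "log_kernel \<beta> a"]]
      show ?thesis by (auto simp: o_def H_def)
    qed
    have "X N = integral {-2*N..2*N} (\<lambda>a. integral {-N..N} (\<lambda>r. H a r))"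
      unfolding X_def Y_def cbox_interval[symmetric]
      by (rule integral_swap_continuous[symmetric]) (auto simp: split_beta intro!: Hc continuous_intros)
    also have "\<dots> = integral {-2*N..2*N} (\<lambda>a. log_kernel \<beta> a o\<^sub>L (JQ (a + N) - JQ (a - N)))"
      by (simp only: inner)
    finally have Xeq: "X N = \<dots>" .
    have c2: "continuous_on {-2*N..2*N} (\<lambda>a. log_kernel \<beta> a o\<^sub>L (JQ (a + N) - JQ (a - N)))"
      by (intro continuous_intros JQc)
    have "(?J o\<^sub>L Q) - X N = integral {-2*N..2*N} (\<lambda>a. (log_kernel \<beta> a o\<^sub>L Q) - (log_kernel \<beta> a o\<^sub>L (JQ (a + N) - JQ (a - N))))"
      using i1 integrable_continuous_real[OF c2] unfolding Xeq
      by (subst Henstock_Kurzweil_Integration.integral_diff) (auto simp: has_integral_iff)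
    also have "norm \<dots> \<le> M * (2 * M / \<delta> * exp (- \<delta> * N)) * (2 * N - - 2 * N)"
    proof (rule integral_bound)
      show "continuous_on {- 2 * N..2 * N} (\<lambda>a. (log_kernel \<beta> a o\<^sub>L Q) - (log_kernel \<beta> a o\<^sub>L (JQ (a + N) - JQ (a - N))))"
        by (intro continuous_intros JQc)
      fix a
      have "norm ((Q - JQ (a + N)) + JQ (a - N)) \<le> M / \<delta> * exp (- \<delta> * (a + N)) + M / \<delta> * exp (\<delta> * (a - N))"
        by (intro norm_triangle_mono JQ0 JQ1)
      also have "\<dots> \<le> M / \<delta> * exp (\<delta> * \<bar>a\<bar> - \<delta> * N) + M / \<delta> * exp (\<delta> * \<bar>a\<bar> - \<delta> * N)"
      proof (intro add_mono mult_left_mono)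
        have "- a * \<delta> \<le> \<bar>a\<bar> * \<delta>" "a * \<delta> \<le> \<bar>a\<bar> * \<delta>"
          using \<delta> by (intro mult_right_mono; simp)+
        then show "exp (- \<delta> * (a + N)) \<le> exp (\<delta> * \<bar>a\<bar> - \<delta> * N)" "exp (\<delta> * (a - N)) \<le> exp (\<delta> * \<bar>a\<bar> - \<delta> * N)"
          by (simp_all add: algebra_simps)
      qed (use M \<delta> in auto)
      also have "\<dots> = 2 * M / \<delta> * exp (- \<delta> * N) * exp (\<delta> * \<bar>a\<bar>)"
        by (simp add: exp_add[symmetric] exp_diff exp_minus field_simps)
      finally have q: "norm (Q - (JQ (a + N) - JQ (a - N))) \<le> 2 * M / \<delta> * exp (- \<delta> * N) * exp (\<delta> * \<bar>a\<bar>)"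
        by (simp add: algebra_simps)
      have "norm (log_kernel \<beta> a o\<^sub>L (Q - (JQ (a + N) - JQ (a - N))))
          \<le> (M * exp (- \<delta> * \<bar>a\<bar>)) * (2 * M / \<delta> * exp (- \<delta> * N) * exp (\<delta> * \<bar>a\<bar>))"
        using log_kernel_bound[OF \<beta>, of a] M unfolding \<delta>'
        by (intro order_trans[OF norm_blinfun_compose] mult_mono q) auto
      also have "\<dots> = M * (2 * M / \<delta> * exp (- \<delta> * N))"
        by (simp add: exp_minus)
      finally show "norm ((log_kernel \<beta> a o\<^sub>L Q) - (log_kernel \<beta> a o\<^sub>L (JQ (a + N) - JQ (a - N)))) \<le> M * (2 * M / \<delta> * exp (- \<delta> * N))"
        by (simp add: bounded_bilinear.diff_right[OF bounded_bilinear_blinfun_compose])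
    qed (use N in auto)
    finally have A: "norm ((?J o\<^sub>L Q) - X N) \<le> M * (2 * M / \<delta> * exp (- \<delta> * N)) * (4 * N)"
      by simp
    have "norm ((P - JP (2 * N)) + JP (- 2 * N)) \<le> M / \<delta> * exp (- \<delta> * (2 * N)) + M / \<delta> * exp (\<delta> * (- 2 * N))"
      by (intro norm_triangle_mono JP0 JP1)
    then have "norm (P - ?J) \<le> M / \<delta> * exp (- \<delta> * (2 * N)) * 2"
      by (simp add: algebra_simps)
    then have B: "norm ((P - ?J) o\<^sub>L Q) \<le> M / \<delta> * exp (- \<delta> * (2 * N)) * 2 * norm Q"
      by (intro order_trans[OF norm_blinfun_compose] mult_right_mono) auto
    have eq: "(P o\<^sub>L Q) - X N = ((P - ?J) o\<^sub>L Q) + ((?J o\<^sub>L Q) - X N)"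
      by (simp add: bounded_bilinear.diff_left[OF bounded_bilinear_blinfun_compose])
    show ?thesis unfolding eq by (rule norm_triangle_mono[OF B A])
  qed

  have \<phi>_le: "exp_quotient r * exp (\<alpha> * r) \<le> exp ((1 - \<delta>) * N)" if "\<bar>r\<bar> \<le> N" for r N
  proof (cases "r \<ge> 0")
    case True
    have "exp_quotient r * exp (\<alpha> * r) \<le> 1 * exp (\<alpha> * r)"
      using exp_quotient_bounds(2)[OF True] by (intro mult_right_mono) auto
    also have "\<dots> \<le> exp ((1 - \<delta>) * N)"
      using True that \<delta> \<alpha> by (auto intro!: mult_mono)
    finally show ?thesis .
  next
    case False
    have "exp_quotient r * exp (\<alpha> * r) \<le> exp (- r) * exp (\<alpha> * r)"
      using exp_quotient_bounds(3)[of r] False by (intro mult_right_mono) auto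
    also have "\<dots> = exp ((1 - \<alpha>) * - r)" by (simp add: exp_add[symmetric] algebra_simps)
    also have "\<dots> \<le> exp ((1 - \<delta>) * N)"
      unfolding exp_le_cancel_iff using False that \<delta> \<alpha> by (intro mult_mono) auto
    finally show ?thesis .
  qed

  \<comment> \<open>The boundary values give \<open>r *\<^sub>R R 0\<close> up to an error of order
    \<open>exp (- N) * \<bar>r\<bar>\<close>. The weight grows at most like
    \<open>exp ((1 - \<delta>) * N)\<close>, which leaves the decay
    \<open>exp (- \<delta> * N)\<close>.\<close>
  have X_Frullani: "norm (X N - \<kappa> N *\<^sub>R R 0) \<le> (M + M * M) * exp (- N) * exp ((1 - \<delta>) * N) * (2 * N)"
    if N: "N \<ge> 0" for N
  proof -
    have H_shift: "(exp r - 1) *\<^sub>R H a r = exp (\<alpha> * r) *\<^sub>R (Z a - Z (a + r))" for a r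
    proof -
      have "Z a - Z (a + r) = (exp a * (exp r - 1)) *\<^sub>R (Z a o\<^sub>L Z (a + r))"
        unfolding Z_def using R_identity[of "exp a" "exp (a + r)"] by (simp add: exp_add algebra_simps)
      moreover have "H a r = (exp (\<alpha> * r) * exp a) *\<^sub>R (Z a o\<^sub>L Z (a + r))"
        unfolding H_def log_kernel_def Z_def
        by (simp add: \<beta>_def exp_add[symmetric] algebra_simps
            bounded_bilinear.scaleR_left[OF bounded_bilinear_blinfun_compose]
            bounded_bilinear.scaleR_right[OF bounded_bilinear_blinfun_compose])
      ultimately show ?thesis by (simp add: ac_simps)
    qed
    have Zsum: "((\<lambda>a. Z a - Z (a + r)) has_integral (W (2*N) - W (-2*N)) - (W (2*N + r) - W (-2*N + r))) {-2*N..2*N}" for r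
    proof (intro has_integral_diff fundamental_theorem_of_calculus)
      fix a
      show "(W has_vector_derivative Z a) (at a within {-2*N..2*N})"
        by (rule has_vector_derivative_at_within[OF W])
      have "((\<lambda>a. a + r) has_vector_derivative 1) (at a)"
        by (auto intro!: derivative_eq_intros)
      from vector_diff_chain_at[OF this W]
      show "((\<lambda>a. W (a + r)) has_vector_derivative Z (a + r)) (at a within {-2*N..2*N})"
        by (simp add: o_def has_vector_derivative_at_within)
    qed (use N in auto)
    define E where "E r = (W (2*N) - W (-2*N)) - (W (2*N + r) - W (-2*N + r)) - r *\<^sub>R R 0" for r
    have E: "norm (E r) \<le> (M + M * M) * exp (- N) * \<bar>r\<bar>" if r: "\<bar>r\<bar> \<le> N" for r
    proof -
      have e1: "norm (W (2*N + r) - W (2*N)) \<le> M * exp (- N) * \<bar>2*N + r - 2*N\<bar>"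
      proof (rule vector_derivative_norm_le[OF W])
        fix y assume "y \<in> closed_segment (2*N) (2*N + r)"
        then have y: "y \<ge> N" using r N by (auto simp: closed_segment_eq_real_ivl split: if_splits)
        have "norm (Z y) \<le> M / (1 + exp y)" unfolding Z_def by (rule R_bound) simp
        also have "\<dots> \<le> M / exp N"
          using y M by (intro divide_left_mono) (auto simp: add_pos_pos intro: add_increasing)
        finally show "norm (Z y) \<le> M * exp (- N)" by (simp add: exp_minus divide_inverse)
      qed
      have e2: "norm ((W (-2*N + r) - (-2*N + r) *\<^sub>R R 0) - (W (-2*N) - (-2*N) *\<^sub>R R 0)) \<le> M * M * exp (- N) * \<bar>-2*N + r - -2*N\<bar>"
      proof (rule vector_derivative_norm_le[where f = "\<lambda>y. W y - y *\<^sub>R R 0" and f' = "\<lambda>y. Z y - R 0"])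
        show "((\<lambda>y. W y - y *\<^sub>R R 0) has_vector_derivative Z y - R 0) (at y)" for y
          using has_vector_derivative_diff[OF W[of y] has_vector_derivative_scaleR[OF DERIV_ident has_vector_derivative_const[of "R 0"]]] by simp
        fix y assume "y \<in> closed_segment (-2*N) (-2*N + r)"
        then have y: "y \<le> - N" using r N by (auto simp: closed_segment_eq_real_ivl split: if_splits)
        have "norm (Z y - R 0) \<le> exp y * (M * M)" using R_lipschitz[of "exp y" 0] by (simp add: Z_def)
        also have "\<dots> \<le> exp (- N) * (M * M)" using y by (intro mult_right_mono) auto
        finally show "norm (Z y - R 0) \<le> M * M * exp (- N)" by (simp add: ac_simps)
      qed
      have eq: "E r = ((W (-2*N + r) - (-2*N + r) *\<^sub>R R 0) - (W (-2*N) - (-2*N) *\<^sub>R R 0)) - (W (2*N + r) - W (2*N))"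
        by (simp add: E_def algebra_simps)
      have "norm (E r) \<le> M * M * exp (- N) * \<bar>-2*N + r - -2*N\<bar> + M * exp (- N) * \<bar>2*N + r - 2*N\<bar>"
        unfolding eq by (intro order_trans[OF norm_triangle_ineq4] add_mono e1 e2)
      then show ?thesis by (simp add: algebra_simps)
    qed
    have Y_near: "norm (Y N r - (exp_quotient r * exp (\<alpha> * r)) *\<^sub>R R 0) \<le> (M + M * M) * exp (- N) * exp ((1 - \<delta>) * N)"
      if r: "\<bar>r\<bar> \<le> N" "r \<noteq> 0" for r
    proof -
      define u where "u = exp (\<alpha> * r) / (exp r - 1)"
      have nz: "exp r - 1 \<noteq> 0" using r(2) by simp
      have hr: "H a r = u *\<^sub>R (Z a - Z (a + r))" for a
      proof -
        have "H a r = (1 / (exp r - 1)) *\<^sub>R ((exp r - 1) *\<^sub>R H a r)" using nz by simp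
        then show ?thesis unfolding H_shift by (simp add: u_def)
      qed
      have "Y N r = u *\<^sub>R ((W (2*N) - W (-2*N)) - (W (2*N + r) - W (-2*N + r)))"
        unfolding Y_def hr using has_integral_cmul[OF Zsum, of u] by (rule integral_unique)
      also have "\<dots> = u *\<^sub>R (E r + r *\<^sub>R R 0)" by (simp add: E_def)
      finally have "Y N r - (exp_quotient r * exp (\<alpha> * r)) *\<^sub>R R 0 = u *\<^sub>R E r"
        using r(2) by (simp add: u_def exp_quotient_def scaleR_add_right ac_simps)
      then have "norm (Y N r - (exp_quotient r * exp (\<alpha> * r)) *\<^sub>R R 0) \<le> \<bar>u\<bar> * ((M + M * M) * exp (- N) * \<bar>r\<bar>)"
        using E[OF r(1)] by (simp add: mult_left_mono)
      also have "\<bar>u\<bar> * \<bar>r\<bar> = exp_quotient r * exp (\<alpha> * r)"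
      proof -
        have "\<bar>u\<bar> * \<bar>r\<bar> = \<bar>exp_quotient r * exp (\<alpha> * r)\<bar>"
          using r(2) by (simp add: u_def exp_quotient_def abs_mult)
        then show ?thesis by (simp add: exp_quotient_nonneg)
      qed
      then have "\<bar>u\<bar> * ((M + M * M) * exp (- N) * \<bar>r\<bar>) = (M + M * M) * exp (- N) * (exp_quotient r * exp (\<alpha> * r))"
        by (simp add: ac_simps)
      also have "\<dots> \<le> (M + M * M) * exp (- N) * exp ((1 - \<delta>) * N)"
        using M by (intro mult_left_mono \<phi>_le r(1)) auto
      finally show ?thesis .
    qed
    have Yc: "continuous_on {-N..N} (Y N)"
      unfolding Y_def cbox_interval[symmetric]
      by (rule integral_continuous_on_param) (auto simp: split_beta intro!: Hc continuous_intros)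
    let ?D = "\<lambda>r. Y N r - (exp_quotient r * exp (\<alpha> * r)) *\<^sub>R R 0"
    \<comment> \<open>The estimate divides by \<open>exp r - 1\<close>, hence omits r = 0; one point
      does not change the integral.\<close>
    let ?D' = "\<lambda>r. if r = 0 then 0 else ?D r"
    have kint: "((\<lambda>r. (exp_quotient r * exp (\<alpha> * r)) *\<^sub>R R 0) has_integral \<kappa> N *\<^sub>R R 0) {-N..N}"
      unfolding \<kappa>_def by (intro has_integral_scaleR_left integrable_integral integrable_continuous_real \<phi>c)
    have Dint: "(?D has_integral X N - \<kappa> N *\<^sub>R R 0) {-N..N}"
      unfolding X_def by (intro has_integral_diff kint integrable_integral integrable_continuous_real Yc)
    have D'int: "(?D' has_integral X N - \<kappa> N *\<^sub>R R 0) {-N..N}"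
      by (rule has_integral_spike[OF _ _ Dint, of "{0}"]) auto
    define c where "c = (M + M * M) * exp (- N) * exp ((1 - \<delta>) * N)"
    have c0: "c \<ge> 0" using M by (simp add: c_def)
    have "norm (integral {-N..N} ?D') \<le> integral {-N..N} (\<lambda>r. c)"
    proof (rule Henstock_Kurzweil_Integration.integral_norm_bound_integral)
      show "?D' integrable_on {-N..N}" using D'int by blast
      show "norm (?D' r) \<le> c" if "r \<in> {-N..N}" for r
        using Y_near[of r] c0 that unfolding c_def by auto
    qed auto
    moreover have "integral {-N..N} (\<lambda>r. c) = c * (2 * N)" using N by simp
    ultimately have "norm (X N - \<kappa> N *\<^sub>R R 0) \<le> c * (2 * N)"
      unfolding integral_unique[OF D'int] by linarith
    then show ?thesis unfolding c_def .
  qed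

  define x where "x n = 1 + real n" for n
  have xlim: "filterlim x at_top sequentially"
    unfolding x_def by (rule filterlim_tendsto_add_at_top[OF tendsto_const filterlim_real_sequentially])
  have x: "x n \<ge> 1" "x n \<ge> 0" for n by (auto simp: x_def)
  have decay: "(\<lambda>n. exp (- k * x n) * x n) \<longlonglongrightarrow> 0" if k: "k > 0" for k :: real
  proof -
    have "filterlim (\<lambda>n. k * x n) at_top sequentially"
      by (rule filterlim_tendsto_pos_mult_at_top[OF tendsto_const k xlim])
    then have "(\<lambda>n. 1 / k * ((k * x n) ^ 1 / exp (k * x n))) \<longlonglongrightarrow> 1 / k * 0"
      by (intro tendsto_mult tendsto_const filterlim_compose[OF tendsto_power_div_exp_0])
    then show ?thesis using k by (simp add: exp_minus field_simps)
  qed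
  have decay': "(\<lambda>n. exp (- k * x n)) \<longlonglongrightarrow> 0" if k: "k > 0" for k :: real
    using filterlim_compose[OF exp_tendsto_0[OF k, of 1] xlim] by simp
  have 1: "(\<lambda>n. (P o\<^sub>L Q) - X (x n)) \<longlonglongrightarrow> 0"
  proof (rule Lim_null_comparison)
    show "\<forall>\<^sub>F n in sequentially. norm ((P o\<^sub>L Q) - X (x n))
        \<le> M / \<delta> * 2 * norm Q * exp (- (2 * \<delta>) * x n) + M * (2 * M / \<delta>) * 4 * (exp (- \<delta> * x n) * x n)"
      using X_near[OF x(2)] by (intro always_eventually allI) (simp add: ac_simps)
    have "(\<lambda>n. M / \<delta> * 2 * norm Q * exp (- (2 * \<delta>) * x n) + M * (2 * M / \<delta>) * 4 * (exp (- \<delta> * x n) * x n))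
        \<longlonglongrightarrow> M / \<delta> * 2 * norm Q * 0 + M * (2 * M / \<delta>) * 4 * 0"
      using \<delta> by (intro tendsto_intros decay decay') auto
    then show "(\<lambda>n. M / \<delta> * 2 * norm Q * exp (- (2 * \<delta>) * x n) + M * (2 * M / \<delta>) * 4 * (exp (- \<delta> * x n) * x n)) \<longlonglongrightarrow> 0"
      by simp
  qed
  have 2: "(\<lambda>n. X (x n) - \<kappa> (x n) *\<^sub>R R 0) \<longlonglongrightarrow> 0"
  proof (rule Lim_null_comparison)
    show "\<forall>\<^sub>F n in sequentially. norm (X (x n) - \<kappa> (x n) *\<^sub>R R 0) \<le> (M + M * M) * 2 * (exp (- \<delta> * x n) * x n)"
    proof (intro always_eventually allI)
      fix n
      have "exp (- x n) * exp ((1 - \<delta>) * x n) = exp (- \<delta> * x n)"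
        by (simp add: exp_add[symmetric] algebra_simps)
      then show "norm (X (x n) - \<kappa> (x n) *\<^sub>R R 0) \<le> (M + M * M) * 2 * (exp (- \<delta> * x n) * x n)"
        using X_Frullani[OF x(2), of n] by (simp add: mult.assoc) (simp add: algebra_simps)
    qed
    have "(\<lambda>n. (M + M * M) * 2 * (exp (- \<delta> * x n) * x n)) \<longlonglongrightarrow> (M + M * M) * 2 * 0"
      using \<delta> by (intro tendsto_intros decay) auto
    then show "(\<lambda>n. (M + M * M) * 2 * (exp (- \<delta> * x n) * x n)) \<longlonglongrightarrow> 0" by simp
  qed
  have "(\<lambda>n. (P o\<^sub>L Q) - ((P o\<^sub>L Q) - X (x n)) - (X (x n) - \<kappa> (x n) *\<^sub>R R 0)) \<longlonglongrightarrow> (P o\<^sub>L Q) - 0 - 0"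
    by (intro tendsto_diff tendsto_const 1 2)
  then have lim: "(\<lambda>n. \<kappa> (x n) *\<^sub>R R 0) \<longlonglongrightarrow> (P o\<^sub>L Q)" by simp
  \<comment> \<open>Instead of evaluating the limit of \<kappa>, the proof uses that its reciprocals
    decrease and stay positive: their limit is the \<mu> sought.\<close>
  have \<kappa>_mono: "\<kappa> u \<le> \<kappa> v" if "0 \<le> u" "u \<le> v" for u v
    unfolding \<kappa>_def using that
    by (intro integral_subset_le integrable_continuous_real \<phi>c) (auto simp: exp_quotient_nonneg)
  have "2 * (exp (- 1) * exp (- 1)) \<le> \<kappa> 1"
  proof -
    have "integral {-1..1} (\<lambda>r::real. exp (- 1) * exp (- 1)) \<le> \<kappa> 1"
      unfolding \<kappa>_def
    proof (intro integral_le integrable_continuous_real \<phi>c continuous_intros mult_mono)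
      fix r :: real assume r: "r \<in> {-1..1}"
      show "exp (- 1) \<le> exp_quotient r"
        using r by (intro order_trans[OF _ exp_quotient_bounds(1)]) auto
      have "\<bar>\<alpha> * r\<bar> \<le> 1 * 1" unfolding abs_mult using r \<alpha> by (intro mult_mono) auto
      then show "exp (- 1) \<le> exp (\<alpha> * r)" by simp
    qed (auto simp: exp_quotient_nonneg)
    then show ?thesis by simp
  qed
  then have \<kappa>1: "\<kappa> 1 > 0" by (rule less_le_trans[rotated]) simp
  have \<kappa>pos: "\<kappa> (x n) > 0" for n
    using \<kappa>_mono[OF _ x(1)[of n]] \<kappa>1 by simp
  have "decseq (\<lambda>n. inverse (\<kappa> (x n)))"
    unfolding decseq_def using \<kappa>pos by (auto intro!: le_imp_inverse_le \<kappa>_mono x simp: x_def)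
  then obtain \<mu> where \<mu>: "(\<lambda>n. inverse (\<kappa> (x n))) \<longlonglongrightarrow> \<mu>"
    using decseq_convergent[of _ 0] \<kappa>pos by (metis less_imp_le positive_imp_inverse_positive)
  have "(\<lambda>n. inverse (\<kappa> (x n)) *\<^sub>R (\<kappa> (x n) *\<^sub>R R 0)) \<longlonglongrightarrow> \<mu> *\<^sub>R (P o\<^sub>L Q)"
    by (intro tendsto_scaleR \<mu> lim)
  moreover have "inverse (\<kappa> (x n)) *\<^sub>R (\<kappa> (x n) *\<^sub>R R 0) = R 0" for n
    using \<kappa>pos[of n] by simp
  ultimately have "R 0 = \<mu> *\<^sub>R (P o\<^sub>L Q)"
    by (simp add: LIMSEQ_const_iff)
  then show ?thesis unfolding P_def Q_def \<beta>_def by blast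
qed

end

section \<open>Semigroups and the Cauchy estimate\<close>

text \<open>Otherwise points tending to \<open>p0\<close> would carry operators of unbounded norm,
  while strong convergence along them makes these pointwise bounded.\<close>

lemma pointwise_limit_eventually_bounded:
  fixes B :: "'p::metric_space \<Rightarrow> 'a::banach \<Rightarrow>\<^sub>L 'b::real_normed_vector"
  assumes lim: "\<And>x. ((\<lambda>p. B p x) \<longlongrightarrow> L x) (at p0 within S)"
  shows "\<exists>M. \<exists>d>0. \<forall>p\<in>S. p \<noteq> p0 \<longrightarrow> dist p p0 < d \<longrightarrow> norm (B p) \<le> M"
proof -
  have "\<exists>n. \<forall>p\<in>S. p \<noteq> p0 \<longrightarrow> dist p p0 < inverse (real (Suc n)) \<longrightarrow> norm (B p) \<le> real n"
  proof (rule ccontr)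
    assume "\<not> ?thesis"
    then have "\<forall>n. \<exists>p. p \<in> S \<and> p \<noteq> p0 \<and> dist p p0 < inverse (real (Suc n)) \<and> \<not> norm (B p) \<le> real n"
      by blast
    then have "\<exists>p. \<forall>n. p n \<in> S \<and> p n \<noteq> p0 \<and> dist (p n) p0 < inverse (real (Suc n)) \<and> \<not> norm (B (p n)) \<le> real n"
      by (rule choice)
    then obtain p where "\<forall>n. p n \<in> S \<and> p n \<noteq> p0 \<and> dist (p n) p0 < inverse (real (Suc n)) \<and> \<not> norm (B (p n)) \<le> real n" ..
    then have p: "p n \<in> S" "p n \<noteq> p0" "dist (p n) p0 < inverse (real (Suc n))" "\<not> norm (B (p n)) \<le> real n" for n
      by simp_all
    have "(\<lambda>n. dist (p n) p0) \<longlonglongrightarrow> 0"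
      by (rule Lim_null_comparison[OF _ LIMSEQ_inverse_real_of_nat])
        (use p(3) in \<open>auto intro!: always_eventually less_imp_le\<close>)
    then have "p \<longlonglongrightarrow> p0" by (subst tendsto_dist_iff)
    then have "filterlim p (at p0 within S) sequentially"
      using p(1,2) by (auto simp: filterlim_at)
    then have "convergent (\<lambda>n. B (p n) x)" for x
      using filterlim_compose[OF lim] convergentI by blast
    then have "bounded (range (\<lambda>n. B (p n) x))" for x
      using convergent_imp_bounded convergent_def by metis
    then obtain M where M: "\<And>n. norm (B (p n)) \<le> M"
      by (rule uniform_boundedness) blast
    obtain n where "M \<le> real n" using real_arch_simple by blast
    then show False using M[of n] p(4)[of n] by simp
  qed
  then obtain n where "\<forall>p\<in>S. p \<noteq> p0 \<longrightarrow> dist p p0 < inverse (real (Suc n)) \<longrightarrow> norm (B p) \<le> real n" ..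
  then show ?thesis
    by (intro exI[of _ "real n"] exI[of _ "inverse (real (Suc n))"] conjI) auto
qed

text \<open>Strong convergence at 0 gives a bound on a short interval, and the semigroup law
  propagates it as a power whose exponent counts the short steps needed to reach T.\<close>

lemma C0_semigroup_bounded:
  assumes U: "C0_semigroup U"
  obtains C where "C \<ge> 1" "\<And>t. t \<in> {0..T} \<Longrightarrow> norm (U t) \<le> C"
proof -
  have lim: "((\<lambda>t. U t x) \<longlongrightarrow> id_blinfun x) (at 0 within {0<..})" for x
    using U by (simp add: C0_semigroup_def)
  obtain M d where M: "d > 0" "\<And>t. t \<in> {0<..} \<Longrightarrow> t \<noteq> 0 \<Longrightarrow> dist t 0 < d \<Longrightarrow> norm (U t) \<le> M"
    using pointwise_limit_eventually_bounded[OF lim] by metis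
  define N where "N = max 1 M"
  have N: "norm (U t) \<le> N" if "0 \<le> t" "t \<le> d / 2" for t
  proof (cases "t = 0")
    case True
    then have "U t = id_blinfun" using U by (simp add: C0_semigroup_def)
    then show "norm (U t) \<le> N"
      using norm_blinfun_id_le[where 'a='a] by (simp add: N_def le_max_iff_disj)
  next
    case False
    then show "norm (U t) \<le> N" using M(2)[of t] that M(1) by (simp add: N_def le_max_iff_disj)
  qed
  have N1: "N \<ge> 1" by (simp add: N_def)
  have pow: "norm (U t) \<le> N ^ n" if "0 \<le> t" "t \<le> real n * (d / 2)" for n t
    using that
  proof (induction n arbitrary: t)
    case 0
    then have "U t = id_blinfun" using U by (simp add: C0_semigroup_def)
    then show ?case using norm_blinfun_id_le[where 'a='a] by simp
  next
    case (Suc n)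
    define s where "s = min t (d / 2)"
    have s: "0 \<le> s" "s \<le> d / 2" "0 \<le> t - s" "t - s \<le> real n * (d / 2)"
      using Suc.prems M(1) by (auto simp: s_def min_def algebra_simps)
    have "U t = U s o\<^sub>L U (t - s)"
      using U s unfolding C0_semigroup_def by (metis add.commute diff_add_cancel)
    then have "norm (U t) \<le> norm (U s) * norm (U (t - s))"
      by (simp add: norm_blinfun_compose)
    also have "\<dots> \<le> N * N ^ n"
      using N[OF s(1,2)] Suc.IH[OF s(3,4)] N1 by (intro mult_mono) auto
    finally show ?case by simp
  qed
  obtain n where n: "T / (d / 2) \<le> real n" using real_arch_simple by blast
  show thesis
  proof (rule that)
    show "N ^ n \<ge> 1" using N1 by (rule one_le_power)
    fix t assume "t \<in> {0..T}"
    moreover have "T \<le> real n * (d / 2)" using n M(1) by (simp add: divide_le_eq)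
    ultimately show "norm (U t) \<le> N ^ n" by (intro pow) auto
  qed
qed

text \<open>Continuity is given only from the right at 0. Factoring the operator at the earlier time
  out of the difference reduces both one-sided limits to it, thanks to the uniform bound.\<close>

lemma C0_semigroup_strongly_continuous:
  assumes U: "C0_semigroup U"
  shows "continuous_on {0..T} (\<lambda>t. U t x)"
proof -
  obtain C where C: "C \<ge> 1" "\<And>t. t \<in> {0..T} \<Longrightarrow> norm (U t) \<le> C"
    using C0_semigroup_bounded[OF U] by metis
  have diff: "norm (U t x - U s x) \<le> C * norm (U (t - s) x - x)" if "0 \<le> s" "s \<le> t" "t \<le> T" for s t
  proof -
    have "U t = U s o\<^sub>L U (t - s)"
      using U that unfolding C0_semigroup_def by (metis add.commute diff_add_cancel diff_ge_0_iff_ge)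
    then have "U t x - U s x = U s (U (t - s) x - x)"
      by (simp add: blinfun.diff_right)
    also have "norm \<dots> \<le> C * norm (U (t - s) x - x)"
      using that by (intro order_trans[OF norm_blinfun] mult_right_mono C(2)) auto
    finally show ?thesis .
  qed
  show ?thesis
    unfolding continuous_on_iff
  proof (intro ballI allI impI)
    fix t e :: real assume t: "t \<in> {0..T}" and e: "e > 0"
    have "((\<lambda>h. U h x) \<longlongrightarrow> x) (at_right 0)" using U by (simp add: C0_semigroup_def)
    then have "\<forall>\<^sub>F h in at_right 0. dist (U h x) x < e / C"
      using e C(1) by (intro tendstoD) auto
    then obtain d where d: "d > 0" "\<And>h. h > 0 \<Longrightarrow> h < d \<Longrightarrow> dist (U h x) x < e / C"
      by (auto simp: eventually_at_right[OF zero_less_one])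
    have step: "dist (U v x) (U u x) < e" if "0 \<le> u" "u \<le> v" "v \<le> T" "v - u < d" for u v
    proof (cases "u = v")
      case False
      then have "norm (U (v - u) x - x) < e / C"
        using d(2)[of "v - u"] that by (simp add: dist_norm)
      then have "C * norm (U (v - u) x - x) < e" using C(1) by (simp add: less_divide_eq ac_simps)
      then show ?thesis using diff[OF that(1-3)] by (simp add: dist_norm)
    qed (use e in auto)
    show "\<exists>d>0. \<forall>t'\<in>{0..T}. dist t' t < d \<longrightarrow> dist (U t' x) (U t x) < e"
    proof (intro exI[of _ d] conjI ballI impI d(1))
      fix t' assume "t' \<in> {0..T}" "dist t' t < d"
      then show "dist (U t' x) (U t x) < e"
        using step[of t t'] step[of t' t] t
        by (cases "t \<le> t'") (auto simp: dist_real_def dist_commute)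
    qed
  qed
qed

text \<open>Let \<open>b l\<close> be the integral of \<open>exp (- \<theta> j) F (z0 + l exp (\<i> \<theta>))\<close> over a period. Then
  \<open>b' l\<close> is the integral of \<open>F'\<close> over the circle, and integration by parts in \<open>\<theta>\<close> gives
  \<open>l * b' l = b l\<close>; so \<open>b\<close> is linear with slope \<open>2 \<pi> F' z0\<close>.\<close>

theorem Cauchy_derivative_estimate:
  fixes F F' :: "complex \<Rightarrow> 'b::banach" and j :: "'b \<Rightarrow>\<^sub>L 'b"
  assumes j: "\<And>x. j (j x) = - x" and \<rho>: "0 < \<rho>" "\<rho> < r"
    and F: "\<And>z. z \<in> ball z0 r \<Longrightarrow> (F has_derivative (\<lambda>w. Re w *\<^sub>R F' z + Im w *\<^sub>R j (F' z))) (at z)"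
    and F': "continuous_on (ball z0 r) F'"
    and M: "\<And>z. z \<in> ball z0 r \<Longrightarrow> norm (F z) \<le> M"
  shows "norm (F' z0) \<le> (1 + norm j) * M / \<rho>"
proof -
  define c where "c \<theta> l = z0 + of_real l * cis \<theta>" for \<theta> l :: real
  have c: "c \<theta> l \<in> ball z0 r" if "l \<in> {0..\<rho>}" for \<theta> l
    using that \<rho> by (auto simp: c_def dist_norm norm_mult)
  \<comment> \<open>With j as the imaginary unit this is multiplication by
    \<open>exp (- \<i> * \<theta>)\<close>.\<close>
  define rot where "rot \<theta> x = cos \<theta> *\<^sub>R x - sin \<theta> *\<^sub>R j x" for \<theta> :: real and x
  have M0: "M \<ge> 0" using M[of z0] order_trans[OF norm_ge_zero] \<rho> by fastforce
  have Fc: "continuous_on (ball z0 r) F"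
    using F has_derivative_continuous continuous_at_imp_continuous_on by blast
  have cc: "continuous_on S (\<lambda>p. c (f p) (g p))" if "continuous_on S f" "continuous_on S g"
    for S and f g :: "'z::t2_space \<Rightarrow> real"
    unfolding c_def cis_conv_exp using that by (intro continuous_intros)
  define b where "b l = integral {0..2*pi} (\<lambda>\<theta>. rot \<theta> (F (c \<theta> l)))" for l
  define b' where "b' l = integral {0..2*pi} (\<lambda>\<theta>. F' (c \<theta> l))" for l
  have Fcc: "continuous_on S (\<lambda>p. F (c (f p) (g p)))" "continuous_on S (\<lambda>p. F' (c (f p) (g p)))"
    if "continuous_on S f" "continuous_on S g" "g ` S \<subseteq> {0..\<rho>}"
    for S and f g :: "'z::t2_space \<Rightarrow> real"
    by (rule continuous_on_compose2[OF Fc cc[OF that(1,2)]], use c that(3) in blast)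
      (rule continuous_on_compose2[OF F' cc[OF that(1,2)]], use c that(3) in blast)
  have rotc: "continuous_on S (\<lambda>p. rot (f p) (h p))" if "continuous_on S f" "continuous_on S h"
    for S and f :: "'z::t2_space \<Rightarrow> real" and h
    unfolding rot_def by (intro continuous_intros that continuous_on_cos continuous_on_sin)
  have radial: "((\<lambda>l. rot \<theta> (F (c \<theta> l))) has_vector_derivative F' (c \<theta> l)) (at l within {0..\<rho>})"
    if l: "l \<in> {0..\<rho>}" for \<theta> l
  proof -
    have "((\<lambda>l. c \<theta> l) has_derivative (\<lambda>h. of_real h * cis \<theta>)) (at l)"
      unfolding c_def by (auto intro!: derivative_eq_intros)
    from has_derivative_compose[OF this F[OF c[OF l]]]
    have "((\<lambda>l. F (c \<theta> l)) has_derivative (\<lambda>h. h *\<^sub>R (cos \<theta> *\<^sub>R F' (c \<theta> l) + sin \<theta> *\<^sub>R j (F' (c \<theta> l))))) (at l)"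
      by (simp add: scaleR_add_right)
    then have "((\<lambda>l. rot \<theta> (F (c \<theta> l))) has_derivative (\<lambda>h. rot \<theta> (h *\<^sub>R (cos \<theta> *\<^sub>R F' (c \<theta> l) + sin \<theta> *\<^sub>R j (F' (c \<theta> l)))))) (at l)"
      unfolding rot_def by (intro derivative_intros bounded_linear.has_derivative[OF blinfun.bounded_linear_right])
    moreover have "rot \<theta> (h *\<^sub>R (cos \<theta> *\<^sub>R y + sin \<theta> *\<^sub>R j y)) = h *\<^sub>R y" for h y
    proof -
      have "rot \<theta> (h *\<^sub>R (cos \<theta> *\<^sub>R y + sin \<theta> *\<^sub>R j y)) = h *\<^sub>R (((cos \<theta>)\<^sup>2 + (sin \<theta>)\<^sup>2) *\<^sub>R y)"
        by (simp add: rot_def blinfun.add_right blinfun.scaleR_right j algebra_simps power2_eq_square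
            del: sin_cos_squared_add sin_cos_squared_add2 sin_cos_squared_add3)
      then show ?thesis by simp
    qed
    ultimately show ?thesis
      by (simp add: has_vector_derivative_def has_derivative_at_withinI)
  qed
  have b': "(b has_vector_derivative b' l) (at l within {0..\<rho>})" if l: "l \<in> {0..\<rho>}" for l
    unfolding b_def b'_def cbox_interval[symmetric]
  proof (rule leibniz_rule_vector_derivative)
    show "((\<lambda>l. rot \<theta> (F (c \<theta> l))) has_vector_derivative F' (c \<theta> l)) (at l within cbox 0 \<rho>)"
      if "l \<in> cbox 0 \<rho>" for l \<theta>
      using radial[of l \<theta>] that by (simp add: cbox_interval)
    show "(\<lambda>\<theta>. rot \<theta> (F (c \<theta> l))) integrable_on cbox 0 (2*pi)" if "l \<in> cbox 0 \<rho>" for l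
      by (intro integrable_continuous rotc Fcc continuous_intros) (use that in auto)
    show "continuous_on (cbox 0 \<rho> \<times> cbox 0 (2*pi)) (\<lambda>(l, \<theta>). F' (c \<theta> l))"
      unfolding split_beta by (intro Fcc continuous_intros) auto
  qed (use l in auto)
  have angular: "((\<lambda>\<theta>. rot \<theta> (F (c \<theta> l))) has_vector_derivative j (l *\<^sub>R F' (c \<theta> l) - rot \<theta> (F (c \<theta> l)))) (at \<theta>)"
    if l: "l \<in> {0..\<rho>}" for \<theta> l
  proof -
    have "((\<lambda>\<theta>. \<i> * of_real \<theta>) has_derivative (\<lambda>h. \<i> * of_real h)) (at \<theta>)"
      by (auto intro!: derivative_eq_intros)
    from has_derivative_compose[OF this DERIV_exp[unfolded has_field_derivative_def]]
    have "((\<lambda>\<theta>. cis \<theta>) has_derivative (\<lambda>h. cis \<theta> * (\<i> * of_real h))) (at \<theta>)"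
      by (simp add: cis_conv_exp)
    then have "((\<lambda>\<theta>. c \<theta> l) has_derivative (\<lambda>h. 0 + of_real l * (cis \<theta> * (\<i> * of_real h)))) (at \<theta>)"
      unfolding c_def by (intro has_derivative_add has_derivative_const has_derivative_mult_right)
    then have "((\<lambda>\<theta>. c \<theta> l) has_derivative (\<lambda>h. of_real l * (of_real h * (\<i> * cis \<theta>)))) (at \<theta>)"
      by (simp add: ac_simps)
    from has_derivative_compose[OF this F[OF c[OF l]]]
    have "((\<lambda>\<theta>. F (c \<theta> l)) has_derivative
        (\<lambda>h. h *\<^sub>R (l *\<^sub>R (cos \<theta> *\<^sub>R j (F' (c \<theta> l)) - sin \<theta> *\<^sub>R F' (c \<theta> l))))) (at \<theta>)"
      by (simp add: algebra_simps)
    then have dF: "((\<lambda>\<theta>. F (c \<theta> l)) has_vector_derivative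
        l *\<^sub>R (cos \<theta> *\<^sub>R j (F' (c \<theta> l)) - sin \<theta> *\<^sub>R F' (c \<theta> l))) (at \<theta>)" (is "(_ has_vector_derivative ?d) _")
      by (simp add: has_vector_derivative_def)
    have "((\<lambda>\<theta>. rot \<theta> (F (c \<theta> l))) has_vector_derivative
        (cos \<theta> *\<^sub>R ?d + (- sin \<theta>) *\<^sub>R F (c \<theta> l)) - (sin \<theta> *\<^sub>R j ?d + cos \<theta> *\<^sub>R j (F (c \<theta> l)))) (at \<theta>)"
      unfolding rot_def
      by (intro has_vector_derivative_diff has_vector_derivative_scaleR DERIV_cos DERIV_sin dF
          bounded_linear.has_vector_derivative[OF blinfun.bounded_linear_right dF])
    moreover have "(cos \<theta> *\<^sub>R ?d + (- sin \<theta>) *\<^sub>R y) - (sin \<theta> *\<^sub>R j ?d + cos \<theta> *\<^sub>R j y) = j (l *\<^sub>R F' (c \<theta> l) - rot \<theta> y)" for y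
    proof -
      have "cos \<theta> *\<^sub>R ?d - sin \<theta> *\<^sub>R j ?d = l *\<^sub>R (((cos \<theta>)\<^sup>2 + (sin \<theta>)\<^sup>2) *\<^sub>R j (F' (c \<theta> l)))"
        by (simp add: blinfun.diff_right blinfun.scaleR_right j algebra_simps power2_eq_square
            del: sin_cos_squared_add sin_cos_squared_add2 sin_cos_squared_add3)
      moreover have "j (rot \<theta> y) = cos \<theta> *\<^sub>R j y + sin \<theta> *\<^sub>R y"
        by (simp add: rot_def blinfun.diff_right blinfun.scaleR_right j)
      ultimately show ?thesis by (simp add: blinfun.diff_right blinfun.scaleR_right algebra_simps)
    qed
    ultimately show ?thesis by simp
  qed
  \<comment> \<open>The angular derivative integrates to 0 over a period, and j is injective because
    its square is minus the identity.\<close>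
  have bb': "l *\<^sub>R b' l = b l" if l: "l \<in> {0..\<rho>}" for l
  proof -
    have i: "(\<lambda>\<theta>. rot \<theta> (F (c \<theta> l))) integrable_on {0..2*pi}" "(\<lambda>\<theta>. F' (c \<theta> l)) integrable_on {0..2*pi}"
      by (intro integrable_continuous_real rotc Fcc continuous_intros; use l in auto)+
    have i1: "((\<lambda>\<theta>. j (l *\<^sub>R F' (c \<theta> l) - rot \<theta> (F (c \<theta> l)))) has_integral rot (2*pi) (F (c (2*pi) l)) - rot 0 (F (c 0 l))) {0..2*pi}"
      by (intro fundamental_theorem_of_calculus has_vector_derivative_at_within[OF angular[OF l]]) auto
    have "((\<lambda>\<theta>. l *\<^sub>R F' (c \<theta> l) - rot \<theta> (F (c \<theta> l))) has_integral l *\<^sub>R b' l - b l) {0..2*pi}"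
      unfolding b_def b'_def by (intro has_integral_diff has_integral_cmul integrable_integral i)
    from has_integral_linear[OF this blinfun.bounded_linear_right[of j]]
    have i2: "((\<lambda>\<theta>. j (l *\<^sub>R F' (c \<theta> l) - rot \<theta> (F (c \<theta> l)))) has_integral j (l *\<^sub>R b' l - b l)) {0..2*pi}"
      by (simp add: o_def)
    have "rot (2*pi) (F (c (2*pi) l)) - rot 0 (F (c 0 l)) = 0"
      by (simp add: rot_def c_def)
    then have "j (l *\<^sub>R b' l - b l) = 0" using has_integral_unique[OF i2 i1] by simp
    then have "l *\<^sub>R b' l - b l = 0" using j[of "l *\<^sub>R b' l - b l"] by simp
    then show ?thesis by simp
  qed
  have const: "(1 / l) *\<^sub>R b l = (1 / \<rho>) *\<^sub>R b \<rho>" if l: "l \<in> {0<..\<rho>}" for l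
  proof -
    have "\<exists>k. \<forall>l\<in>{0<..\<rho>}. (1 / l) *\<^sub>R b l = k"
    proof (rule has_vector_derivative_zero_constant)
      fix l assume l: "l \<in> {0<..\<rho>}"
      have "(b has_vector_derivative b' l) (at l within {0<..\<rho>})"
        using l by (intro has_vector_derivative_within_subset[OF b']) auto
      moreover have "((\<lambda>l. 1 / l) has_real_derivative - (1 / l\<^sup>2)) (at l within {0<..\<rho>})"
        using l by (auto intro!: derivative_eq_intros simp: power2_eq_square)
      ultimately have "((\<lambda>l. (1 / l) *\<^sub>R b l) has_vector_derivative (1 / l) *\<^sub>R b' l + (- (1 / l\<^sup>2)) *\<^sub>R b l) (at l within {0<..\<rho>})"
        by (intro has_vector_derivative_scaleR)
      moreover have "(1 / l) *\<^sub>R b' l + (- (1 / l\<^sup>2)) *\<^sub>R b l = 0"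
        using bb'[of l, symmetric] l by (simp add: power2_eq_square)
      ultimately show "((\<lambda>l. (1 / l) *\<^sub>R b l) has_vector_derivative 0) (at l within {0<..\<rho>})" by simp
    qed (simp, blast)
    then show ?thesis using l \<rho> by auto
  qed
  \<comment> \<open>By \<open>const\<close>, b is linear with slope
    \<open>b \<rho> / \<rho>\<close>; its derivative at 0 is also the integral of the constant
    \<open>F' z0\<close>.\<close>
  have "(b has_vector_derivative (1 / \<rho>) *\<^sub>R b \<rho>) (at 0 within {0..\<rho>})"
  proof (rule has_vector_derivative_transform)
    show "((\<lambda>l. l *\<^sub>R (1 / \<rho>) *\<^sub>R b \<rho>) has_vector_derivative (1 / \<rho>) *\<^sub>R b \<rho>) (at 0 within {0..\<rho>})"
      using has_vector_derivative_scaleR[OF DERIV_ident has_vector_derivative_const[of "(1 / \<rho>) *\<^sub>R b \<rho>"]] by simp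
    show "b l = l *\<^sub>R (1 / \<rho>) *\<^sub>R b \<rho>" if "l \<in> {0..\<rho>}" for l
    proof (cases "l = 0")
      case True
      then show ?thesis using bb'[of 0] \<rho> by simp
    next
      case False
      then have "b l = l *\<^sub>R ((1 / l) *\<^sub>R b l)" by simp
      also have "\<dots> = l *\<^sub>R (1 / \<rho>) *\<^sub>R b \<rho>"
        by (subst const) (use that False in auto)
      finally show ?thesis .
    qed
  qed (use \<rho> in auto)
  then have "b' 0 = (1 / \<rho>) *\<^sub>R b \<rho>"
    using vector_derivative_unique_within_closed_interval[OF \<rho>(1), of 0 b] b'[of 0] \<rho> by (simp add: cbox_interval)
  moreover have "b' 0 = (2 * pi) *\<^sub>R F' z0" by (simp add: b'_def c_def)
  ultimately have eq: "(2 * pi) *\<^sub>R F' z0 = (1 / \<rho>) *\<^sub>R b \<rho>" by simp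
  have "F' z0 = (1 / (2 * pi)) *\<^sub>R ((2 * pi) *\<^sub>R F' z0)" by simp
  then have "F' z0 = (1 / (2 * pi)) *\<^sub>R (1 / \<rho>) *\<^sub>R b \<rho>" unfolding eq .
  then have nF: "norm (F' z0) = norm (b \<rho>) / (2 * pi * \<rho>)" using \<rho> by simp
  have "norm (b \<rho>) \<le> ((1 + norm j) * M) * (2 * pi - 0)"
    unfolding b_def
  proof (rule integral_bound)
    show "continuous_on {0..2 * pi} (\<lambda>\<theta>. rot \<theta> (F (c \<theta> \<rho>)))"
      by (intro rotc Fcc continuous_intros) (use \<rho> in auto)
    fix \<theta> :: real
    have Fb: "norm (F (c \<theta> \<rho>)) \<le> M" using \<rho> by (intro M c) auto
    have "norm (rot \<theta> (F (c \<theta> \<rho>))) \<le> norm (cos \<theta> *\<^sub>R F (c \<theta> \<rho>)) + norm (sin \<theta> *\<^sub>R j (F (c \<theta> \<rho>)))"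
      unfolding rot_def by (rule norm_triangle_ineq4)
    also have "\<dots> \<le> 1 * M + 1 * (norm j * M)"
      unfolding norm_scaleR
      by (intro add_mono mult_mono order_trans[OF norm_blinfun] Fb) (auto simp: M0)
    finally show "norm (rot \<theta> (F (c \<theta> \<rho>))) \<le> (1 + norm j) * M" by (simp add: algebra_simps)
  qed simp
  then have "norm (b \<rho>) / (2 * pi * \<rho>) \<le> ((1 + norm j) * M) * (2 * pi) / (2 * pi * \<rho>)"
    using \<rho> by (intro divide_right_mono) auto
  also have "\<dots> = (1 + norm j) * M / \<rho>" by simp
  finally show ?thesis by (simp only: nF)
qed

section \<open>Kernels of the two cases\<close>

text \<open>Left composition with \<open>imag_unit\<close> squares to minus the identity, so it
  plays the role of j when Cauchy's estimate is applied to an operator-valued function.\<close>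

definition imag_mult :: "(('e::banach \<times> 'e) \<Rightarrow>\<^sub>L ('e \<times> 'e)) \<Rightarrow>\<^sub>L (('e \<times> 'e) \<Rightarrow>\<^sub>L ('e \<times> 'e))" where
  "imag_mult = Blinfun (\<lambda>X. imag_unit o\<^sub>L X)"

lemma imag_mult: "imag_mult X = imag_unit o\<^sub>L X"
  unfolding imag_mult_def
  by (rule bounded_linear_Blinfun_apply[THEN fun_cong])
    (rule bounded_bilinear.bounded_linear_right[OF bounded_bilinear_blinfun_compose])

lemma imag_unit_apply: "imag_unit (x, y) = (- y, x)"
proof -
  have "bounded_linear (\<lambda>p :: 'a \<times> 'a. (- snd p, fst p))"
    by (intro bounded_linear_Pair bounded_linear_minus bounded_linear_snd bounded_linear_fst)
  then show ?thesis
    unfolding imag_unit_def case_prod_unfold by (simp add: bounded_linear_Blinfun_apply)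
qed

lemma imag_mult_imag_mult: "imag_mult (imag_mult X) = - X"
  by (rule blinfun_eqI) (auto simp: imag_mult imag_unit_apply uminus_blinfun.rep_eq split: prod.split
      intro!: prod_eqI; metis imag_unit_apply prod.collapse fst_conv snd_conv)

text \<open>The sector is a cone: a disk around 1 inside it, found by continuity of the argument,
  can be scaled by \<tau>.\<close>

lemma ball_subset_sector:
  assumes "\<delta> > 0"
  shows "\<exists>r>0. r < 1 \<and> (\<forall>\<tau>>0. ball (complex_of_real \<tau>) (r * \<tau>) \<subseteq> sector \<delta>)"
proof -
  have "isCont Arg 1" by (rule continuous_at_Arg) auto
  then obtain d where d: "d > 0" "\<And>z. dist z 1 < d \<Longrightarrow> \<bar>Arg z\<bar> < \<delta>"
    using assms unfolding continuous_at_eps_delta by (metis Arg_1 dist_real_def diff_zero)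
  \<comment> \<open>The 1 / 2 keeps the disk around 1 away from 0.\<close>
  define r where "r = min d (1 / 2)"
  show ?thesis
  proof (intro exI[of _ r] conjI allI impI)
    show "0 < r" "r < 1" using d(1) by (auto simp: r_def)
    fix \<tau> :: real assume \<tau>: "\<tau> > 0"
    show "ball (complex_of_real \<tau>) (r * \<tau>) \<subseteq> sector \<delta>"
    proof
      fix z assume z: "z \<in> ball (complex_of_real \<tau>) (r * \<tau>)"
      define u where "u = z / of_real \<tau>"
      have "dist u 1 = dist z (of_real \<tau>) / \<tau>"
        using \<tau> by (simp add: u_def dist_norm divide_simps norm_divide flip: norm_divide)
          (simp add: norm_divide field_simps)
      also have "\<dots> < r" using z \<tau> by (simp add: dist_commute field_simps)
      finally have u: "dist u 1 < r" .
      have "u \<noteq> 0" using u by (auto simp: r_def dist_norm)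
      then have "z \<noteq> 0" by (auto simp: u_def)
      moreover have "\<bar>Arg u\<bar> < \<delta>" using d(2)[of u] u by (simp add: r_def)
      then have "\<bar>Arg z\<bar> < \<delta>" using \<tau> by (simp add: u_def)
      ultimately show "z \<in> sector \<delta>" by (simp add: sector_def)
    qed
  qed
qed

lemma has_vector_derivative_right_quotient:
  assumes "(f has_vector_derivative d) (at 0 within {0<..})"
  shows "((\<lambda>t. (f t - f 0) /\<^sub>R t) \<longlongrightarrow> d) (at_right 0)"
proof -
  have "((\<lambda>t. (1 / norm (t - 0)) *\<^sub>R (f t - (f 0 + (t - 0) *\<^sub>R d))) \<longlongrightarrow> 0) (at_right 0)"
    using assms unfolding has_vector_derivative_def has_derivative_within by blast
  then have "((\<lambda>t. (f t - f 0) /\<^sub>R t - d) \<longlongrightarrow> 0) (at_right 0)"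
    by (rule Lim_transform_eventually)
      (auto simp: eventually_at_filter divide_inverse algebra_simps intro!: always_eventually)
  then show ?thesis by (rule LIM_zero_cancel)
qed

text \<open>For small \<open>\<tau>\<close> the bound is Cauchy's estimate on a disk of radius proportional to \<open>\<tau>\<close>; it
  extends to \<open>(0, T]\<close> by the semigroup property.\<close>

lemma analytic_semigroup_derivative:
  fixes U :: "real \<Rightarrow> 'e::banach \<Rightarrow>\<^sub>L 'e"
  assumes U: "analytic_semigroup U" and gen: "infinitesimal_generator A D U" and T: "T > 0"
  shows "\<exists>UD C. (\<forall>\<tau>>0. \<forall>x. U \<tau> x \<in> D \<and> A (U \<tau> x) = blinfun_apply (UD \<tau>) x) \<and>
    (\<forall>\<tau>\<in>{0<..T}. norm (UD \<tau>) \<le> C / \<tau>) \<and> (\<forall>x. continuous_on {0<..T} (\<lambda>\<tau>. UD \<tau> x))"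
proof -
  have C0: "C0_semigroup U" using U by (simp add: analytic_semigroup_def)
  have semi: "U (s + t) = U s o\<^sub>L U t" if "s \<ge> 0" "t \<ge> 0" for s t
    using C0 that by (simp add: C0_semigroup_def)
  obtain \<delta> Z where \<delta>: "0 < \<delta>"
    and ZU': "\<forall>t\<ge>0. \<forall>x y. blinfun_apply (Z (complex_of_real t)) (x, y) = (U t x, U t y)"
    and Zd: "\<forall>z\<in>sector \<delta>. \<exists>Z'. (Z has_derivative (\<lambda>w. Re w *\<^sub>R Z' + Im w *\<^sub>R (imag_unit o\<^sub>L Z'))) (at z)"
    and Zs': "\<forall>z\<in>sector \<delta>. \<forall>w\<in>sector \<delta>. Z (z + w) = Z z o\<^sub>L Z w"
    and Z0': "\<forall>u. ((\<lambda>z. blinfun_apply (Z z) u) \<longlongrightarrow> u) (at 0 within sector \<delta>)"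
    using U unfolding analytic_semigroup_def by (elim conjE exE) (rule that)
  have ZU: "blinfun_apply (Z (complex_of_real t)) (x, y) = (U t x, U t y)" if "t \<ge> 0" for t x y
    using ZU' that by simp
  have Zs: "Z (z + w) = Z z o\<^sub>L Z w" if "z \<in> sector \<delta>" "w \<in> sector \<delta>" for z w
    using Zs' that by simp
  obtain Z' where Z'': "\<forall>z\<in>sector \<delta>. (Z has_derivative (\<lambda>w. Re w *\<^sub>R Z' z + Im w *\<^sub>R (imag_unit o\<^sub>L Z' z))) (at z)"
    using bchoice[OF Zd] by (elim exE)
  have Z': "(Z has_derivative (\<lambda>w. Re w *\<^sub>R Z' z + Im w *\<^sub>R imag_mult (Z' z))) (at z)" if "z \<in> sector \<delta>" for z
    using bspec[OF Z'' that] unfolding imag_mult .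
  obtain r where r: "0 < r" "r < 1" "\<And>\<tau>. \<tau> > 0 \<Longrightarrow> ball (complex_of_real \<tau>) (r * \<tau>) \<subseteq> sector \<delta>"
    using ball_subset_sector[OF \<delta>] by auto
  have pos: "complex_of_real \<tau> \<in> sector \<delta>" if "\<tau> > 0" for \<tau>
    using r(3)[OF that] r(1) that by auto
  have "((\<lambda>z. blinfun_apply (Z z) u) \<longlongrightarrow> blinfun_apply id_blinfun u) (at 0 within sector \<delta>)" for u
    using spec[OF Z0', of u] by simp
  from pointwise_limit_eventually_bounded[OF this]
  obtain M0 h0 where h0: "h0 > 0" and "\<forall>z\<in>sector \<delta>. z \<noteq> 0 \<longrightarrow> dist z 0 < h0 \<longrightarrow> norm (Z z) \<le> M0"
    by blast
  then have M0: "norm (Z z) \<le> M0" if "z \<in> sector \<delta>" "z \<noteq> 0" "dist z 0 < h0" for z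
    using that by simp
  have real_deriv: "((\<lambda>t. Z (complex_of_real t + w)) has_vector_derivative Z' (of_real \<tau> + w)) (at \<tau>)"
    if "of_real \<tau> + w \<in> sector \<delta>" for \<tau> w
  proof -
    have "((\<lambda>t. complex_of_real t + w) has_derivative (\<lambda>h. of_real h)) (at \<tau>)"
      by (auto intro!: derivative_eq_intros)
    from has_derivative_compose[OF this Z'[OF that]] show ?thesis
      by (simp add: has_vector_derivative_def)
  qed
  \<comment> \<open>Cauchy's estimate asks for a continuous \<open>Z'\<close>, and the definition
    only says that a derivative exists at each point. The semigroup law fills the gap: near \<tau>,
    \<open>Z'\<close> is a fixed operator composed with the continuous Z.\<close>
  have Z'_shift: "Z' z = Z' (of_real (\<tau> / 2)) o\<^sub>L Z (z - of_real (\<tau> / 2))"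
    if \<tau>: "\<tau> > 0" and z: "z \<in> ball (of_real \<tau>) (r * (\<tau> / 2))" for z \<tau>
  proof -
    define w where "w = z - of_real (\<tau> / 2)"
    have w: "w \<in> sector \<delta>"
    proof -
      have "dist (complex_of_real (\<tau> / 2)) w = dist (of_real \<tau>) z"
        by (simp add: w_def dist_norm algebra_simps)
      then have "w \<in> ball (complex_of_real (\<tau> / 2)) (r * (\<tau> / 2))" using z by simp
      then show ?thesis using r(3)[of "\<tau> / 2"] \<tau> by auto
    qed
    have zs: "of_real (\<tau> / 2) + w \<in> sector \<delta>"
    proof -
      have "ball (complex_of_real \<tau>) (r * (\<tau> / 2)) \<subseteq> ball (of_real \<tau>) (r * \<tau>)"
        using r(1) \<tau> by (intro subset_ball) simp
      then show ?thesis using z r(3)[OF \<tau>] by (auto simp: w_def)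
    qed
    have "((\<lambda>t. Z (complex_of_real t + w)) has_vector_derivative Z' (of_real (\<tau> / 2) + w)) (at (\<tau> / 2))"
      by (rule real_deriv[OF zs])
    moreover have "((\<lambda>t. Z (complex_of_real t + w)) has_vector_derivative Z' (of_real (\<tau> / 2)) o\<^sub>L Z w) (at (\<tau> / 2))"
    proof (rule has_vector_derivative_transform_within_open[of "\<lambda>t. Z (complex_of_real t) o\<^sub>L Z w" _ _ "{0<..}"])
      show "((\<lambda>t. Z (complex_of_real t) o\<^sub>L Z w) has_vector_derivative Z' (of_real (\<tau> / 2)) o\<^sub>L Z w) (at (\<tau> / 2))"
        using real_deriv[of "\<tau> / 2" 0] pos[of "\<tau> / 2"] \<tau>
        by (intro bounded_linear.has_vector_derivative[OF bounded_bilinear.bounded_linear_left[OF bounded_bilinear_blinfun_compose]]) simp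
    qed (use \<tau> w pos Zs in auto)
    ultimately have "Z' (of_real (\<tau> / 2) + w) = Z' (of_real (\<tau> / 2)) o\<^sub>L Z w"
      by (rule vector_derivative_unique_at)
    then show ?thesis by (simp add: w_def)
  qed
  have Z_cont: "isCont Z z" if "z \<in> sector \<delta>" for z
    using has_derivative_continuous[OF Z'[OF that]] .
  define h1 where "h1 = h0 / 2"
  have h1: "h1 > 0" using h0 by (simp add: h1_def)
  \<comment> \<open>The shift formula holds on the disk of radius \<open>r * (\<tau> / 2)\<close>,
    and the estimate uses the strictly smaller circle of radius
    \<open>r * (\<tau> / 4)\<close>.\<close>
  define C1 where "C1 = (1 + norm (imag_mult :: (('e \<times> 'e) \<Rightarrow>\<^sub>L ('e \<times> 'e)) \<Rightarrow>\<^sub>L _)) * M0 / (r / 4)"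
  have small: "norm (Z' (of_real \<tau>)) \<le> C1 / \<tau>" if \<tau>: "\<tau> > 0" "\<tau> < h1" for \<tau>
  proof -
    have sub: "ball (complex_of_real \<tau>) (r * (\<tau> / 2)) \<subseteq> ball (of_real \<tau>) (r * \<tau>)"
      using r(1) \<tau> by (intro subset_ball) simp
    have "norm (Z' (of_real \<tau>)) \<le> (1 + norm (imag_mult :: (('e \<times> 'e) \<Rightarrow>\<^sub>L ('e \<times> 'e)) \<Rightarrow>\<^sub>L _)) * M0 / (r * (\<tau> / 4))"
    proof (rule Cauchy_derivative_estimate[where F = Z and r = "r * (\<tau> / 2)"])
      show "0 < r * (\<tau> / 4)" "r * (\<tau> / 4) < r * (\<tau> / 2)" using r(1) \<tau> by auto
      fix z assume z: "z \<in> ball (complex_of_real \<tau>) (r * (\<tau> / 2))"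
      then have zs: "z \<in> sector \<delta>" using sub r(3)[OF \<tau>(1)] by auto
      then show "(Z has_derivative (\<lambda>w. Re w *\<^sub>R Z' z + Im w *\<^sub>R imag_mult (Z' z))) (at z)" by (rule Z')
      have "norm z \<le> norm (complex_of_real \<tau>) + norm (z - of_real \<tau>)"
        using norm_triangle_sub by blast
      also have "\<dots> < \<tau> + r * (\<tau> / 2)" using z \<tau> by (simp add: dist_norm norm_minus_commute)
      also have "\<dots> \<le> \<tau> + 1 * (\<tau> / 2)" using r \<tau> by (intro add_mono mult_right_mono) auto
      also have "\<dots> < h0" using \<tau> by (simp add: h1_def)
      finally show "norm (Z z) \<le> M0" using zs by (intro M0) (auto simp: sector_def)
    next
      have Zc: "continuous_on (ball (complex_of_real \<tau>) (r * (\<tau> / 2))) (\<lambda>z. Z (z - of_real (\<tau> / 2)))"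
      proof (rule continuous_on_compose2[of "sector \<delta>" Z])
        show "continuous_on (ball (complex_of_real \<tau>) (r * (\<tau> / 2))) (\<lambda>z. z - of_real (\<tau> / 2))"
          by (intro continuous_intros)
        show "continuous_on (sector \<delta>) Z" using Z_cont by (simp add: continuous_at_imp_continuous_on)
        show "(\<lambda>z. z - of_real (\<tau> / 2)) ` ball (complex_of_real \<tau>) (r * (\<tau> / 2)) \<subseteq> sector \<delta>"
        proof clarify
          fix z assume z: "z \<in> ball (complex_of_real \<tau>) (r * (\<tau> / 2))"
          have "dist (complex_of_real (\<tau> / 2)) (z - of_real (\<tau> / 2)) = dist (of_real \<tau>) z"
            by (simp add: dist_norm algebra_simps)
          then have "z - of_real (\<tau> / 2) \<in> ball (complex_of_real (\<tau> / 2)) (r * (\<tau> / 2))" using z by simp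
          then show "z - of_real (\<tau> / 2) \<in> sector \<delta>" using r(3)[of "\<tau> / 2"] \<tau> by auto
        qed
      qed
      have "continuous_on (ball (complex_of_real \<tau>) (r * (\<tau> / 2))) (\<lambda>z. Z' (of_real (\<tau> / 2)) o\<^sub>L Z (z - of_real (\<tau> / 2)))"
        by (intro bounded_bilinear.continuous_on[OF bounded_bilinear_blinfun_compose] continuous_on_const Zc)
      then show "continuous_on (ball (complex_of_real \<tau>) (r * (\<tau> / 2))) Z'"
        by (rule continuous_on_eq) (simp add: Z'_shift[OF \<tau>(1)])
    qed (rule imag_mult_imag_mult)
    then show ?thesis by (simp add: C1_def field_simps)
  qed
  have "bounded_linear (\<lambda>x :: 'e. (x, 0 :: 'e))"
    by (intro bounded_linear_Pair bounded_linear_ident bounded_linear_zero)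
  note inl = bounded_linear_Blinfun_apply[OF this, THEN fun_cong]
  define inl :: "'e \<Rightarrow>\<^sub>L ('e \<times> 'e)" where "inl = Blinfun (\<lambda>x. (x, 0))"
  note inl = inl[folded inl_def]
  define UD where "UD \<tau> = fst_blinfun o\<^sub>L Z' (complex_of_real \<tau>) o\<^sub>L inl" for \<tau>
  have Ud: "((\<lambda>t. U t x) has_vector_derivative UD \<tau> x) (at \<tau>)" if \<tau>: "\<tau> > 0" for \<tau> x
  proof (rule has_vector_derivative_transform_within_open[of "\<lambda>t. fst (Z (complex_of_real t) (x, 0))" _ _ "{0<..}"])
    have "((\<lambda>t. Z (complex_of_real t)) has_vector_derivative Z' (of_real \<tau>)) (at \<tau>)"
      using real_deriv[of \<tau> 0] pos[OF \<tau>] by simp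
    then have "((\<lambda>t. Z (complex_of_real t) (x, 0)) has_vector_derivative Z' (of_real \<tau>) (x, 0)) (at \<tau>)"
      by (rule bounded_linear.has_vector_derivative[OF blinfun.bounded_linear_left])
    from bounded_linear.has_vector_derivative[OF bounded_linear_fst this]
    show "((\<lambda>t. fst (Z (complex_of_real t) (x, 0))) has_vector_derivative UD \<tau> x) (at \<tau>)"
      by (simp add: UD_def inl)
  qed (use \<tau> ZU in auto)
  have lim: "((\<lambda>t. (U t (U \<tau> x) - U \<tau> x) /\<^sub>R t) \<longlongrightarrow> UD \<tau> x) (at_right 0)" if \<tau>: "\<tau> > 0" for \<tau> x
  proof -
    have "((\<lambda>t. U (t + \<tau>) x) has_vector_derivative UD \<tau> x) (at 0)"
    proof -
      have "((\<lambda>t. t + \<tau>) has_vector_derivative 1) (at 0)" by (auto intro!: derivative_eq_intros)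
      from vector_diff_chain_at[OF this, of "\<lambda>t. U t x" "UD \<tau> x"] show ?thesis
        using Ud[OF \<tau>] by (simp add: o_def)
    qed
    then have "((\<lambda>t. U (t + \<tau>) x) has_vector_derivative UD \<tau> x) (at 0 within {0<..})"
      by (rule has_vector_derivative_at_within)
    then have "((\<lambda>t. (U (t + \<tau>) x - U \<tau> x) /\<^sub>R t) \<longlongrightarrow> UD \<tau> x) (at_right 0)"
      using has_vector_derivative_right_quotient by fastforce
    then show ?thesis
      by (rule Lim_transform_eventually) (use semi \<tau> in \<open>auto simp: eventually_at_filter\<close>)
  qed
  have gen': "U \<tau> x \<in> D \<and> A (U \<tau> x) = UD \<tau> x" if \<tau>: "\<tau> > 0" for \<tau> x
  proof -
    have "U \<tau> x \<in> D" using gen lim[OF \<tau>, of x] by (auto simp: infinitesimal_generator_def)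
    moreover from this have "((\<lambda>t. (U t (U \<tau> x) - U \<tau> x) /\<^sub>R t) \<longlongrightarrow> A (U \<tau> x)) (at_right 0)"
      using gen by (simp add: infinitesimal_generator_def)
    then have "A (U \<tau> x) = UD \<tau> x"
      using lim[OF \<tau>, of x] tendsto_unique[of "at_right (0::real)"] by simp
    ultimately show ?thesis ..
  qed
  have UD_shift: "UD (s + t) = UD s o\<^sub>L U t" if "s > 0" "t \<ge> 0" for s t
  proof (rule blinfun_eqI)
    fix x
    have "UD (s + t) x = A (U (s + t) x)" using gen'[of "s + t" x] that by simp
    also have "\<dots> = A (U s (U t x))" using semi[of s t] that by simp
    also have "\<dots> = UD s (U t x)" using gen'[of s "U t x"] that by simp
    finally show "UD (s + t) x = (UD s o\<^sub>L U t) x" by simp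
  qed
  obtain CU where CU: "CU \<ge> 1" "\<And>t. t \<in> {0..T} \<Longrightarrow> norm (U t) \<le> CU"
    using C0_semigroup_bounded[OF C0] by metis
  define h2 where "h2 = min T (h1 / 2)"
  have h2: "0 < h2" "h2 < h1" "h2 \<le> T" using h1 T by (auto simp: h2_def)
  define ni where "ni = norm (fst_blinfun :: ('e \<times> 'e) \<Rightarrow>\<^sub>L 'e) * norm inl"
  have UD_small: "norm (UD \<tau>) \<le> ni * (C1 / \<tau>)" if "0 < \<tau>" "\<tau> < h1" for \<tau>
  proof -
    have "norm (UD \<tau>) \<le> norm (fst_blinfun :: ('e \<times> 'e) \<Rightarrow>\<^sub>L 'e) * norm (Z' (of_real \<tau>)) * norm inl"
      unfolding UD_def by (intro order_trans[OF norm_blinfun_compose] mult_right_mono) auto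
    also have "\<dots> = ni * norm (Z' (of_real \<tau>))" by (simp add: ni_def)
    also have "\<dots> \<le> ni * (C1 / \<tau>)"
      using small[OF that] by (intro mult_left_mono) (auto simp: ni_def)
    finally show ?thesis .
  qed
  have niC1: "ni * C1 \<ge> 0"
    using UD_small[OF h2(1,2)] order_trans[OF norm_ge_zero] h2(1) by (fastforce simp: zero_le_divide_iff)
  \<comment> \<open>The factor \<open>CU * (T / h2)\<close> covers times from \<open>h1\<close> on,
    which are reached from \<open>h2\<close> by the semigroup; there 1 / T is at most 1 /
    \<tau>.\<close>
  define C where "C = ni * C1 * CU * (T / h2)"
  have one: "1 \<le> CU * (T / h2)"
    using mult_mono[of 1 CU 1 "T / h2"] CU(1) h2 by simp
  have bound: "norm (UD \<tau>) \<le> C / \<tau>" if \<tau>: "\<tau> \<in> {0<..T}" for \<tau>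
  proof (cases "\<tau> < h1")
    case True
    then have "norm (UD \<tau>) \<le> (ni * C1 * 1) / \<tau>" using UD_small[of \<tau>] \<tau> by simp
    also have "\<dots> \<le> (ni * C1 * (CU * (T / h2))) / \<tau>"
      using \<tau> by (intro divide_right_mono mult_left_mono one niC1) auto
    finally show ?thesis by (simp add: C_def mult.assoc)
  next
    case False
    then have "UD \<tau> = UD h2 o\<^sub>L U (\<tau> - h2)"
      using UD_shift[of h2 "\<tau> - h2"] h2 by simp
    then have "norm (UD \<tau>) \<le> norm (UD h2) * norm (U (\<tau> - h2))" by (simp add: norm_blinfun_compose)
    also have "\<dots> \<le> (ni * (C1 / h2)) * CU"
      using UD_small[OF h2(1,2)] CU(2)[of "\<tau> - h2"] False h2 \<tau>
      by (intro mult_mono) (auto intro: order_trans[OF norm_ge_zero])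
    also have "\<dots> = C / T" using T by (simp add: C_def)
    also have "\<dots> \<le> C / \<tau>"
    proof -
      have "C \<ge> 0" unfolding C_def using niC1 CU(1) T h2 by auto
      then show ?thesis using \<tau> T by (intro divide_left_mono) auto
    qed
    finally show ?thesis .
  qed
  have cont: "continuous_on {0<..T} (\<lambda>\<tau>. UD \<tau> x)" for x
    unfolding continuous_on_eq_continuous_within
  proof
    fix \<tau> assume \<tau>: "\<tau> \<in> {0<..T}"
    define s where "s = \<tau> / 2"
    have s: "0 < s" "s < \<tau>" using \<tau> by (auto simp: s_def)
    have "continuous_on {s..T} (\<lambda>t. UD s (U (t - s) x))"
      using s by (intro continuous_intros continuous_on_compose2[OF C0_semigroup_strongly_continuous[OF C0, of T x]]) auto
    then have "continuous_on {s..T} (\<lambda>t. UD t x)"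
    proof (rule continuous_on_eq)
      fix t assume "t \<in> {s..T}"
      then have "UD t = UD s o\<^sub>L U (t - s)" using UD_shift[of s "t - s"] s by simp
      then show "UD s (U (t - s) x) = UD t x" by simp
    qed
    then have "continuous (at \<tau> within {s..T}) (\<lambda>t. UD t x)"
      using \<tau> s by (simp add: continuous_on_eq_continuous_within)
    moreover have "at \<tau> within {s..T} = at \<tau> within {0<..T}"
      by (rule at_within_nhd[of \<tau> "{s<..}"]) (use s \<tau> in auto)
    ultimately show "continuous (at \<tau> within {0<..T}) (\<lambda>t. UD t x)" by simp
  qed
  have "\<forall>\<tau>>0. \<forall>x. U \<tau> x \<in> D \<and> A (U \<tau> x) = blinfun_apply (UD \<tau>) x"
    by (intro allI impI gen')
  moreover have "\<forall>\<tau>\<in>{0<..T}. norm (UD \<tau>) \<le> C / \<tau>" by (intro ballI bound)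
  moreover have "\<forall>x. continuous_on {0<..T} (\<lambda>\<tau>. UD \<tau> x)" by (intro allI cont)
  ultimately show ?thesis by (intro exI[of _ UD] exI[of _ C] conjI)
qed

section \<open>Resolvents and the two kernels\<close>

lemma is_resolvent_unique:
  assumes "is_resolvent A D s R" "is_resolvent A D s R'"
  shows "R = R'"
proof (rule blinfun_eqI)
  fix x
  have "R x \<in> D" "s *\<^sub>R R x - A (R x) = x" "\<And>y. y \<in> D \<Longrightarrow> R' (s *\<^sub>R y - A y) = y"
    using assms by (auto simp: is_resolvent_def)
  then show "R x = R' x" by metis
qed

lemma is_resolvent_identity:
  assumes R: "is_resolvent A D s R" and R': "is_resolvent A D t R'"
  shows "R - R' = (t - s) *\<^sub>R (R o\<^sub>L R')"
proof (rule blinfun_eqI)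
  fix x
  define y where "y = R' x"
  have y: "y \<in> D" "t *\<^sub>R y - A y = x" using R' by (auto simp: is_resolvent_def y_def)
  have "R (s *\<^sub>R y - A y) = y" using R y(1) by (simp add: is_resolvent_def)
  moreover have "s *\<^sub>R y - A y = x - (t - s) *\<^sub>R y" using y(2) by (simp add: algebra_simps)
  ultimately have "R x - (t - s) *\<^sub>R R y = y" by (simp add: blinfun.diff_right blinfun.scaleR_right)
  then show "(R - R') x = ((t - s) *\<^sub>R (R o\<^sub>L R')) x"
    by (simp add: y_def minus_blinfun.rep_eq scaleR_blinfun.rep_eq algebra_simps)
qed

lemma analytic_kernel:
  fixes U :: "real \<Rightarrow> 'e::banach \<Rightarrow>\<^sub>L 'e"
  assumes U: "analytic_semigroup U" and gen: "infinitesimal_generator A D U" and T: "T > 0"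
    and \<alpha>: "0 < \<alpha>" "\<alpha> < 1" and pw: "powers_defined A D \<alpha>"
  shows "\<exists>K C. mild_kernel U K T \<alpha> C \<and> (\<forall>\<tau>\<in>{0<..T}. \<forall>v. pos_power A D \<alpha> (U \<tau> v) = blinfun_apply (K \<tau>) v)"
proof -
  obtain M where M: "\<And>s. s \<ge> 0 \<Longrightarrow> \<exists>R. is_resolvent A D s R \<and> norm R \<le> M / (1 + s)"
    using pw by (auto simp: powers_defined_def)
  have res: "is_resolvent A D s (resolvent A D s) \<and> norm (resolvent A D s) \<le> M / (1 + s)" if s: "s \<ge> 0" for s
  proof -
    obtain R where R: "is_resolvent A D s R" "norm R \<le> M / (1 + s)" using M[OF s] by blast
    have "resolvent A D s = R"
      unfolding resolvent_def by (rule the_equality) (use R is_resolvent_unique in blast)+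
    then show ?thesis using R by simp
  qed
  interpret positive_resolvent "resolvent A D" M
    by unfold_locales (use res is_resolvent_identity in blast)+
  define c where "c = sin (pi * \<alpha>) / pi"
  have c: "c > 0" using \<alpha> by (auto simp: c_def intro!: divide_pos_pos sin_gt_zero)
  have neg: "neg_power A D \<alpha> x = c *\<^sub>R power_integral (1 - \<alpha>) x" for x
    using has_integral_power_integral[of "1 - \<alpha>" x] \<alpha>
    by (simp add: neg_power_def c_def has_integral_iff)
  obtain \<mu> where \<mu>: "resolvent A D 0 = \<mu> *\<^sub>R (power_integral (1 - \<alpha>) o\<^sub>L power_integral \<alpha>)"
    using power_integral_product[OF \<alpha>] by blast
  obtain UD C1 where UD': "\<forall>\<tau>>0. \<forall>x. U \<tau> x \<in> D \<and> A (U \<tau> x) = blinfun_apply (UD \<tau>) x"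
    and UD_bound': "\<forall>\<tau>\<in>{0<..T}. norm (UD \<tau>) \<le> C1 / \<tau>"
    and UD_cont': "\<forall>x. continuous_on {0<..T} (\<lambda>\<tau>. UD \<tau> x)"
    using analytic_semigroup_derivative[OF U gen T] by (elim exE conjE)
  have UD: "U \<tau> x \<in> D \<and> A (U \<tau> x) = blinfun_apply (UD \<tau>) x" if "\<tau> > 0" for \<tau> x
    using UD' that by simp
  note UD_bound = bspec[OF UD_bound'] and UD_cont = spec[OF UD_cont']
  have C0: "C0_semigroup U" using U by (simp add: analytic_semigroup_def)
  obtain CU where CU: "CU \<ge> 1" "\<And>t. t \<in> {0..T} \<Longrightarrow> norm (U t) \<le> CU"
    using C0_semigroup_bounded[OF C0] by metis
  have R0: "resolvent A D 0 (- UD \<tau> x) = U \<tau> x" if "\<tau> > 0" for \<tau> x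
  proof -
    have "resolvent A D 0 (0 *\<^sub>R U \<tau> x - A (U \<tau> x)) = U \<tau> x"
      using res[of 0] UD[OF that, of x] unfolding is_resolvent_def by blast
    then show ?thesis using UD[OF that, of x] by simp
  qed
  \<comment> \<open>Comes from \<open>R0\<close> and the factorization of the resolvent at 0, whose
    outer factor is \<open>neg_power\<close> divided by c. Injectivity of \<open>neg_power\<close>
    identifies the result with \<open>pos_power\<close> after \<open>U \<tau>\<close>, whatever the
    value of \<mu>.\<close>
  define K where "K \<tau> = (- \<mu> / c) *\<^sub>R (power_integral \<alpha> o\<^sub>L UD \<tau>)" for \<tau>
  have inv: "pos_power A D \<alpha> (U \<tau> v) = K \<tau> v" if \<tau>: "\<tau> > 0" for \<tau> v
  proof -
    have "neg_power A D \<alpha> (K \<tau> v) = \<mu> *\<^sub>R power_integral (1 - \<alpha>) (power_integral \<alpha> (- UD \<tau> v))"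
      using c by (simp add: neg K_def scaleR_blinfun.rep_eq uminus_blinfun.rep_eq blinfun.scaleR_right blinfun.minus_right)
    also have "\<dots> = U \<tau> v"
      using R0[OF \<tau>, of v] unfolding \<mu> by (simp add: scaleR_blinfun.rep_eq)
    finally have "pos_power A D \<alpha> (U \<tau> v) = inv (neg_power A D \<alpha>) (neg_power A D \<alpha> (K \<tau> v))"
      by (simp add: pos_power_def)
    also have "\<dots> = K \<tau> v" using pw by (intro inv_f_f) (simp add: powers_defined_def)
    finally show ?thesis .
  qed
  define C2 where "C2 = \<bar>\<mu> / c\<bar> * ((1 + M) / \<alpha> * CU + M / (1 - \<alpha>) * C1)"
  have K_bound: "norm (K \<tau>) \<le> C2 * \<tau> powr (- \<alpha>)" if \<tau>: "\<tau> \<in> {0<..T}" for \<tau>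
  proof (rule norm_blinfun_bound)
    have C1: "C1 \<ge> 0"
      using order_trans[OF norm_ge_zero UD_bound[OF \<tau>]] \<tau> by (simp add: zero_le_divide_iff)
    then show "0 \<le> C2 * \<tau> powr (- \<alpha>)"
      using M \<alpha> CU(1) positive_resolvent.M[OF positive_resolvent_axioms] by (simp add: C2_def)
    fix v
    let ?P = "(1 + M) / \<alpha>" and ?Q = "M / (1 - \<alpha>)"
    have PQ: "?P \<ge> 0" "?Q \<ge> 0"
      using \<alpha> positive_resolvent.M[OF positive_resolvent_axioms] by auto
    then have "?Q * \<tau> \<ge> 0" using \<tau> by (intro mult_nonneg_nonneg) auto
    note PQ = PQ this
    \<comment> \<open>Interpolation with \<open>U \<tau> v\<close> as the image of
      \<open>- UD \<tau> v\<close> under the resolvent at 0; the factor \<tau> cancels against the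
      bound C1 / \<tau>.\<close>
    have "norm (power_integral \<alpha> (- UD \<tau> v)) \<le> \<tau> powr (- \<alpha>) * (?P * norm (U \<tau> v) + ?Q * \<tau> * norm (- UD \<tau> v))"
      using \<tau> R0[of \<tau> v] by (intro power_integral_interpolation[OF \<alpha>]) auto
    also have "\<dots> \<le> \<tau> powr (- \<alpha>) * (?P * (CU * norm v) + ?Q * \<tau> * (C1 / \<tau> * norm v))"
      unfolding norm_minus_cancel using \<tau> PQ
      by (intro mult_left_mono add_mono order_trans[OF norm_blinfun] mult_right_mono CU UD_bound) auto
    also have "\<dots> = \<tau> powr (- \<alpha>) * (?P * CU + ?Q * C1) * norm v"
      using \<tau> by (simp add: algebra_simps)
    finally have "\<bar>\<mu> / c\<bar> * norm (power_integral \<alpha> (- UD \<tau> v)) \<le> \<bar>\<mu> / c\<bar> * (\<tau> powr (- \<alpha>) * (?P * CU + ?Q * C1) * norm v)"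
      by (intro mult_left_mono) auto
    then show "norm (K \<tau> v) \<le> C2 * \<tau> powr (- \<alpha>) * norm v"
      by (simp add: K_def C2_def scaleR_blinfun.rep_eq uminus_blinfun.rep_eq blinfun.minus_right abs_mult ac_simps)
  qed
  define C where "C = max CU C2"
  have "mild_kernel U K T \<alpha> C"
  proof
    show "U 0 = id_blinfun" using C0 by (simp add: C0_semigroup_def)
    show "continuous_on {0..T} (\<lambda>t. U t v)" for v by (rule C0_semigroup_strongly_continuous[OF C0])
    show "norm (U t) \<le> C" if "t \<in> {0..T}" for t using CU(2)[OF that] by (simp add: C_def)
    show "continuous_on {0<..T} (\<lambda>t. K t v)" for v
      unfolding K_def scaleR_blinfun.rep_eq blinfun_apply_blinfun_compose
      by (intro continuous_on_scaleR continuous_on_const bounded_linear.continuous_on[OF blinfun.bounded_linear_right] UD_cont)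
    show "norm (K t) \<le> C * t powr (- \<alpha>)" if "t \<in> {0<..T}" for t
      by (rule order_trans[OF K_bound[OF that]]) (simp add: C_def mult_right_mono)
  qed (use T \<alpha> CU(1) in \<open>auto simp: C_def\<close>)
  then show ?thesis using inv by (intro exI[of _ K] exI[of _ C]) auto
qed

lemma contractive_kernel:
  fixes U :: "real \<Rightarrow> 'e::banach \<Rightarrow>\<^sub>L 'e"
  assumes C0: "C0_semigroup U" and T: "T > 0"
  shows "\<exists>C. mild_kernel U U T 0 C"
proof -
  obtain CU where CU: "CU \<ge> 1" "\<And>t. t \<in> {0..T} \<Longrightarrow> norm (U t) \<le> CU"
    using C0_semigroup_bounded[OF C0] by metis
  have "mild_kernel U U T 0 CU"
  proof
    show "continuous_on {0<..T} (\<lambda>t. U t v)" for v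
      by (rule continuous_on_subset[OF C0_semigroup_strongly_continuous[OF C0, of T]]) auto
  qed (use C0 T CU in \<open>auto simp: C0_semigroup_def intro: C0_semigroup_strongly_continuous[OF C0]\<close>)
  then show ?thesis ..
qed

section \<open>The periodic problem\<close>

text \<open>Ties the abstract kernel to \<open>pos_power\<close>. The link is stated for positive
  times, since at time 0 the vector may lie outside the domain of the power.\<close>

locale mild_setting = mild_problem U K T \<alpha> C "\<lambda>s z. f s (neg_power A D \<alpha> z)" F' "\<lambda>s z. g s (neg_power A D \<alpha> z)" L
  for U K :: "real \<Rightarrow> 'e::banach \<Rightarrow>\<^sub>L 'e" and T \<alpha> C :: real and A :: "'e \<Rightarrow> 'e" and D
    and f :: "real \<Rightarrow> 'e \<Rightarrow> 'e" and g :: "real \<Rightarrow> 'e \<Rightarrow> real \<Rightarrow> 'e"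
    and F' :: "real \<Rightarrow> 'e \<Rightarrow> 'e \<Rightarrow>\<^sub>L 'e" and L +
  assumes pos_power_U: "\<And>\<tau> v. \<tau> \<in> {0<..T} \<Longrightarrow> pos_power A D \<alpha> (U \<tau> v) = K \<tau> v"
begin

text \<open>The two integrands can differ only at s = t, a single point.\<close>

lemma has_integral_pos_power_iff:
  assumes t: "t \<in> {0..T}"
    and H: "\<And>s. s \<in> {0..<t} \<Longrightarrow> H s = pos_power A D \<alpha> (U (t - s) (\<Phi> s))"
    and \<Phi>: "continuous_on {0..t} \<Phi>"
  shows "(H has_integral y) {0..t} \<longleftrightarrow> y = conv \<Phi> t"
proof -
  have "(H has_integral y) {0..t} \<longleftrightarrow> ((\<lambda>s. K (t - s) (\<Phi> s)) has_integral y) {0..t}"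
    by (rule has_integral_spike_finite_eq[of "{t}"]) (use t H pos_power_U in auto)
  then show ?thesis
    using conv_has_integral[OF t \<Phi>] has_integral_unique by metis
qed

lemma mild_solution_iff:
  assumes d: "d \<in> {0..T}" and e: "e \<in> {0..1}"
  shows "mild_solution A D U \<alpha> f g e d x \<longleftrightarrow> mild e d x"
proof -
  have "(x t - U t (x 0) = conv (\<lambda>s. f s (neg_power A D \<alpha> (x s)) + e *\<^sub>R g s (neg_power A D \<alpha> (x s)) e) t) \<longleftrightarrow>
      ((\<lambda>s. pos_power A D \<alpha> (U (t - s) (f s (neg_power A D \<alpha> (x s)) + e *\<^sub>R g s (neg_power A D \<alpha> (x s)) e)))
         has_integral (x t - U t (x 0))) {0..t}"
    if x: "continuous_on {0..d} x" and t: "t \<in> {0..d}" for t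
  proof (rule has_integral_pos_power_iff[symmetric])
    have "continuous_on {0..t} x" by (rule continuous_on_subset[OF x]) (use t in auto)
    then show "continuous_on {0..t} (\<lambda>s. f s (neg_power A D \<alpha> (x s)) + e *\<^sub>R g s (neg_power A D \<alpha> (x s)) e)"
      using e by (intro continuous_intros) auto
  qed (use t d in auto)
  then show ?thesis
    unfolding mild_solution_def mild_def by (auto simp: diff_eq_eq add.commute)
qed

text \<open>Uniqueness on [0, t] gives the definite description in \<open>solution\<close> its
  expected value.\<close>

lemma solution_eq:
  assumes z: "mild 0 T z" and t: "t \<in> {0..T}"
  shows "solution A D U \<alpha> f g (z 0) 0 t = z t"
  unfolding solution_def
proof (rule the_equality)
  have "mild_solution A D U \<alpha> f g 0 t z"
    using mild_restrict[OF z t] mild_solution_iff[OF t] by simp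
  then show "\<exists>x. mild_solution A D U \<alpha> f g 0 t x \<and> x 0 = z 0 \<and> z t = x t" by blast
  fix v assume "\<exists>x. mild_solution A D U \<alpha> f g 0 t x \<and> x 0 = z 0 \<and> v = x t"
  then obtain x where x: "mild_solution A D U \<alpha> f g 0 t x" "x 0 = z 0" "v = x t" by blast
  then have "mild 0 t x" using mild_solution_iff[OF t] by simp
  from mild_unique[OF t this mild_restrict[OF z t] x(2)] show "v = z t"
    using x(3) t by simp
qed

end

locale mild_setting_at = mild_setting U K T \<alpha> C A D f g F' L +
  mild_problem_at U K T \<alpha> C "\<lambda>s z. f s (neg_power A D \<alpha> z)" F' "\<lambda>s z. g s (neg_power A D \<alpha> z)" L x0
  for U K :: "real \<Rightarrow> 'e::banach \<Rightarrow>\<^sub>L 'e" and T \<alpha> C :: real and A :: "'e \<Rightarrow> 'e" and D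
    and f :: "real \<Rightarrow> 'e \<Rightarrow> 'e" and g :: "real \<Rightarrow> 'e \<Rightarrow> real \<Rightarrow> 'e"
    and F' :: "real \<Rightarrow> 'e \<Rightarrow> 'e \<Rightarrow>\<^sub>L 'e" and L and x0
begin

lemma poincare_deriv_minus_id_eq:
  "poincare_deriv_minus_id A D U \<alpha> f g T (x0 0) v = tangent_curve v T - v"
proof -
  have "(poincare A D U \<alpha> f g T 0 has_derivative (\<lambda>\<beta>. tangent_curve \<beta> T)) (at (x0 0))"
    by (rule time_map_has_derivative) (use solution_eq T in \<open>simp add: poincare_def\<close>)
  then show ?thesis
    unfolding poincare_deriv_minus_id_def by (simp flip: frechet_derivative_at)
qed

lemma variational_solution_iff:
  "variational_solution A D U \<alpha> f g T (x0 0) y \<longleftrightarrow> linear_mild (conv (\<lambda>s. g s (neg_power A D \<alpha> (x0 s)) 0)) y"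
proof -
  let ?G = "\<lambda>s. g s (neg_power A D \<alpha> (x0 s)) 0"
  have "(y t = conv ?G t + conv (\<lambda>s. B s (y s)) t) \<longleftrightarrow>
      ((\<lambda>s. let x = solution A D U \<alpha> f g (x0 0) 0 s in pos_power A D \<alpha> (U (t - s)
          (frechet_derivative (\<lambda>z. f s (neg_power A D \<alpha> z)) (at x) (y s) + g s (neg_power A D \<alpha> x) 0)))
        has_integral y t) {0..t}"
    if y: "continuous_on {0..T} y" and t: "t \<in> {0..T}" for t
  proof -
    have c: "continuous_on {0..t} ?G" "continuous_on {0..t} (\<lambda>s. B s (y s))"
      by (rule continuous_on_subset[of "{0..T}"], intro G0_cont continuous_on_B_apply y, use t in auto)+
    show ?thesis
      unfolding conv_add[OF t c, symmetric]
    proof (rule has_integral_pos_power_iff[OF t, symmetric])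
      fix s assume s: "s \<in> {0..<t}"
      have "frechet_derivative (\<lambda>z. f s (neg_power A D \<alpha> z)) (at (x0 s)) = B s"
        using frechet_derivative_at[OF F_deriv[of s "x0 s"]] by simp
      then show "(let x = solution A D U \<alpha> f g (x0 0) 0 s in pos_power A D \<alpha> (U (t - s)
          (frechet_derivative (\<lambda>z. f s (neg_power A D \<alpha> z)) (at x) (y s) + g s (neg_power A D \<alpha> x) 0)))
        = pos_power A D \<alpha> (U (t - s) (?G s + B s (y s)))"
        using solution_eq[OF x0, of s] s t by (simp add: Let_def add.commute)
    qed (intro continuous_intros c)
  qed
  then show ?thesis
    unfolding variational_solution_def linear_mild_def by auto
qed

lemma eta_eq: "eta A D U \<alpha> f g T (x0 0) = forced_curve T"
  unfolding eta_def
proof (rule the_equality)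
  show "\<exists>y. variational_solution A D U \<alpha> f g T (x0 0) y \<and> forced_curve T = y T"
    using forced_curve variational_solution_iff by blast
  fix v assume "\<exists>y. variational_solution A D U \<alpha> f g T (x0 0) y \<and> v = y T"
  then show "v = forced_curve T"
    using linear_mild_unique[OF _ forced_curve, of _ T] variational_solution_iff T by auto
qed

end

text \<open>The two cases merge here; what follows uses only the common setting.\<close>

lemma exists_mild_setting:
  fixes A :: "'e::banach \<Rightarrow> 'e"
  assumes T: "T > 0" and f: "C1_on (\<lambda>(t, x). f t x) UNIV"
    and cases: "analytic_compact_case A D U \<alpha> f g \<or> (\<alpha> = 0 \<and> contractive_case A D U f g)"
  shows "\<exists>K C F' L. mild_setting U K T \<alpha> C A D f g F' L"
proof -
  have "\<exists>K C. mild_kernel U K T \<alpha> C \<and> (\<forall>\<tau>\<in>{0<..T}. \<forall>v. pos_power A D \<alpha> (U \<tau> v) = blinfun_apply (K \<tau>) v)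
      \<and> bounded_linear (neg_power A D \<alpha>)
      \<and> lipschitz_hypotheses (\<lambda>t x. f t (neg_power A D \<alpha> x)) (\<lambda>t x \<epsilon>. g t (neg_power A D \<alpha> x) \<epsilon>)"
    using cases
  proof
    assume a: "analytic_compact_case A D U \<alpha> f g"
    then have "\<exists>K C. mild_kernel U K T \<alpha> C \<and> (\<forall>\<tau>\<in>{0<..T}. \<forall>v. pos_power A D \<alpha> (U \<tau> v) = blinfun_apply (K \<tau>) v)"
      unfolding analytic_compact_case_def by (intro analytic_kernel[OF _ _ T]) auto
    then show ?thesis
      using a by (auto simp: analytic_compact_case_def powers_defined_def)
  next
    assume a: "\<alpha> = 0 \<and> contractive_case A D U f g"
    then have "C0_semigroup U" by (simp add: contractive_case_def)
    from contractive_kernel[OF this T] obtain C where C: "mild_kernel U U T 0 C" ..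
    have np: "neg_power A D 0 = (\<lambda>x. x)" by (auto simp: neg_power_def)
    then have pp: "pos_power A D 0 = (\<lambda>x. x)"
      unfolding pos_power_def by (simp add: inv_equality)
    show ?thesis
      using a C by (auto simp: np pp contractive_case_def bounded_linear_ident)
  qed
  then obtain K C where K: "mild_kernel U K T \<alpha> C"
    and pp: "\<forall>\<tau>\<in>{0<..T}. \<forall>v. pos_power A D \<alpha> (U \<tau> v) = blinfun_apply (K \<tau>) v"
    and bl: "bounded_linear (neg_power A D \<alpha>)"
    and lip: "lipschitz_hypotheses (\<lambda>t x. f t (neg_power A D \<alpha> x)) (\<lambda>t x \<epsilon>. g t (neg_power A D \<alpha> x) \<epsilon>)"
    by (elim exE conjE)
  obtain F' L1 where F': "\<forall>t x. ((\<lambda>x. f t (neg_power A D \<alpha> x)) has_derivative blinfun_apply (F' t x)) (at x)"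
      "continuous_on UNIV (\<lambda>(t, x). F' t x)" "\<forall>t x y. norm (F' t x - F' t y) \<le> L1 * norm (x - y)"
    using lip unfolding lipschitz_hypotheses_def by (elim exE conjE)
  obtain L2 where G: "continuous_on (UNIV \<times> UNIV \<times> {0..1}) (\<lambda>(t, x, \<epsilon>). g t (neg_power A D \<alpha> x) \<epsilon>)"
      "\<forall>t x y. \<forall>\<epsilon>\<in>{0..1}. norm (g t (neg_power A D \<alpha> x) \<epsilon> - g t (neg_power A D \<alpha> y) \<epsilon>) \<le> L2 * norm (x - y)"
    using lip unfolding lipschitz_hypotheses_def by (elim exE conjE)
  define L where "L = max 1 (max L1 L2)"
  have le: "L1 * n \<le> L * n" "L2 * n \<le> L * n" if "n \<ge> 0" for n
    using that by (auto simp: L_def intro: mult_right_mono)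
  have fc: "continuous_on UNIV (\<lambda>(t, x). f t x)"
    using f unfolding C1_on_def
    by (metis UNIV_I continuous_at_imp_continuous_on has_derivative_continuous)
  interpret mild_kernel U K T \<alpha> C by (rule K)
  have "mild_setting U K T \<alpha> C A D f g F' L"
  proof
    show "1 \<le> L" by (simp add: L_def)
    have "continuous_on UNIV (\<lambda>p. (fst p, neg_power A D \<alpha> (snd p)))"
      by (intro continuous_intros bounded_linear.continuous_on[OF bl])
    from continuous_on_compose2[OF fc this]
    show "continuous_on UNIV (\<lambda>(t, x). f t (neg_power A D \<alpha> x))" by (simp add: split_beta)
    show "norm (F' t x - F' t y) \<le> L * norm (x - y)" for t x y
      using F'(3) le(1)[of "norm (x - y)"] by (meson norm_ge_zero order_trans)
    show "norm (g t (neg_power A D \<alpha> x) e - g t (neg_power A D \<alpha> y) e) \<le> L * norm (x - y)" if "e \<in> {0..1}" for t x y e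
      using G(2) that le(2)[of "norm (x - y)"] by (meson norm_ge_zero order_trans)
  qed (use F' G pp in auto)
  then show ?thesis by blast
qed

theorem theorem4p1:
  fixes A :: "'e::banach \<Rightarrow> 'e" and D :: "'e set" and U :: "real \<Rightarrow> 'e \<Rightarrow>\<^sub>L 'e"
    and f :: "real \<Rightarrow> 'e \<Rightarrow> 'e" and g :: "real \<Rightarrow> 'e \<Rightarrow> real \<Rightarrow> 'e"
    and T \<alpha> :: real and \<xi>0 :: 'e
    and V :: "(real ^ 'k) set" and S :: "real ^ 'k \<Rightarrow> 'e" and h0 :: "real ^ 'k"
    and E1 E2 :: "real ^ 'k \<Rightarrow> 'e set" and \<pi>1 \<pi>2 :: "real ^ 'k \<Rightarrow> 'e \<Rightarrow>\<^sub>L 'e"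
    and \<epsilon> :: "nat \<Rightarrow> real" and x :: "nat \<Rightarrow> real \<Rightarrow> 'e"
  assumes "T > 0"
    and "C1_on (\<lambda>(t, x). f t x) UNIV"
    and "continuous_on (UNIV \<times> UNIV \<times> {0..1}) (\<lambda>(t, x, e). g t x e)"
    and "\<And>t x. f (t + T) x = f t x"
    and "\<And>t x e. e \<in> {0..1} \<Longrightarrow> g (t + T) x e = g t x e"
    and "analytic_compact_case A D U \<alpha> f g \<or> (\<alpha> = 0 \<and> contractive_case A D U f g)"
    and "solution_exists A D U \<alpha> f g 0 T \<xi>0"
    and "open V" and "h0 \<in> V" and "C1_on S V" and "S h0 = \<xi>0"
    and "\<And>\<xi>. \<xi> \<in> (\<Union>h\<in>V. {S h}) \<Longrightarrow>
           solution_exists A D U \<alpha> f g 0 T \<xi> \<and> poincare A D U \<alpha> f g T 0 \<xi> = \<xi>"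
    and "dim (range (frechet_derivative S (at h0))) = CARD('k)"
    and "\<And>h. h \<in> V \<Longrightarrow> E1 h = range (frechet_derivative S (at h))"
    and "\<And>h. h \<in> V \<Longrightarrow> complementary (E1 h) (E2 h)"
    and "\<And>h. h \<in> V \<Longrightarrow> projector_onto_along (\<pi>1 h) (E1 h) (E2 h)"
    and "\<And>h. h \<in> V \<Longrightarrow> projector_onto_along (\<pi>2 h) (E2 h) (E1 h)"
    and "continuous_on V \<pi>1" and "continuous_on V \<pi>2"
    and "bij_betw (\<lambda>v. \<pi>2 h0 (poincare_deriv_minus_id A D U \<alpha> f g T \<xi>0 (\<pi>2 h0 v))) (E2 h0) (E2 h0)"
    and "\<And>n. \<epsilon> n \<in> {0<..1}" and "\<epsilon> \<longlonglongrightarrow> 0"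
    and "\<And>n. mild_solution A D U \<alpha> f g (\<epsilon> n) T (x n)"
    and "\<And>n. x n 0 = x n T"
    and "uniform_limit {0..T} x (solution A D U \<alpha> f g \<xi>0 0) sequentially"
  shows "bifurcation_function A D U \<alpha> f g T S E2 \<pi>1 \<pi>2 h0 = 0"
proof -
  note T = assms(1) and h0 = assms(9) and Sh0 = assms(11)
  obtain K C F' L where "mild_setting U K T \<alpha> C A D f g F' L"
    using exists_mild_setting[OF assms(1,2,6)] by blast
  then interpret mild_setting U K T \<alpha> C A D f g F' L .
  have TT: "T \<in> {0..T}" using T by simp
  obtain x0 where x0: "mild 0 T x0" "x0 0 = \<xi>0"
    using assms(7) mild_solution_iff[OF TT, of 0] by (auto simp: solution_exists_def)
  note x0_initial = x0(2)
  interpret mild_setting_at U K T \<alpha> C A D f g F' L x0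
    by unfold_locales (rule x0(1))
  obtain S' where S': "\<And>h. h \<in> V \<Longrightarrow> (S has_derivative blinfun_apply (S' h)) (at h)" "continuous_on V S'"
    using assms(10) unfolding C1_on_def by (elim exE conjE) (rule that, simp_all)
  have fd: "frechet_derivative S (at h0) = S' h0"
    using frechet_derivative_at[OF S'(1)[OF h0]] by simp
  have lin: "linear (S' h0)" by (rule bounded_linear.linear[OF blinfun.bounded_linear_right])
  have inj: "inj (S' h0)"
    using assms(13) by (intro inj_linear_of_dim_range lin) (simp add: fd)
  have E1: "E1 h0 = range (S' h0)" using assms(14)[OF h0] by (simp add: fd)
  have per: "\<exists>z. mild 0 T z \<and> z 0 = S h \<and> z T = S h" if h: "h \<in> V" for h
  proof -
    have s: "solution_exists A D U \<alpha> f g 0 T (S h)" "poincare A D U \<alpha> f g T 0 (S h) = S h"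
      using assms(12)[of "S h"] h by auto
    then obtain z where z: "mild 0 T z" "z 0 = S h"
      using mild_solution_iff[OF TT, of 0] by (auto simp: solution_exists_def)
    then have "z T = S h"
      using solution_eq[OF z(1) TT] s(2) by (simp add: poincare_def)
    then show ?thesis using z by blast
  qed
  have "bounded_linear (\<lambda>\<beta>. tangent_curve \<beta> T - \<beta>)"
    by (intro bounded_linear_sub bounded_linear_tangent_curve bounded_linear_ident)
  note Q = bounded_linear_Blinfun_apply[OF this, THEN fun_cong]
  define Q where "Q = Blinfun (\<lambda>\<beta>. tangent_curve \<beta> T - \<beta>)"
  note Q = Q[folded Q_def]
  have Pd: "poincare_deriv_minus_id A D U \<alpha> f g T \<xi>0 = blinfun_apply Q"
    using poincare_deriv_minus_id_eq by (auto simp: Q x0_initial)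
  \<comment> \<open>\<open>solution\<close> is known to agree with \<open>x0\<close> on [0, T],
    which is all that uniform convergence there sees.\<close>
  have ul: "uniform_limit {0..T} x x0 sequentially"
    using assms(25) by (rule uniform_limit_cong'[THEN iffD1, rotated 2]) (use solution_eq[OF x0] x0_initial in auto)
  have "forced_curve T = Q (inv_into (E2 h0) (\<lambda>v. \<pi>2 h0 (Q (\<pi>2 h0 v))) (\<pi>2 h0 (forced_curve T)))"
  proof (rule forced_curve_in_range[OF assms(8,9) S' _ inj per])
    show "S h0 = x0 0" using Sh0 x0_initial by simp
    show "complementary (range (S' h0)) (E2 h0)" using assms(15)[OF h0] by (simp add: E1)
    show "projector_onto_along (\<pi>1 h0) (range (S' h0)) (E2 h0)" using assms(16)[OF h0] by (simp add: E1)
    show "projector_onto_along (\<pi>2 h0) (E2 h0) (range (S' h0))" using assms(17)[OF h0] by (simp add: E1)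
    show "bij_betw (\<lambda>v. \<pi>2 h0 (Q (\<pi>2 h0 v))) (E2 h0) (E2 h0)" using assms(20) by (simp add: Pd)
    show "mild (\<epsilon> n) T (x n)" for n
      using mild_solution_iff[OF TT, of "\<epsilon> n"] assms(21)[of n] assms(23)[of n] by auto
  qed (use assms(21,22,24) ul Q in auto)
  \<comment> \<open>The bracket in the bifurcation function vanishes by the identity just proved;
    injectivity of \<open>S' h0\<close> then makes its \<open>inv\<close> send 0 to 0.\<close>
  then have "bifurcation_function A D U \<alpha> f g T S E2 \<pi>1 \<pi>2 h0 = inv (S' h0) (\<pi>1 h0 0)"
    unfolding bifurcation_function_def Let_def Sh0 Pd fd
    using eta_eq by (simp add: x0_initial)
  also have "\<dots> = 0"
    using inv_f_f[OF inj, of 0] by simp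
  finally show ?thesis .
qed

end
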